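(* Let $K$ be a field, $f:\mathbb Z_{\ge0}\to\mathbb R_{\ge0}$ an increasing function with $\sum_{\alpha\ge0}f(2^\alpha)/2^\alpha<+\infty$, and $B=\bigoplus_{n\ge0}B_n$ an integral graded $K$-algebra of finite type, generated by $B_1$. Suppose (i) the Krull dimension of $B$ is $>0$; (ii) each $B_n$ ($n\ge1$) carries a separated, exhaustive, left continuous $\mathbb R$-filtration making $B$ an $f$-pseudo-filtered graded $K$-algebra; (iii) $\limsup_{n\to\infty}\sup_{0\ne a\in B_n}\lambda(a)/n<+\infty$. Let $\nu_n=T_{1/n}\nu_{B_n}$. Then the supports of the $\nu_n$ ($n\ge1$) lie in a common bounded interval and $(\nu_n)_{n\ge1}$ converges vaguely to a Borel probability measure on $\mathbb R$.
   Context: Filtrations: decreasing families $(B_{n,s})_{s\in\mathbb R}$ of subspaces; separated: $\bigcap_sB_{n,s}=0$; exhaustive: $\bigcup_sB_{n,s}=B_n$; left continuous: $B_{n,s}=\bigcap_{t<s}B_{n,t}$; index $\lambda(a)=\sup\{s:a\in B_{n,s}\}$. $B$ is $f$-pseudo-filtered if $B_{n,s}B_{m,t}\subseteq B_{n+m,\,s+t-f(n)-f(m)}$ for all sufficiently large integers $n,m$ and all $s,t\in\mathbb R$. For nonzero finite-dimensional $W$, $\nu_W$ is the Borel probability measure with $\nu_W([r,+\infty[)=\dim\mathcal F_rW/\dim W$. $T_\varepsilon\nu$: image of $\nu$ under $x\mapsto\varepsilon x$. Vague convergence: convergence of integrals of continuous compactly supported functions. *)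

theory Defs
  imports "HOL-Probability.Probability"
begin

definition k_algebra :: "('k::field \<Rightarrow> 'b::comm_ring_1 \<Rightarrow> 'b) \<Rightarrow> bool" where
  "k_algebra sc \<longleftrightarrow> vector_space sc \<and> (\<forall>c a b. sc c (a * b) = sc c a * b)"

inductive_set alg_gen :: "('k \<Rightarrow> 'b::comm_ring_1 \<Rightarrow> 'b) \<Rightarrow> 'b set \<Rightarrow> 'b set"
  for sc :: "'k \<Rightarrow> 'b \<Rightarrow> 'b" and S :: "'b set" where
  gen: "x \<in> S \<Longrightarrow> x \<in> alg_gen sc S"
| one: "1 \<in> alg_gen sc S"
| add: "x \<in> alg_gen sc S \<Longrightarrow> y \<in> alg_gen sc S \<Longrightarrow> x + y \<in> alg_gen sc S"
| mult: "x \<in> alg_gen sc S \<Longrightarrow> y \<in> alg_gen sc S \<Longrightarrow> x * y \<in> alg_gen sc S"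
| scale: "x \<in> alg_gen sc S \<Longrightarrow> sc c x \<in> alg_gen sc (S)"

definition finite_type :: "('k \<Rightarrow> 'b::comm_ring_1 \<Rightarrow> 'b) \<Rightarrow> bool" where
  "finite_type sc \<longleftrightarrow> (\<exists>G. finite G \<and> alg_gen sc G = UNIV)"

definition graded_algebra :: "('k::field \<Rightarrow> 'b::comm_ring_1 \<Rightarrow> 'b) \<Rightarrow> (nat \<Rightarrow> 'b set) \<Rightarrow> bool" where
  "graded_algebra sc B \<longleftrightarrow>
     k_algebra sc \<and>
     (\<forall>n. module.subspace sc (B n)) \<and>
     (\<forall>n m a b. a \<in> B n \<longrightarrow> b \<in> B m \<longrightarrow> a * b \<in> B (n + m)) \<and>
     1 \<in> B 0 \<and>
     (\<forall>x. \<exists>!c :: nat \<Rightarrow> 'b. finite {n. c n \<noteq> 0} \<and> (\<forall>n. c n \<in> B n) \<and>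
            x = (\<Sum>n\<in>{n. c n \<noteq> 0}. c n))"

definition ring_ideal :: "'b::comm_ring_1 set \<Rightarrow> bool" where
  "ring_ideal I \<longleftrightarrow> 0 \<in> I \<and> (\<forall>x\<in>I. \<forall>y\<in>I. x + y \<in> I) \<and> (\<forall>r. \<forall>x\<in>I. r * x \<in> I)"

definition prime_ideal :: "'b::comm_ring_1 set \<Rightarrow> bool" where
  "prime_ideal P \<longleftrightarrow> ring_ideal P \<and> P \<noteq> UNIV \<and> (\<forall>a b. a * b \<in> P \<longrightarrow> a \<in> P \<or> b \<in> P)"

definition krull_dim :: "'b::comm_ring_1 itself \<Rightarrow> enat" where
  "krull_dim _ = Sup {enat n | n. \<exists>P :: nat \<Rightarrow> 'b set.
      (\<forall>i\<le>n. prime_ideal (P i)) \<and> (\<forall>i<n. P i \<subset> P (Suc i))}"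

definition filtration_on ::
  "('k::field \<Rightarrow> 'b::comm_ring_1 \<Rightarrow> 'b) \<Rightarrow> 'b set \<Rightarrow> (real \<Rightarrow> 'b set) \<Rightarrow> bool" where
  "filtration_on sc W F \<longleftrightarrow>
     (\<forall>s. module.subspace sc (F s) \<and> F s \<subseteq> W) \<and>
     (\<forall>s t. s \<le> t \<longrightarrow> F t \<subseteq> F s)"

definition separated :: "(real \<Rightarrow> 'b::zero set) \<Rightarrow> bool" where
  "separated F \<longleftrightarrow> (\<Inter>s. F s) = {0}"

definition exhaustive :: "'b set \<Rightarrow> (real \<Rightarrow> 'b set) \<Rightarrow> bool" where
  "exhaustive W F \<longleftrightarrow> (\<Union>s. F s) = W"

definition left_continuous :: "(real \<Rightarrow> 'b set) \<Rightarrow> bool" where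
  "left_continuous F \<longleftrightarrow> (\<forall>s. F s = (\<Inter>t\<in>{..<s}. F t))"

definition filt_index :: "(real \<Rightarrow> 'b set) \<Rightarrow> 'b \<Rightarrow> ereal" where
  "filt_index F a = (SUP s\<in>{s. a \<in> F s}. ereal s)"

definition pseudo_filtered ::
  "(nat \<Rightarrow> real) \<Rightarrow> (nat \<Rightarrow> real \<Rightarrow> 'b::comm_ring_1 set) \<Rightarrow> bool" where
  "pseudo_filtered f F \<longleftrightarrow> (\<exists>N. \<forall>n m. N \<le> n \<longrightarrow> N \<le> m \<longrightarrow> (\<forall>s t.
      \<forall>a\<in>F n s. \<forall>b\<in>F m t. a * b \<in> F (n + m) (s + t - f n - f m)))"

definition filt_measure ::
  "('k::field \<Rightarrow> 'b::comm_ring_1 \<Rightarrow> 'b) \<Rightarrow> 'b set \<Rightarrow> (real \<Rightarrow> 'b set) \<Rightarrow> real measure" where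
  "filt_measure sc W F = (THE \<nu>. prob_space \<nu> \<and> sets \<nu> = sets borel \<and>
      (\<forall>r. measure \<nu> {r..} = real (vector_space.dim sc (F r)) / real (vector_space.dim sc W)))"

definition dilate :: "real \<Rightarrow> real measure \<Rightarrow> real measure" where
  "dilate \<epsilon> \<nu> = distr \<nu> borel (\<lambda>x. \<epsilon> * x)"

definition vague_conv :: "(nat \<Rightarrow> real measure) \<Rightarrow> real measure \<Rightarrow> bool" where
  "vague_conv \<nu> \<mu> \<longleftrightarrow> (\<forall>g :: real \<Rightarrow> real. continuous_on UNIV g \<longrightarrow>
      compact (closure {x. g x \<noteq> 0}) \<longrightarrow>
      (\<lambda>n. integral\<^sup>L (\<nu> n) g) \<longlonglongrightarrow> integral\<^sup>L \<mu> g)"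

end

theory Submission
  imports Defs "HOL-Computational_Algebra.Polynomial_Factorial"
begin

text \<open>
  Let \<open>d + 1\<close> be the transcendence degree of \<open>B\<close>, and \<open>x\<^sub>0, \<dots>, x\<^sub>d\<close> algebraically independent elements of
  \<open>B\<^sub>1\<close>. Giving the \<open>x\<^sub>i\<close> rationally independent real weights defines a monomial valuation, which extends
  (Chevalley) to a valuation \<open>v\<close> of the fraction field. Its values on homogeneous elements lie in a group
  containing the group \<open>\<Gamma>\<close> generated by the weights with bounded exponent \<open>E\<close>, and its graded pieces have
  bounded dimension; let \<open>r\<close> be the maximal one, attained by a family \<open>U\<close>.
  For a subspace \<open>V\<close> of \<open>B\<^sub>n\<close> and \<open>k \<equiv> 1 (mod E)\<close>, pick \<open>b\<^sub>s\<close> in \<open>V\<close> of value \<open>s\<close> for each value \<open>s\<close> of \<open>V\<close>. The elements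
  \<open>b\<^sub>s\<^sup>k x\<^sup>j u\<close>, with \<open>u\<close> in \<open>U\<close> and \<open>j\<close> in a box with \<open>k\<^sup>d\<close> points, are linearly independent, because \<open>ks + j\<close>
  determines \<open>s\<close> and \<open>j\<close>. Hence the \<open>k\<close>-th powers of \<open>V\<close>, multiplied by a graded piece of degree about \<open>dk\<close>, span
  a space of dimension at least \<open>k\<^sup>d dim V\<close>.

  Applied to \<open>V = F\<^sub>n(nx)\<close>, and with the errors of the pseudo-filtration controlled by the dyadic sum, this
  yields \<open>liminf dim F\<^sub>n(ny) / n\<^sup>d \<ge> limsup dim F\<^sub>n(nx) / n\<^sup>d\<close> for all \<open>y < x\<close>. So all subsequential
  weak limits of the uniformly boundedly supported measures coincide.
\<close>

section \<open>Valuation rings\<close>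

text \<open>The comparison of dimensions has to be asymptotically sharp: losing a constant factor
  would bound ratios of tail fractions without making their limits agree. Counting the values of
  \<open>V\<close> loses up to the factor \<open>r\<close>, since only
  \<open>dim V \<le> r * card S\<close> holds for its set of values \<open>S\<close>; the family
  \<open>U\<close> has exactly \<open>r\<close> elements and all its nonzero combinations share one
  value, so multiplying by \<open>U\<close> restores that factor. Powers of a single element are
  used because the index of \<open>b ^ j\<close> is an almost superadditive function of
  \<open>j\<close>. Its total loss is at most \<open>2 * k * dyadic_err f n\<close>, and
  \<open>dyadic_err f n\<close> is small compared with \<open>n\<close>. The extra factor, of degree
  \<open>q\<close> about \<open>k * d\<close>, costs little: all of \<open>B q\<close> lies in
  \<open>F q (- R * q)\<close>, and \<open>q\<close> is small compared with \<open>k * n\<close>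
  once \<open>n\<close> is large. Homogeneity explains the exponent \<open>d\<close> in place of
  \<open>d + 1\<close>: in a fixed degree one exponent is determined by the others.\<close>

definition is_subring :: "'a::field set \<Rightarrow> bool" where
  "is_subring R \<longleftrightarrow> 1 \<in> R \<and> (\<forall>a\<in>R. \<forall>b\<in>R. a - b \<in> R \<and> a * b \<in> R)"

lemma is_subring_closed:
  assumes "is_subring R"
  shows "1 \<in> R" "0 \<in> R" "a \<in> R \<Longrightarrow> b \<in> R \<Longrightarrow> a - b \<in> R" "a \<in> R \<Longrightarrow> b \<in> R \<Longrightarrow> a * b \<in> R"
    "a \<in> R \<Longrightarrow> - a \<in> R" "a \<in> R \<Longrightarrow> b \<in> R \<Longrightarrow> a + b \<in> R" "a \<in> R \<Longrightarrow> a ^ n \<in> R"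
proof -
  show 1: "1 \<in> R" and d: "\<And>a b. a \<in> R \<Longrightarrow> b \<in> R \<Longrightarrow> a - b \<in> R"
    and m: "\<And>a b. a \<in> R \<Longrightarrow> b \<in> R \<Longrightarrow> a * b \<in> R"
    using assms unfolding is_subring_def by auto
  show 0: "0 \<in> R" using d[OF 1 1] by simp
  show u: "- a \<in> R" if "a \<in> R" for a using d[OF 0 that] by simp
  show "a + b \<in> R" if "a \<in> R" "b \<in> R" using d[OF that(1) u[OF that(2)]] by simp
  show "a ^ n \<in> R" if "a \<in> R" using that by (induction n) (auto simp: 1 m)
qed

lemma is_subring_sum:
  assumes "is_subring R" "\<And>i. i \<in> A \<Longrightarrow> g i \<in> R"
  shows "sum g A \<in> R"
  using assms(2) by (induction A rule: infinite_finite_induct)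
    (auto simp: is_subring_closed[OF assms(1)])

lemma is_subring_adjoin:
  assumes "is_subring R"
  shows "is_subring {poly q y | q. \<forall>i. coeff q i \<in> R}" (is "is_subring ?A")
    and "R \<subseteq> {poly q y | q. \<forall>i. coeff q i \<in> R}"
    and "y \<in> {poly q y | q. \<forall>i. coeff q i \<in> R}"
proof -
  note R = is_subring_closed[OF assms]
  show "R \<subseteq> ?A"
  proof
    fix a assume "a \<in> R"
    then show "a \<in> ?A" by (intro CollectI exI[of _ "[:a:]"]) (auto simp: coeff_pCons R split: nat.split)
  qed
  show "y \<in> ?A"
    by (intro CollectI exI[of _ "[:0,1:]"]) (auto simp: coeff_pCons R split: nat.split)
  show "is_subring ?A" unfolding is_subring_def
  proof (intro conjI ballI)
    show "1 \<in> ?A" using \<open>R \<subseteq> ?A\<close> R(1) by blast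
    fix a b assume "a \<in> ?A" "b \<in> ?A"
    then obtain p q where p: "a = poly p y" "\<forall>i. coeff p i \<in> R" and q: "b = poly q y" "\<forall>i. coeff q i \<in> R"
      by blast
    show "a - b \<in> ?A" using p q by (intro CollectI exI[of _ "p - q"]) (auto simp: R)
    show "a * b \<in> ?A" using p q
      by (intro CollectI exI[of _ "p * q"]) (auto simp: R coeff_mult intro!: is_subring_sum[OF assms])
  qed
qed

text \<open>Chevalley's extension argument: \<open>V\<close> is a maximal subring above
  \<open>R0\<close> containing no inverse of an element of \<open>P\<close>. The ideal to be
  preserved is generated by \<open>P\<close>, which by \<open>tot\<close> is totally ordered by
  divisibility in \<open>R0\<close>.\<close>

theorem valuation_ring_exists:
  fixes R0 P :: "'a::field set"
  assumes sub: "is_subring R0" and PR: "P \<subseteq> R0" and P0: "0 \<notin> P" and Pne: "P \<noteq> {}"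
    and tot: "\<And>p q. p \<in> P \<Longrightarrow> q \<in> P \<Longrightarrow> p / q \<in> R0 \<or> q / p \<in> R0"
    and inv: "\<And>p. p \<in> P \<Longrightarrow> inverse p \<notin> R0"
  obtains V where "is_subring V" "R0 \<subseteq> V" "\<And>p. p \<in> P \<Longrightarrow> inverse p \<notin> V"
    "\<And>y. y \<in> V \<or> inverse y \<in> V"
proof -
  define \<A> where "\<A> = {R. is_subring R \<and> R0 \<subseteq> R \<and> (\<forall>p\<in>P. inverse p \<notin> R)}"
  have "\<exists>M\<in>\<A>. \<forall>X\<in>\<A>. M \<subseteq> X \<longrightarrow> X = M"
  proof (rule subset_Zorn_nonempty)
    show "\<A> \<noteq> {}" using sub inv unfolding \<A>_def by auto
    fix \<C> assume ne: "\<C> \<noteq> {}" and ch: "subset.chain \<A> \<C>"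
    have "is_subring (\<Union>\<C>)"
      unfolding is_subring_def
    proof (intro conjI ballI)
      obtain R where "R \<in> \<C>" using ne by auto
      then have "is_subring R" using ch unfolding subset.chain_def \<A>_def by auto
      then show "1 \<in> \<Union>\<C>" using \<open>R \<in> \<C>\<close> is_subring_closed(1) by auto
      fix a b assume "a \<in> \<Union>\<C>" "b \<in> \<Union>\<C>"
      then obtain R1 R2 where "R1 \<in> \<C>" "a \<in> R1" "R2 \<in> \<C>" "b \<in> R2" by auto
      moreover have "R1 \<subseteq> R2 \<or> R2 \<subseteq> R1" using ch calculation unfolding subset.chain_def by auto
      ultimately obtain R where "R \<in> \<C>" "a \<in> R" "b \<in> R" by auto
      moreover have "is_subring R" using \<open>R \<in> \<C>\<close> ch unfolding subset.chain_def \<A>_def by auto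
      ultimately show "a - b \<in> \<Union>\<C>" "a * b \<in> \<Union>\<C>"
        using is_subring_closed by blast+
    qed
    then show "\<Union>\<C> \<in> \<A>" using ch ne unfolding subset.chain_def \<A>_def by blast
  qed
  then obtain V where VA: "V \<in> \<A>" and Vmax: "\<And>X. X \<in> \<A> \<Longrightarrow> V \<subseteq> X \<Longrightarrow> X = V" by blast
  have Vs: "is_subring V" and RV: "R0 \<subseteq> V" and Vi: "\<And>p. p \<in> P \<Longrightarrow> inverse p \<notin> V"
    using VA unfolding \<A>_def by auto
  note V = is_subring_closed[OF Vs]
  \<comment> \<open>The ideal of \<open>V\<close> generated by \<open>P\<close>. Of two elements of
    \<open>P\<close> one divides the other, so a sum of two multiples is again a multiple of a
    single \<open>p\<close>.\<close>
  define J where "J = {p * r | p r. p \<in> P \<and> r \<in> V}"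
  have J1: "1 \<notin> J"
  proof
    assume "1 \<in> J"
    then obtain p r where "p \<in> P" "r \<in> V" "1 = p * r" unfolding J_def by auto
    then have "inverse p = r" by (metis inverse_unique)
    then show False using Vi \<open>p \<in> P\<close> \<open>r \<in> V\<close> by auto
  qed
  have JV: "J \<subseteq> V" using PR RV V(4) unfolding J_def by auto
  have Jm: "a * b \<in> J" if "a \<in> J" "b \<in> V" for a b
  proof -
    obtain p r where "p \<in> P" "r \<in> V" "a = p * r" using \<open>a \<in> J\<close> unfolding J_def by auto
    moreover have "a * b = p * (r * b)" using \<open>a = p * r\<close> by (simp add: mult.assoc)
    ultimately show ?thesis using V(4)[OF \<open>r \<in> V\<close> \<open>b \<in> V\<close>] unfolding J_def by blast
  qed
  have J0: "0 \<in> J" using Pne V(2) unfolding J_def by force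
  have Ja: "a + b \<in> J" if ab: "a \<in> J" "b \<in> J" for a b
  proof -
    obtain p r q s where h: "p \<in> P" "r \<in> V" "a = p * r" "q \<in> P" "s \<in> V" "b = q * s"
      using ab unfolding J_def by blast
    have nz: "p \<noteq> 0" "q \<noteq> 0" using h P0 by auto
    show ?thesis
    proof (cases "p / q \<in> R0")
      case True
      then have "p / q * r + s \<in> V" using RV h V(4,6) by blast
      moreover have "a + b = q * (p / q * r + s)" using h nz by (simp add: field_simps)
      ultimately show ?thesis using h unfolding J_def by blast
    next
      case False
      then have "q / p \<in> R0" using tot h by blast
      then have "q / p * s + r \<in> V" using RV h V(4,6) by blast
      moreover have "a + b = p * (q / p * s + r)" using h nz by (simp add: field_simps)
      ultimately show ?thesis using h unfolding J_def by blast
    qed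
  qed
  have Jmin: "- a \<in> J" if "a \<in> J" for a using Jm[OF that V(5)[OF V(1)]] by simp
  have Jsum: "sum g A \<in> J" if "\<And>i. i \<in> A \<Longrightarrow> g i \<in> J" for g and A :: "nat set"
    using that by (induction A rule: infinite_finite_induct) (auto simp: J0 Ja)
  \<comment> \<open>A relation of degree at most \<open>n\<close> placing \<open>1\<close> in the
    ideal generated by \<open>J\<close> in \<open>V[y]\<close>. For \<open>y\<close> outside
    \<open>V\<close>, maximality puts some \<open>inverse p\<close> into \<open>V[y]\<close>, and
    multiplying by \<open>p\<close> yields such a relation.\<close>
  define Q where "Q y n \<longleftrightarrow> (\<exists>a. (\<forall>i. a i \<in> J) \<and> 1 = (\<Sum>i\<le>n. a i * y ^ i))" for y and n :: nat
  have ext: "\<exists>n. Q y n" if "y \<notin> V" for y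
  proof -
    let ?A = "{poly q y | q. \<forall>i. coeff q i \<in> V}"
    have "?A \<notin> \<A>" using Vmax[of ?A] is_subring_adjoin(2,3)[OF Vs, of y] that by blast
    then obtain p where p: "p \<in> P" "inverse p \<in> ?A"
      using is_subring_adjoin(1,2)[OF Vs, of y] RV unfolding \<A>_def by blast
    then obtain q where q: "inverse p = poly q y" "\<forall>i. coeff q i \<in> V" by blast
    have "p \<noteq> 0" using p P0 by auto
    then have "1 = p * poly q y" using q(1) by (metis right_inverse)
    also have "\<dots> = (\<Sum>i\<le>degree q. (p * coeff q i) * y ^ i)"
      by (simp add: poly_altdef sum_distrib_left mult.assoc)
    finally have "Q y (degree q)" unfolding Q_def
      using p(1) q(2) by (intro exI[of _ "\<lambda>i. p * coeff q i"]) (auto simp: J_def)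
    then show ?thesis by blast
  qed
  \<comment> \<open>For \<open>u = 1 + j\<close> with inverse outside \<open>V\<close>, a relation
    in \<open>inverse u\<close> multiplied by \<open>u ^ n\<close> gives
    \<open>u ^ n \<in> J\<close>, although \<open>u ^ n\<close> is congruent to \<open>1\<close>
    modulo \<open>J\<close>.\<close>
  have unit: "inverse (1 + j) \<in> V" if j: "j \<in> J" for j
  proof (rule ccontr)
    define u where "u = 1 + j"
    assume "inverse (1 + j) \<notin> V"
    then have u: "inverse u \<notin> V" by (simp add: u_def)
    then have u0: "u \<noteq> 0" using V(2) by auto
    have uV: "u \<in> V" unfolding u_def using j JV V by auto
    obtain n a where a: "\<And>i. a i \<in> J" "1 = (\<Sum>i\<le>n. a i * inverse u ^ i)"
      using ext[OF u] unfolding Q_def by blast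
    have "u ^ n = (\<Sum>i\<le>n. a i * inverse u ^ i) * u ^ n" using a(2) by simp
    also have "\<dots> = (\<Sum>i\<le>n. a i * u ^ (n - i))"
      unfolding sum_distrib_right using u0
      by (intro sum.cong) (auto simp: power_diff field_simps)
    also have "\<dots> \<in> J" using a(1) Jm V(7)[OF uV] by (intro Jsum) auto
    finally have 1: "u ^ n \<in> J" .
    have "u ^ n - 1 \<in> J"
    proof (induction n)
      case 0 then show ?case using J0 by simp
    next
      case (Suc n)
      have "u ^ Suc n - 1 = (u ^ n - 1) * u + j" unfolding u_def by (simp add: algebra_simps)
      then show ?case using Ja[OF Jm[OF Suc uV] j] by simp
    qed
    then have "u ^ n + - (u ^ n - 1) \<in> J" using 1 Ja Jmin by blast
    then show False using J1 by simp
  qed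
  \<comment> \<open>The relation for \<open>inverse y\<close>, divided by the unit
    \<open>1 - b 0\<close>, has no constant term on the right; multiplied by
    \<open>a n * y ^ n\<close> it rewrites the top term of the relation for \<open>y\<close> in
    lower degrees. Repeating this on the longer of the two relations descends to degree
    \<open>0\<close>, where \<open>1 \<in> J\<close> is impossible.\<close>
  have red: "Q y (n - 1)" if y0: "y \<noteq> 0" and Qn: "Q y n" and Qm: "Q (inverse y) m" and mn: "m \<le> n" and n0: "n > 0"
    for y n m
  proof -
    obtain a where a: "\<And>i. a i \<in> J" "1 = (\<Sum>i\<le>n. a i * y ^ i)" using Qn unfolding Q_def by blast
    obtain b where b: "\<And>i. b i \<in> J" "1 = (\<Sum>i\<le>m. b i * inverse y ^ i)" using Qm unfolding Q_def by blast
    define u where "u = 1 - b 0"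
    have iu: "inverse u \<in> V" using unit[OF Jmin[OF b(1)[of 0]]] by (simp add: u_def)
    have u0: "u \<noteq> 0" using J1 b(1)[of 0] unfolding u_def by auto
    have "1 = b 0 + (\<Sum>i=1..m. b i * inverse y ^ i)"
      using b(2) by (simp add: atMost_atLeast0 sum.atLeast_Suc_atMost)
    then have "u = (\<Sum>i=1..m. b i * inverse y ^ i)" unfolding u_def by (simp add: algebra_simps)
    then have "inverse u * u = (\<Sum>i=1..m. (inverse u * b i) * inverse y ^ i)"
      by (simp add: sum_distrib_left mult.assoc)
    then have c: "1 = (\<Sum>i=1..m. (inverse u * b i) * inverse y ^ i)" using u0 by simp
    define e where "e i = (if n - m \<le> i \<and> i < n then a n * (inverse u * b (n - i)) else 0)" for i
    have "inverse u * b i \<in> V" for i using iu JV b(1) V(4) by blast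
    then have eJ: "e i \<in> J" for i unfolding e_def using J0 Jm[OF a(1)] by auto
    have "a n * y ^ n = a n * y ^ n * (\<Sum>i=1..m. (inverse u * b i) * inverse y ^ i)" using c by simp
    also have "\<dots> = (\<Sum>i=1..m. a n * (inverse u * b i) * y ^ (n - i))"
      unfolding sum_distrib_left using y0 mn
      by (intro sum.cong) (auto simp: power_diff field_simps)
    also have "\<dots> = (\<Sum>i=n-m..n-1. a n * (inverse u * b (n - i)) * y ^ i)"
      by (rule sum.reindex_bij_witness[of _ "\<lambda>i. n - i" "\<lambda>i. n - i"]) (use mn n0 in auto)
    also have "\<dots> = (\<Sum>i\<le>n-1. e i * y ^ i)"
      by (rule sum.mono_neutral_cong_left) (use n0 in \<open>auto simp: e_def\<close>)
    finally have top: "a n * y ^ n = (\<Sum>i\<le>n-1. e i * y ^ i)" .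
    have "1 = (\<Sum>i\<le>n-1. a i * y ^ i) + a n * y ^ n"
      using a(2) n0 by (cases n) auto
    also have "\<dots> = (\<Sum>i\<le>n-1. (a i + e i) * y ^ i)"
      unfolding top by (simp add: sum.distrib algebra_simps)
    finally show ?thesis unfolding Q_def using Ja[OF a(1) eJ] by (intro exI[of _ "\<lambda>i. a i + e i"]) auto
  qed
  have Q0: "\<not> Q y 0" for y
  proof
    assume "Q y 0"
    then obtain a where "\<And>i. a i \<in> J" "1 = a (0::nat)" unfolding Q_def by auto
    then show False using J1 by metis
  qed
  have noQ: "\<not> (Q y n \<and> Q (inverse y) m)" if "y \<noteq> 0" for y n m
    using that
  proof (induction "n + m" arbitrary: y n m rule: less_induct)
    case less
    show ?case
    proof
      assume Q: "Q y n \<and> Q (inverse y) m"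
      then have pos: "n > 0" "m > 0" using Q0 by (metis gr0I)+
      show False
      proof (cases "m \<le> n")
        case True
        then have "Q y (n - 1)" using red Q pos less.prems by blast
        then show False using less.hyps[of "n - 1" m y] Q pos less.prems by auto
      next
        case False
        then have "Q (inverse y) (m - 1)" using red[of "inverse y" m n] Q pos less.prems by auto
        then show False using less.hyps[of n "m - 1" y] Q pos less.prems by auto
      qed
    qed
  qed
  have "y \<in> V \<or> inverse y \<in> V" for y
  proof (cases "y = 0")
    case True then show ?thesis using V(2) by auto
  next
    case False then show ?thesis using ext noQ by metis
  qed
  then show ?thesis using that Vs RV Vi by blast
qed


section \<open>Equality of values in a valuation ring\<close>

locale valuation_ring =
  fixes V :: "'a::field set"
  assumes subring: "is_subring V" and total: "y \<in> V \<or> inverse y \<in> V"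
begin

lemmas closed = is_subring_closed[OF subring]

definition max_ideal :: "'a set" where
  "max_ideal = {z \<in> V. z = 0 \<or> inverse z \<notin> V}"

text \<open>Equality of values, expressed without a value group: the quotient is a unit of
  \<open>V\<close>.\<close>

definition assoc :: "'a \<Rightarrow> 'a \<Rightarrow> bool" where
  "assoc a b \<longleftrightarrow> a \<noteq> 0 \<and> b \<noteq> 0 \<and> a / b \<in> V \<and> b / a \<in> V"

lemma assoc_refl: "a \<noteq> 0 \<Longrightarrow> assoc a a"
  by (simp add: assoc_def closed)

lemma assoc_sym: "assoc a b \<Longrightarrow> assoc b a"
  by (auto simp: assoc_def)

lemma assoc_trans: assumes "assoc a b" "assoc b c" shows "assoc a c"
proof -
  have "a / b * (b / c) \<in> V" "c / b * (b / a) \<in> V" using assms closed(4) unfolding assoc_def by blast+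
  then show ?thesis using assms unfolding assoc_def by auto
qed

lemma assoc_mult: assumes "assoc a b" "assoc c d" shows "assoc (a * c) (b * d)"
proof -
  have "a / b * (c / d) \<in> V" "b / a * (d / c) \<in> V" using assms closed(4) unfolding assoc_def by blast+
  then show ?thesis using assms unfolding assoc_def by auto
qed

lemma assoc_inverse: "assoc a b \<Longrightarrow> assoc (inverse a) (inverse b)"
  unfolding assoc_def by (auto simp: field_simps)

lemma assoc_divide: "assoc a b \<Longrightarrow> assoc c d \<Longrightarrow> assoc (a / c) (b / d)"
  using assoc_mult[OF _ assoc_inverse] by (simp add: divide_inverse)

lemma assoc_power: "assoc a b \<Longrightarrow> assoc (a ^ n) (b ^ n)"
  by (induction n) (auto intro: assoc_mult assoc_refl)

lemma divide_total: "a \<noteq> 0 \<Longrightarrow> b \<noteq> 0 \<Longrightarrow> a / b \<in> V \<or> b / a \<in> V"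
  using total[of "a / b"] by (simp add: field_simps)

text \<open>Of two nonzero elements one divides the other; if the sum were a unit, the divisor would
  be a unit too.\<close>

lemma max_ideal_add: assumes "a \<in> max_ideal" "b \<in> max_ideal" shows "a + b \<in> max_ideal"
proof -
  have *: "a + b \<in> max_ideal" if ab: "a \<in> max_ideal" "b \<in> max_ideal" "b \<noteq> 0" "a / b \<in> V" for a b
  proof (rule ccontr)
    assume "a + b \<notin> max_ideal"
    moreover have "a + b \<in> V" using ab closed unfolding max_ideal_def by auto
    ultimately have h: "a + b \<noteq> 0" "inverse (a + b) \<in> V" unfolding max_ideal_def by auto
    have "(1 + a / b) * inverse (a + b) \<in> V" using ab(4) h(2) closed(1,4,6) by blast
    moreover have "(1 + a / b) * inverse (a + b) = inverse b"
      using ab h(1) by (simp add: field_simps)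
    ultimately show False using ab unfolding max_ideal_def by auto
  qed
  show ?thesis
  proof (cases "a = 0 \<or> b = 0")
    case True then show ?thesis using assms by auto
  next
    case False
    then show ?thesis using *[OF assms] *[OF assms(2,1)] divide_total[of a b] by (auto simp: add.commute)
  qed
qed

lemma max_ideal_uminus: "a \<in> max_ideal \<Longrightarrow> - a \<in> max_ideal"
  unfolding max_ideal_def using closed(5) by fastforce

lemma one_notin_max_ideal: "1 \<notin> max_ideal"
  unfolding max_ideal_def using closed by auto

lemma max_ideal_sum: "(\<And>i. i \<in> A \<Longrightarrow> g i \<in> max_ideal) \<Longrightarrow> sum g A \<in> max_ideal"
proof (induction A rule: infinite_finite_induct)
  case (insert x F) then show ?case by (auto intro: max_ideal_add)
qed (auto simp: max_ideal_def closed)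

text \<open>The other terms sum to \<open>z i0 * w\<close> with \<open>w\<close> in the maximal
  ideal, and then \<open>1 + w\<close> is a unit.\<close>

lemma assoc_dominant_term:
  assumes "finite I" "i0 \<in> I" "z i0 \<noteq> 0" "\<And>i. i \<in> I \<Longrightarrow> i \<noteq> i0 \<Longrightarrow> z i / z i0 \<in> max_ideal"
  shows "assoc (sum z I) (z i0)"
proof -
  define w where "w = (\<Sum>i\<in>I - {i0}. z i / z i0)"
  have w: "w \<in> max_ideal" unfolding w_def using assms by (intro max_ideal_sum) auto
  then have wV: "1 + w \<in> V" unfolding max_ideal_def using closed by auto
  have "1 + w \<notin> max_ideal"
    using max_ideal_add[OF _ max_ideal_uminus[OF w], of "1 + w"] one_notin_max_ideal by auto
  then have u: "1 + w \<noteq> 0" "inverse (1 + w) \<in> V" using wV unfolding max_ideal_def by auto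
  have "sum z I = z i0 + sum z (I - {i0})" using assms(1,2) by (rule sum.remove)
  also have "\<dots> = z i0 * (1 + w)"
    using assms(3) by (simp add: w_def sum_divide_distrib[symmetric] distrib_left)
  finally have "sum z I = z i0 * (1 + w)" .
  then have "sum z I \<noteq> 0" "sum z I / z i0 = 1 + w" "z i0 / sum z I = inverse (1 + w)"
    using assms(3) u(1) by (auto simp: divide_inverse)
  then show ?thesis unfolding assoc_def using assms(3) u wV by auto
qed

text \<open>The least value among the terms of a vanishing sum is attained twice; otherwise the term
  attaining it would dominate and the sum would be nonzero.\<close>

lemma zero_sum_assoc:
  assumes I: "finite I" and zero: "sum z I = 0" and nz: "\<exists>i\<in>I. z i \<noteq> 0"
  obtains i j where "i \<in> I" "j \<in> I" "i \<noteq> j" "assoc (z i) (z j)"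
proof -
  define I' where "I' = {i \<in> I. z i \<noteq> 0}"
  have least: "\<exists>i\<in>F. \<forall>j\<in>F. z j / z i \<in> V" if "finite F" "F \<noteq> {}" "\<forall>i\<in>F. z i \<noteq> 0" for F
    using that
  proof (induction F rule: finite_ne_induct)
    case (singleton x) then show ?case using closed by auto
  next
    case (insert x F)
    then obtain i where i: "i \<in> F" "\<forall>j\<in>F. z j / z i \<in> V" by auto
    show ?case
    proof (cases "z x / z i \<in> V")
      case True then show ?thesis using i by auto
    next
      case False
      then have xi: "z i / z x \<in> V" using divide_total insert.prems i by auto
      have "z j / z x \<in> V" if "j \<in> F" for j
        using closed(4)[OF _ xi, of "z j / z i"] i that insert.prems by auto
      then show ?thesis using closed insert.prems by (intro bexI[of _ x]) auto
    qed
  qed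
  have "finite I'" "I' \<noteq> {}" "\<forall>i\<in>I'. z i \<noteq> 0" using I nz unfolding I'_def by auto
  from least[OF this] obtain i where i: "i \<in> I'" "\<And>j. j \<in> I' \<Longrightarrow> z j / z i \<in> V"
    by blast
  have "sum z I' = sum z I" unfolding I'_def using I by (intro sum.mono_neutral_left) auto
  then have "sum z I' = 0" using zero by simp
  then have "\<not> assoc (sum z I') (z i)" by (simp add: assoc_def)
  then obtain j where j: "j \<in> I'" "j \<noteq> i" "z j / z i \<notin> max_ideal"
    using assoc_dominant_term[of I' i z] I i(1) unfolding I'_def by auto
  then have "z i / z j \<in> V" using i(2)[OF j(1)] unfolding max_ideal_def by (auto simp: field_simps)
  then have "assoc (z i) (z j)" using i j unfolding assoc_def I'_def by auto
  then show ?thesis using that i(1) j(1,2) unfolding I'_def by blast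
qed

end

section \<open>Graded domains and the growth of their graded pieces\<close>

definition exps :: "nat set \<Rightarrow> (nat \<Rightarrow> nat) set" where
  "exps X = {\<alpha>. \<forall>i. i \<notin> X \<longrightarrow> \<alpha> i = 0}"

lemma exps_add: "\<alpha> \<in> exps X \<Longrightarrow> \<beta> \<in> exps X \<Longrightarrow> (\<lambda>i. \<alpha> i + \<beta> i) \<in> exps X"
  by (simp add: exps_def)

lemma exps_mult: "\<alpha> \<in> exps X \<Longrightarrow> (\<lambda>i. k * \<alpha> i) \<in> exps X"
  by (simp add: exps_def)

lemma exps_zero: "(\<lambda>i. 0) \<in> exps X"
  by (simp add: exps_def)

lemma exps_mono: "X \<subseteq> Y \<Longrightarrow> exps X \<subseteq> exps Y"
  by (auto simp: exps_def)

locale algebra_over = vector_space sc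
  for sc :: "'k::field \<Rightarrow> 'b::comm_ring_1 \<Rightarrow> 'b" +
  assumes sc_mult: "sc c (a * b) = sc c a * b"
begin

lemma sc_mult_right: "a * sc c b = sc c (a * b)"
  by (metis mult.commute sc_mult)

lemma span_mult_left: "a \<in> span S \<Longrightarrow> b * a \<in> span ((*) b ` S)"
proof (induction rule: span_induct_alt)
  case base then show ?case by (simp add: span_zero)
next
  case (step c x z)
  have "sc c (b * x) + b * z \<in> span ((*) b ` S)"
    using span_add[OF span_scale[OF span_base[OF imageI[OF step(1)]]] step(2)] .
  then show ?case by (simp add: distrib_left sc_mult_right)
qed

lemma span_mult:
  assumes "a \<in> span S" "b \<in> span T" "\<And>x z. x \<in> S \<Longrightarrow> z \<in> T \<Longrightarrow> x * z \<in> span U"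
  shows "a * b \<in> span U"
proof -
  have "x * b \<in> span U" if "x \<in> S" for x
  proof -
    have "span ((*) x ` T) \<subseteq> span U" by (rule span_minimal) (use assms(3) that in auto)
    then show ?thesis using span_mult_left[OF assms(2), of x] by blast
  qed
  then have "span ((*) b ` S) \<subseteq> span U" by (intro span_minimal) (auto simp: mult.commute)
  then show ?thesis using span_mult_left[OF assms(1), of b] by (auto simp: mult.commute)
qed

end

locale graded_algebra_over = algebra_over +
  fixes B :: "nat \<Rightarrow> 'b set"
  assumes B_subspace: "subspace (B n)"
    and B_mult: "a \<in> B n \<Longrightarrow> b \<in> B m \<Longrightarrow> a * b \<in> B (n + m)"
    and B_one: "1 \<in> B 0"
    and B_direct: "finite T \<Longrightarrow> (\<And>n. n \<in> T \<Longrightarrow> g n \<in> B n) \<Longrightarrow> (\<Sum>n\<in>T. g n) = 0 \<Longrightarrow> n \<in> T \<Longrightarrow> g n = 0"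
begin

lemma B_power: "a \<in> B n \<Longrightarrow> a ^ k \<in> B (k * n)"
  by (induction k) (auto simp: B_one B_mult)

lemma monomial_B:
  fixes y :: "nat \<Rightarrow> 'b" and p :: nat
  assumes "\<And>i. i < p \<Longrightarrow> y i \<in> B 1"
  shows "(\<Prod>i<p. y i ^ \<alpha> i) \<in> B (\<Sum>i<p. \<alpha> i)"
  using assms
proof (induction p)
  case 0 then show ?case by (simp add: B_one)
next
  case (Suc q)
  then show ?case using B_mult[OF Suc.IH B_power[of "y q" 1 "\<alpha> q"]] by simp
qed

end

section \<open>Monomials in the generators, with degree and weight\<close>

locale graded_domain = graded_algebra_over sc B
  for sc :: "'k::field \<Rightarrow> 'b::idom \<Rightarrow> 'b" and B :: "nat \<Rightarrow> 'b set" +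
  fixes y :: "nat \<Rightarrow> 'b" and p :: nat and \<omega> :: "nat \<Rightarrow> real"
  assumes y_B1: "i < p \<Longrightarrow> y i \<in> B 1"
    and B_span: "B n \<subseteq> span ((\<lambda>\<alpha>. \<Prod>i<p. y i ^ \<alpha> i) ` {\<alpha> \<in> exps {..<p}. (\<Sum>i<p. \<alpha> i) = n})"
    and y_nonzero: "\<exists>i<p. y i \<noteq> 0"
    and \<omega>_indep: "(\<Sum>i<p. real_of_int (h i) * \<omega> i) = 0 \<Longrightarrow> i < p \<Longrightarrow> h i = 0"
begin

definition mon :: "(nat \<Rightarrow> nat) \<Rightarrow> 'b" where "mon \<alpha> = (\<Prod>i<p. y i ^ \<alpha> i)"
definition tdeg :: "(nat \<Rightarrow> nat) \<Rightarrow> nat" where "tdeg \<alpha> = (\<Sum>i<p. \<alpha> i)"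
abbreviation mfrac :: "(nat \<Rightarrow> nat) \<Rightarrow> (nat \<Rightarrow> nat) \<Rightarrow> 'b fract" where
  "mfrac \<alpha> \<beta> \<equiv> to_fract (mon \<alpha>) / to_fract (mon \<beta>)"
definition wt :: "(nat \<Rightarrow> nat) \<Rightarrow> real" where "wt \<alpha> = (\<Sum>i<p. real (\<alpha> i) * \<omega> i)"

lemma mon_add: "mon (\<lambda>i. \<alpha> i + \<beta> i) = mon \<alpha> * mon \<beta>"
  by (simp add: mon_def power_add prod.distrib)

lemma mon_mult: "mon (\<lambda>i. k * \<alpha> i) = mon \<alpha> ^ k"
  by (simp add: mon_def power_mult prod_power_distrib mult.commute[of k])

lemma mon_zero: "mon (\<lambda>i. 0) = 1"
  by (simp add: mon_def)

lemma tdeg_add: "tdeg (\<lambda>i. \<alpha> i + \<beta> i) = tdeg \<alpha> + tdeg \<beta>"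
  by (simp add: tdeg_def sum.distrib)

lemma wt_add: "wt (\<lambda>i. \<alpha> i + \<beta> i) = wt \<alpha> + wt \<beta>"
  by (simp add: wt_def sum.distrib algebra_simps)

lemma wt_mult: "wt (\<lambda>i. k * \<alpha> i) = real k * wt \<alpha>"
  by (simp add: wt_def sum_distrib_left mult.assoc)

lemma wt_zero: "wt (\<lambda>i. 0) = 0"
  by (simp add: wt_def)

lemma single_exp:
  fixes k :: nat
  assumes "i < p"
  defines "\<delta> \<equiv> (\<lambda>j. if j = i then k else 0)"
  shows "mon \<delta> = y i ^ k" "tdeg \<delta> = k" "wt \<delta> = real k * \<omega> i" "i \<in> X \<Longrightarrow> \<delta> \<in> exps X"
proof -
  have "mon \<delta> = (\<Prod>j<p. if j = i then y i ^ k else 1)"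
    unfolding mon_def \<delta>_def by (intro prod.cong) auto
  then show "mon \<delta> = y i ^ k" using assms(1) by simp
  show "tdeg \<delta> = k" using assms(1) by (simp add: tdeg_def \<delta>_def)
  have "wt \<delta> = (\<Sum>j<p. if j = i then real k * \<omega> i else 0)"
    unfolding wt_def \<delta>_def by (intro sum.cong) auto
  then show "wt \<delta> = real k * \<omega> i" using assms(1) by simp
  show "\<delta> \<in> exps X" if "i \<in> X" using that by (auto simp: \<delta>_def exps_def)
qed

lemma mon_B: "mon \<alpha> \<in> B (tdeg \<alpha>)"
  unfolding mon_def tdeg_def by (rule monomial_B[OF y_B1])

lemma B_span_mon: "B n \<subseteq> span (mon ` {\<alpha> \<in> exps {..<p}. tdeg \<alpha> = n})"
  using B_span unfolding mon_def[abs_def] tdeg_def by auto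

lemma wt_inj:
  assumes "\<alpha> \<in> exps {..<p}" "\<beta> \<in> exps {..<p}" "wt \<alpha> = wt \<beta>"
  shows "\<alpha> = \<beta>"
proof
  fix i
  have "(\<Sum>i<p. real_of_int (int (\<alpha> i) - int (\<beta> i)) * \<omega> i) = 0"
    using assms(3) by (simp add: wt_def sum_subtractf left_diff_distrib)
  then have "i < p \<Longrightarrow> int (\<alpha> i) - int (\<beta> i) = 0" by (rule \<omega>_indep)
  then show "\<alpha> i = \<beta> i" using assms by (cases "i < p") (auto simp: exps_def)
qed

lemma exps_le_tdeg: "i < p \<Longrightarrow> \<alpha> i \<le> tdeg \<alpha>"
  unfolding tdeg_def by (rule member_le_sum) auto

lemma finite_exps_tdeg: "finite {\<alpha> \<in> exps {..<p}. tdeg \<alpha> = n}"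
proof (rule finite_subset)
  show "{\<alpha> \<in> exps {..<p}. tdeg \<alpha> = n} \<subseteq> {\<alpha>. \<forall>i. (i \<in> {..<p} \<longrightarrow> \<alpha> i \<in> {..n}) \<and> (i \<notin> {..<p} \<longrightarrow> \<alpha> i = 0)}"
    using exps_le_tdeg by (auto simp: exps_def)
  show "finite {\<alpha>. \<forall>i. (i \<in> {..<p} \<longrightarrow> \<alpha> i \<in> {..n}) \<and> (i \<notin> {..<p} \<longrightarrow> \<alpha> i = (0::nat))}"
    by (rule finite_set_of_finite_funs) auto
qed

lemma B_finite_span: obtains S where "finite S" "B n \<subseteq> span S"
  using B_span_mon[of n] finite_exps_tdeg[of n] finite_imageI by blast

lemma card_independent_le_dim:
  assumes "W \<subseteq> B n" "A \<subseteq> W" "independent A"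
  shows "finite A" "card A \<le> dim W"
proof -
  obtain S where S: "finite S" "B n \<subseteq> span S" using B_finite_span by blast
  obtain b where b: "b \<subseteq> W" "independent b" "W \<subseteq> span b" "card b = dim W" using basis_exists by blast
  have "finite b" using independent_span_bound[OF S(1) b(2)] b(1) assms(1) S(2) by blast
  then show "finite A" "card A \<le> dim W"
    using independent_span_bound[OF _ assms(3), of b] assms(2) b(3,4) by auto
qed

lemma dim_mono_B: "W \<subseteq> W' \<Longrightarrow> W' \<subseteq> B n \<Longrightarrow> dim W \<le> dim W'"
  using card_independent_le_dim(2)[of W' n] basis_exists[of W] by (metis subset_trans)

lemma family_card_le_dim:
  assumes P: "finite P" and z: "\<And>q. q \<in> P \<Longrightarrow> z q \<in> W" and W: "W \<subseteq> B n"
    and ind: "\<And>c. (\<Sum>q\<in>P. sc (c q) (z q)) = 0 \<Longrightarrow> \<forall>q\<in>P. c q = 0"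
  shows "card P \<le> dim W"
proof -
  have inj: "inj_on z P"
  proof (rule inj_onI, rule ccontr)
    fix q r assume h: "q \<in> P" "r \<in> P" "z q = z r" "q \<noteq> r"
    have "(\<Sum>s\<in>P. sc (if s = q then 1 else if s = r then -1 else 0) (z s))
        = (\<Sum>s\<in>{q,r}. sc (if s = q then 1 else if s = r then -1 else 0) (z s))"
      by (rule sum.mono_neutral_right) (use P h in auto)
    also have "\<dots> = 0" using h by simp
    finally show False using ind[of "\<lambda>s. if s = q then 1 else if s = r then -1 else 0"] h(1) by auto
  qed
  have "independent (z ` P)"
  proof (rule independent_if_scalars_zero)
    show "finite (z ` P)" using P by simp
    fix f x assume h: "(\<Sum>x\<in>z ` P. sc (f x) x) = 0" "x \<in> z ` P"
    then have "(\<Sum>q\<in>P. sc (f (z q)) (z q)) = 0" by (simp add: sum.reindex[OF inj])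
    then show "f x = 0" using ind[of "\<lambda>q. f (z q)"] h(2) by auto
  qed
  then have "card (z ` P) \<le> dim W" using card_independent_le_dim(2)[OF W] z by blast
  then show ?thesis by (simp add: card_image[OF inj])
qed

section \<open>Algebraic independence and reduction of monomials\<close>

definition alg_indep :: "nat set \<Rightarrow> bool" where
  "alg_indep X \<longleftrightarrow> (\<forall>T c. finite T \<longrightarrow> T \<subseteq> exps X \<longrightarrow> (\<Sum>\<alpha>\<in>T. sc (c \<alpha>) (mon \<alpha>)) = 0 \<longrightarrow> (\<forall>\<alpha>\<in>T. c \<alpha> = 0))"

text \<open>The weights serve here as a monomial order. A relation can be taken homogeneous because
  the \<open>B n\<close> are in direct sum; since \<open>wt\<close> is injective, it has a unique
  heaviest monomial, for which it is solved.\<close>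

lemma not_alg_indep_leading:
  assumes Y: "Y \<subseteq> {..<p}" and dep: "\<not> alg_indep Y"
  shows "\<exists>\<beta>\<in>exps Y. mon \<beta> \<in> span (mon ` {\<alpha> \<in> exps Y. tdeg \<alpha> = tdeg \<beta> \<and> wt \<alpha> < wt \<beta>})"
proof -
  obtain T c \<alpha>0 where T: "finite T" "T \<subseteq> exps Y" "(\<Sum>\<alpha>\<in>T. sc (c \<alpha>) (mon \<alpha>)) = 0" "\<alpha>0 \<in> T" "c \<alpha>0 \<noteq> 0"
    using dep unfolding alg_indep_def by blast
  define g where "g n = (\<Sum>\<alpha>\<in>{\<alpha>\<in>T. tdeg \<alpha> = n}. sc (c \<alpha>) (mon \<alpha>))" for n
  have "(\<Sum>n\<in>tdeg ` T. g n) = 0"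
    unfolding g_def using sum.image_gen[OF T(1), of "\<lambda>\<alpha>. sc (c \<alpha>) (mon \<alpha>)" tdeg] T(3) by simp
  moreover have "g n \<in> B n" for n unfolding g_def
    using mon_B by (intro subspace_sum[OF B_subspace] subspace_scale[OF B_subspace]) auto
  ultimately have g0: "g (tdeg \<alpha>0) = 0" using B_direct[of "tdeg ` T" g "tdeg \<alpha>0"] T by auto
  define T' where "T' = {\<alpha>\<in>T. tdeg \<alpha> = tdeg \<alpha>0 \<and> c \<alpha> \<noteq> 0}"
  have fT': "finite T'" and T'ne: "T' \<noteq> {}" using T unfolding T'_def by auto
  have "(\<Sum>\<alpha>\<in>T'. sc (c \<alpha>) (mon \<alpha>)) = g (tdeg \<alpha>0)"
    unfolding g_def T'_def by (rule sum.mono_neutral_left) (use T in auto)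
  then have s0: "(\<Sum>\<alpha>\<in>T'. sc (c \<alpha>) (mon \<alpha>)) = 0" using g0 by simp
  obtain \<beta> where \<beta>: "\<beta> \<in> T'" "\<And>\<alpha>. \<alpha> \<in> T' \<Longrightarrow> wt \<alpha> \<le> wt \<beta>"
    using Max_in[of "wt ` T'"] Max_ge[of "wt ` T'"] fT' T'ne by fastforce
  let ?S = "mon ` {\<alpha> \<in> exps Y. tdeg \<alpha> = tdeg \<beta> \<and> wt \<alpha> < wt \<beta>}"
  have "mon \<alpha> \<in> ?S" if "\<alpha> \<in> T' - {\<beta>}" for \<alpha>
  proof -
    have "\<alpha> \<in> exps Y" "\<beta> \<in> exps Y" "tdeg \<alpha> = tdeg \<beta>" using that \<beta>(1) T(2) unfolding T'_def by auto
    moreover have "wt \<alpha> \<noteq> wt \<beta>" using wt_inj[of \<alpha> \<beta>] calculation exps_mono[OF Y] that by auto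
    ultimately show ?thesis using \<beta>(2)[of \<alpha>] that by force
  qed
  then have rest: "(\<Sum>\<alpha>\<in>T' - {\<beta>}. sc (c \<alpha>) (mon \<alpha>)) \<in> span ?S"
    by (intro span_sum span_scale span_base) auto
  have top: "sc (c \<beta>) (mon \<beta>) = - (\<Sum>\<alpha>\<in>T' - {\<beta>}. sc (c \<alpha>) (mon \<alpha>))"
    using s0 sum.remove[OF fT' \<beta>(1), of "\<lambda>\<alpha>. sc (c \<alpha>) (mon \<alpha>)"] by (simp add: eq_neg_iff_add_eq_0)
  have "sc (inverse (c \<beta>)) (sc (c \<beta>) (mon \<beta>)) \<in> span ?S"
    unfolding top using rest by (intro span_scale span_neg)
  then have "mon \<beta> \<in> span ?S" using \<beta>(1) unfolding T'_def by simp
  moreover have "\<beta> \<in> exps Y" using \<beta>(1) T(2) unfolding T'_def by auto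
  ultimately show ?thesis by blast
qed

lemma alg_indep_singleton: assumes "i < p" "y i \<noteq> 0" shows "alg_indep {i}"
proof (rule ccontr)
  assume "\<not> alg_indep {i}"
  then obtain \<beta> where \<beta>: "\<beta> \<in> exps {i}" "mon \<beta> \<in> span (mon ` {\<alpha> \<in> exps {i}. tdeg \<alpha> = tdeg \<beta> \<and> wt \<alpha> < wt \<beta>})"
    using not_alg_indep_leading[of "{i}"] assms(1) by auto
  have t: "tdeg \<alpha> = \<alpha> i \<and> mon \<alpha> = y i ^ \<alpha> i \<and> wt \<alpha> = real (\<alpha> i) * \<omega> i" if "\<alpha> \<in> exps {i}" for \<alpha>
  proof -
    have "\<alpha> = (\<lambda>j. if j = i then \<alpha> i else 0)" using that by (auto simp: exps_def)
    then show ?thesis using single_exp(1-3)[OF assms(1), where k = "\<alpha> i"] by simp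
  qed
  \<comment> \<open>In one variable the degree fixes the exponent, so no lighter monomial of the
    same degree exists.\<close>
  then have empty: "{\<alpha> \<in> exps {i}. tdeg \<alpha> = tdeg \<beta> \<and> wt \<alpha> < wt \<beta>} = {}" using \<beta>(1) by auto
  have "mon \<beta> = 0" using \<beta>(2) unfolding empty by simp
  then show False using t[OF \<beta>(1)] assms(2) by simp
qed

lemma max_alg_indep_exists:
  obtains X where "X \<subseteq> {..<p}" "alg_indep X" "X \<noteq> {}" "\<And>Y. Y \<subseteq> {..<p} \<Longrightarrow> alg_indep Y \<Longrightarrow> card Y \<le> card X"
proof -
  let ?S = "{X. X \<subseteq> {..<p} \<and> alg_indep X}"
  obtain i where i: "i < p" "y i \<noteq> 0" using y_nonzero by auto
  then have i': "{i} \<in> ?S" using alg_indep_singleton by auto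
  have "finite ?S" by (rule finite_subset[of _ "Pow {..<p}"]) auto
  then obtain X where X: "X \<in> ?S" "\<And>Y. Y \<in> ?S \<Longrightarrow> card Y \<le> card X"
    using i' Max_in[of "card ` ?S"] Max_ge[of "card ` ?S"] by fastforce
  have "card {i} \<le> card X" using X(2) i' by blast
  then have "X \<noteq> {}" by auto
  then show ?thesis using that X by auto
qed

end

locale graded_domain_tr = graded_domain +
  fixes X :: "nat set"
  assumes X_le: "X \<subseteq> {..<p}" and X_indep: "alg_indep X" and X_nonempty: "X \<noteq> {}"
    and X_max: "Y \<subseteq> {..<p} \<Longrightarrow> alg_indep Y \<Longrightarrow> card Y \<le> card X"
begin

text \<open>One less than the transcendence degree: the growth exponent of
  \<open>dim (B m)\<close>.\<close>

definition d :: nat where "d = card X - 1"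

lemma finite_X: "finite X"
  using X_le finite_subset by blast

lemma card_X: "card X = Suc d"
  using X_nonempty finite_X by (simp add: d_def card_gt_0_iff)

text \<open>Every set of \<open>d + 2\<close> variables is dependent and provides a leading monomial
  that can be rewritten by lighter ones. The irreducible monomials have at most \<open>d + 1\<close>
  large exponents, one of which is determined by the degree; this leaves
  \<open>O((m + 1) ^ d)\<close> of them.\<close>

lemma dim_B_bound: obtains C where "\<And>m. dim (B m) \<le> C * (m + 1) ^ d"
proof -
  define Ys where "Ys = {Y. Y \<subseteq> {..<p} \<and> card Y = Suc (Suc d)}"
  have fYs: "finite Ys" unfolding Ys_def by (rule finite_subset[of _ "Pow {..<p}"]) auto
  have "\<forall>Y\<in>Ys. \<exists>\<beta>\<in>exps Y. mon \<beta> \<in> span (mon ` {\<alpha> \<in> exps Y. tdeg \<alpha> = tdeg \<beta> \<and> wt \<alpha> < wt \<beta>})"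
  proof
    fix Y assume "Y \<in> Ys"
    then have "Y \<subseteq> {..<p}" "\<not> card Y \<le> card X" using card_X unfolding Ys_def by auto
    then show "\<exists>\<beta>\<in>exps Y. mon \<beta> \<in> span (mon ` {\<alpha> \<in> exps Y. tdeg \<alpha> = tdeg \<beta> \<and> wt \<alpha> < wt \<beta>})"
      using not_alg_indep_leading X_max by blast
  qed
  then have "\<forall>Y\<in>Ys. \<exists>\<beta>. \<beta> \<in> exps Y \<and> mon \<beta> \<in> span (mon ` {\<alpha> \<in> exps Y. tdeg \<alpha> = tdeg \<beta> \<and> wt \<alpha> < wt \<beta>})"
    by blast
  from bchoice[OF this] obtain b where b: "\<And>Y. Y \<in> Ys \<Longrightarrow> b Y \<in> exps Y"
    "\<And>Y. Y \<in> Ys \<Longrightarrow> mon (b Y) \<in> span (mon ` {\<alpha> \<in> exps Y. tdeg \<alpha> = tdeg (b Y) \<and> wt \<alpha> < wt (b Y)})"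
    by blast
  \<comment> \<open>\<open>e\<close> dominates every exponent of every leading monomial, so a
    monomial with \<open>d + 2\<close> exponents at least \<open>e\<close> is divisible by one of
    them.\<close>
  define e where "e = (\<Sum>Y\<in>Ys. tdeg (b Y))"
  have be: "b Y i \<le> e" if "Y \<in> Ys" for Y i
  proof (cases "i < p")
    case True
    then have "b Y i \<le> tdeg (b Y)" by (rule exps_le_tdeg)
    also have "\<dots> \<le> e" unfolding e_def by (rule member_le_sum) (use that fYs in auto)
    finally show ?thesis .
  next
    case False
    then show ?thesis using b(1)[OF that] that unfolding Ys_def exps_def by auto
  qed
  define Gd where "Gd m = {\<alpha> \<in> exps {..<p}. tdeg \<alpha> = m \<and> card {i. i < p \<and> e \<le> \<alpha> i} \<le> Suc d}" for m
  have red: "mon \<alpha> \<in> span (mon ` {\<alpha>' \<in> exps {..<p}. tdeg \<alpha>' = tdeg \<alpha> \<and> wt \<alpha>' < wt \<alpha>})" (is "_ \<in> span ?S")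
    if \<alpha>: "\<alpha> \<in> exps {..<p}" "\<alpha> \<notin> Gd (tdeg \<alpha>)" for \<alpha>
  proof -
    have "Suc (Suc d) \<le> card {i. i < p \<and> e \<le> \<alpha> i}" using \<alpha> unfolding Gd_def by auto
    then obtain Y where Y: "Y \<subseteq> {i. i < p \<and> e \<le> \<alpha> i}" "card Y = Suc (Suc d)"
      by (meson obtain_subset_with_card_n)
    then have Ys: "Y \<in> Ys" unfolding Ys_def by auto
    define \<gamma> where "\<gamma> i = \<alpha> i - b Y i" for i
    have le: "b Y i \<le> \<alpha> i" for i
      using be[OF Ys, of i] b(1)[OF Ys] Y(1) le_trans unfolding exps_def by (cases "i \<in> Y") fastforce+
    have \<gamma>: "\<alpha> = (\<lambda>i. \<gamma> i + b Y i)" using le by (auto simp: \<gamma>_def)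
    have "\<gamma> \<in> exps {..<p}" using \<alpha>(1) unfolding \<gamma>_def exps_def by auto
    have "mon \<gamma> * mon (b Y) \<in> span ?S"
    proof (rule span_mult[of _ "{mon \<gamma>}", OF _ b(2)[OF Ys]])
      show "mon \<gamma> \<in> span {mon \<gamma>}" by (simp add: span_base)
      fix x z assume "x \<in> {mon \<gamma>}" "z \<in> mon ` {\<alpha> \<in> exps Y. tdeg \<alpha> = tdeg (b Y) \<and> wt \<alpha> < wt (b Y)}"
      then obtain \<delta> where \<delta>: "\<delta> \<in> exps Y" "tdeg \<delta> = tdeg (b Y)" "wt \<delta> < wt (b Y)" "x * z = mon (\<lambda>i. \<gamma> i + \<delta> i)"
        by (auto simp: mon_add)
      have "\<delta> \<in> exps {..<p}" using \<delta>(1) Ys exps_mono unfolding Ys_def by blast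
      then show "x * z \<in> span ?S" unfolding \<delta>(4)
        using exps_add[OF \<open>\<gamma> \<in> exps {..<p}\<close>] \<delta> \<gamma> tdeg_add wt_add
        by (intro span_base imageI CollectI) (metis add_left_mono add_strict_left_mono)
    qed
    moreover have "mon \<alpha> = mon \<gamma> * mon (b Y)" by (subst \<gamma>) (rule mon_add)
    ultimately show ?thesis by simp
  qed
  \<comment> \<open>Weights may be negative; the descent is therefore on the number of lighter
    monomials of the same degree, which is finite.\<close>
  have "mon \<alpha> \<in> span (mon ` Gd m)" if "\<alpha> \<in> exps {..<p}" "tdeg \<alpha> = m" for \<alpha> m
    using that
  proof (induction "card {\<alpha>' \<in> {\<alpha>' \<in> exps {..<p}. tdeg \<alpha>' = m}. wt \<alpha>' < wt \<alpha>}" arbitrary: \<alpha> rule: less_induct)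
    case less
    show ?case
    proof (cases "\<alpha> \<in> Gd m")
      case True then show ?thesis by (simp add: span_base)
    next
      case False
      have "mon \<beta> \<in> span (mon ` Gd m)" if \<beta>: "\<beta> \<in> exps {..<p}" "tdeg \<beta> = m" "wt \<beta> < wt \<alpha>" for \<beta>
      proof (rule less.hyps[OF psubset_card_mono])
        show "{\<alpha>' \<in> {\<alpha>' \<in> exps {..<p}. tdeg \<alpha>' = m}. wt \<alpha>' < wt \<beta>} \<subset> {\<alpha>' \<in> {\<alpha>' \<in> exps {..<p}. tdeg \<alpha>' = m}. wt \<alpha>' < wt \<alpha>}"
          using \<beta> by auto
        show "finite {\<alpha>' \<in> {\<alpha>' \<in> exps {..<p}. tdeg \<alpha>' = m}. wt \<alpha>' < wt \<alpha>}"
          by (rule finite_subset[OF _ finite_exps_tdeg[of m]]) auto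
      qed (use \<beta> in auto)
      then have "span (mon ` {\<alpha>' \<in> exps {..<p}. tdeg \<alpha>' = tdeg \<alpha> \<and> wt \<alpha>' < wt \<alpha>}) \<subseteq> span (mon ` Gd m)"
        using less.prems by (intro span_minimal) auto
      then show ?thesis using red less.prems False by auto
    qed
  qed
  then have "span (mon ` {\<alpha> \<in> exps {..<p}. tdeg \<alpha> = m}) \<subseteq> span (mon ` Gd m)" for m
    by (intro span_minimal) auto
  then have BG: "B m \<subseteq> span (mon ` Gd m)" for m using B_span_mon by blast
  have fGd: "finite (Gd m)" for m unfolding Gd_def by (rule finite_subset[OF _ finite_exps_tdeg[of m]]) auto
  define Zs where "Zs = {Y. Y \<subseteq> {..<p} \<and> card Y = Suc d}"
  have fZs: "finite Zs" unfolding Zs_def by (rule finite_subset[of _ "Pow {..<p}"]) auto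
  define Gy where "Gy m Y = {\<alpha> \<in> exps {..<p}. tdeg \<alpha> = m \<and> (\<forall>i\<in>{..<p} - Y. \<alpha> i < e)}" for m Y
  have "Suc d \<le> p" using card_mono[OF _ X_le] card_X by simp
  then have GdU: "Gd m \<subseteq> (\<Union>Y\<in>Zs. Gy m Y)" for m
  proof (intro subsetI)
    fix \<alpha> assume \<alpha>: "\<alpha> \<in> Gd m"
    then obtain Y where Y: "{i. i < p \<and> e \<le> \<alpha> i} \<subseteq> Y" "Y \<subseteq> {..<p}" "card Y = Suc d"
      using exists_subset_between[of "{i. i < p \<and> e \<le> \<alpha> i}" "Suc d" "{..<p}"] \<open>Suc d \<le> p\<close> unfolding Gd_def by auto
    have "\<alpha> i < e" if "i \<in> {..<p} - Y" for i using Y(1) that by (metis DiffD1 DiffD2 lessThan_iff mem_Collect_eq not_le subsetD)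
    then have "\<alpha> \<in> Gy m Y" using \<alpha> unfolding Gd_def Gy_def by auto
    then show "\<alpha> \<in> (\<Union>Y\<in>Zs. Gy m Y)" using Y unfolding Zs_def by blast
  qed
  have cGy: "card (Gy m Y) \<le> e ^ (p - Suc d) * (m + 1) ^ d" if "Y \<in> Zs" for m Y
  proof -
    have Y: "Y \<subseteq> {..<p}" "card Y = Suc d" using that unfolding Zs_def by auto
    have fY: "finite Y" using Y(1) by (rule finite_subset) simp
    \<comment> \<open>The exponent of \<open>i1\<close> is recovered from the total degree, so only
      \<open>d\<close> large exponents are counted.\<close>
    obtain i1 where i1: "i1 \<in> Y" using Y(2) by fastforce
    let ?D = "{..<p} - {i1}"
    let ?r = "\<lambda>i. if i \<in> Y then {..m} else {..<e}"
    have "card (Gy m Y) \<le> card (PiE ?D ?r)"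
    proof (rule card_inj_on_le)
      show "inj_on (\<lambda>\<alpha>. restrict \<alpha> ?D) (Gy m Y)"
      proof (rule inj_onI)
        fix \<alpha> \<beta> assume h: "\<alpha> \<in> Gy m Y" "\<beta> \<in> Gy m Y" "restrict \<alpha> ?D = restrict \<beta> ?D"
        have eq: "\<alpha> i = \<beta> i" if "i \<in> ?D" for i using fun_cong[OF h(3), of i] that by simp
        have t: "tdeg g = g i1 + (\<Sum>i\<in>?D. g i)" for g
          unfolding tdeg_def using i1 Y(1) by (intro sum.remove) auto
        have "(\<Sum>i\<in>?D. \<alpha> i) = (\<Sum>i\<in>?D. \<beta> i)" using eq by (rule sum.cong[OF refl])
        then have "\<alpha> i1 = \<beta> i1" using h(1,2) t[of \<alpha>] t[of \<beta>] unfolding Gy_def by auto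
        then have "\<alpha> i = \<beta> i" for i
          using eq[of i] h(1,2) unfolding Gy_def exps_def by (cases "i = i1"; cases "i < p") auto
        then show "\<alpha> = \<beta>" by (rule ext)
      qed
      show "(\<lambda>\<alpha>. restrict \<alpha> ?D) ` Gy m Y \<subseteq> PiE ?D ?r"
        using exps_le_tdeg unfolding Gy_def by (intro image_subsetI restrict_PiE_iff[THEN iffD2]) auto
      show "finite (PiE ?D ?r)" by (intro finite_PiE) auto
    qed
    also have "\<dots> = (\<Prod>i\<in>?D. if i \<in> Y then m + 1 else e)" by (subst card_PiE) (auto intro!: prod.cong split: if_splits)
    also have "\<dots> = (m + 1) ^ card (?D \<inter> Y) * e ^ card (?D \<inter> - Y)"
      by (subst prod.If_cases) auto
    also have "?D \<inter> Y = Y - {i1}" using Y by auto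
    also have "?D \<inter> - Y = {..<p} - Y" using i1 by auto
    also have "card ({..<p} - Y) = p - Suc d" using Y fY by (simp add: card_Diff_subset)
    also have "card (Y - {i1}) = d" using Y fY i1 by simp
    finally show ?thesis by (simp add: mult.commute)
  qed
  have "dim (B m) \<le> card Zs * e ^ (p - Suc d) * (m + 1) ^ d" for m
  proof -
    have "dim (B m) \<le> card (mon ` Gd m)" using dim_le_card[OF BG] fGd by simp
    also have "\<dots> \<le> card (Gd m)" using fGd card_image_le by blast
    also have "\<dots> \<le> card (\<Union>Y\<in>Zs. Gy m Y)"
    proof (rule card_mono[OF _ GdU])
      have "finite (Gy m Y)" for Y unfolding Gy_def by (rule finite_subset[OF _ finite_exps_tdeg[of m]]) auto
      then show "finite (\<Union>Y\<in>Zs. Gy m Y)" using fZs by blast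
    qed
    also have "\<dots> \<le> (\<Sum>Y\<in>Zs. card (Gy m Y))" by (rule card_UN_le[OF fZs])
    also have "\<dots> \<le> (\<Sum>Y\<in>Zs. e ^ (p - Suc d) * (m + 1) ^ d)" by (rule sum_mono[OF cGy])
    finally show ?thesis by simp
  qed
  then show ?thesis using that by blast
qed

end

section \<open>A valuation extending a monomial one\<close>

lemma to_fract_power: "to_fract (a ^ n) = to_fract a ^ n"
  by (induction n) auto

context graded_domain_tr
begin

lemma mon_nonzero: "\<alpha> \<in> exps X \<Longrightarrow> mon \<alpha> \<noteq> 0"
  using X_indep[unfolded alg_indep_def, rule_format, of "{\<alpha>}" "\<lambda>_. 1" \<alpha>] by auto

lemma mon_notin_span:
  assumes "S \<subseteq> exps X" "\<delta> \<in> exps X" "\<delta> \<notin> S"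
  shows "mon \<delta> \<notin> span (mon ` S)"
proof
  assume "mon \<delta> \<in> span (mon ` S)"
  then obtain t r where t: "finite t" "t \<subseteq> mon ` S" "mon \<delta> = (\<Sum>a\<in>t. sc (r a) a)"
    unfolding span_explicit by blast
  obtain U where U: "U \<subseteq> S" "inj_on mon U" "t = mon ` U" using t(2) unfolding subset_image_inj by blast
  have fU: "finite U" using t(1) U finite_imageD by blast
  have \<delta>U: "\<delta> \<notin> U" using U assms by blast
  define c where "c \<alpha> = (if \<alpha> = \<delta> then -1 else r (mon \<alpha>))" for \<alpha>
  have "(\<Sum>\<alpha>\<in>insert \<delta> U. sc (c \<alpha>) (mon \<alpha>)) = sc (c \<delta>) (mon \<delta>) + (\<Sum>\<alpha>\<in>U. sc (c \<alpha>) (mon \<alpha>))"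
    using fU \<delta>U by simp
  also have "(\<Sum>\<alpha>\<in>U. sc (c \<alpha>) (mon \<alpha>)) = (\<Sum>\<alpha>\<in>U. sc (r (mon \<alpha>)) (mon \<alpha>))"
    by (rule sum.cong) (use \<delta>U in \<open>auto simp: c_def\<close>)
  also have "\<dots> = mon \<delta>" using t(3) U by (simp add: sum.reindex)
  finally have "(\<Sum>\<alpha>\<in>insert \<delta> U. sc (c \<alpha>) (mon \<alpha>)) = 0" by (simp add: c_def)
  then have "c \<delta> = 0" using X_indep[unfolded alg_indep_def, rule_format, of "insert \<delta> U" c \<delta>] fU U assms by auto
  then show False by (simp add: c_def)
qed

text \<open>The variable that absorbs degree constraints: powers of \<open>y i0\<close> are used to
  move elements into a common degree.\<close>

definition i0 :: nat where "i0 = (SOME i. i \<in> X)"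

lemma i0_X: "i0 \<in> X" and i0_p: "i0 < p"
proof -
  show "i0 \<in> X" unfolding i0_def using X_nonempty by (simp add: some_in_eq)
  then show "i0 < p" using X_le by auto
qed

lemma y_i0_nonzero: "y i0 \<noteq> 0"
  using mon_nonzero[OF single_exp(4)[OF i0_p i0_X, of 1]] single_exp(1)[OF i0_p, of 1] by simp

lemma tdeg_exps_X: assumes "j \<in> exps X" shows "tdeg j = j i0 + (\<Sum>i\<in>X - {i0}. j i)"
proof -
  have "tdeg j = (\<Sum>i\<in>X. j i)"
    unfolding tdeg_def by (rule sum.mono_neutral_right) (use X_le assms in \<open>auto simp: exps_def\<close>)
  then show ?thesis using sum.remove[OF finite_X i0_X, of j] by simp
qed

text \<open>The \<open>d\<close> coordinates other than \<open>i0\<close> run freely through the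
  residues modulo \<open>k\<close>. Their sum is at most \<open>d * (k - 1)\<close>, and the
  coordinate \<open>i0\<close> fills it up, so that all monomials of the box have one
  degree.\<close>

definition box :: "nat \<Rightarrow> (nat \<Rightarrow> nat) set" where
  "box k = {j \<in> exps X. (\<forall>i\<in>X - {i0}. j i < k) \<and> tdeg j = d * (k - 1)}"

lemma finite_box: "finite (box k)"
  using exps_mono[OF X_le] unfolding box_def
  by (intro finite_subset[OF _ finite_exps_tdeg[of "d * (k - 1)"]]) auto

lemma card_box: assumes "k \<ge> 1" shows "k ^ d \<le> card (box k)"
proof -
  let ?D = "X - {i0}"
  have cD: "card ?D = d" using card_X i0_X finite_X by simp
  have "k ^ d = card (PiE ?D (\<lambda>_. {..<k}))" using cD finite_X by (simp add: card_PiE)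
  also have "\<dots> \<le> card (box k)"
  proof (rule card_inj_on_le)
    let ?f = "\<lambda>g i. if i = i0 then d * (k - 1) - (\<Sum>i\<in>?D. g i) else if i \<in> X then g i else 0"
    show "inj_on ?f (PiE ?D (\<lambda>_. {..<k}))"
    proof (rule inj_onI)
      fix g h assume gh: "g \<in> PiE ?D (\<lambda>_. {..<k})" "h \<in> PiE ?D (\<lambda>_. {..<k})" "?f g = ?f h"
      show "g = h"
      proof (rule PiE_ext[OF gh(1,2)])
        fix i assume "i \<in> ?D"
        then show "g i = h i" using fun_cong[OF gh(3), of i] by auto
      qed
    qed
    show "?f ` PiE ?D (\<lambda>_. {..<k}) \<subseteq> box k"
    proof (rule image_subsetI)
      fix g assume g: "g \<in> PiE ?D (\<lambda>_. {..<k})"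
      have e: "?f g \<in> exps X" using i0_X by (auto simp: exps_def)
      have lt: "g i < k" if "i \<in> ?D" for i using g that by auto
      have "(\<Sum>i\<in>?D. g i) \<le> (\<Sum>i\<in>?D. k - 1)" using lt by (intro sum_mono) fastforce
      then have le: "(\<Sum>i\<in>?D. g i) \<le> d * (k - 1)" using cD by simp
      have "(\<Sum>i\<in>?D. ?f g i) = (\<Sum>i\<in>?D. g i)" by (rule sum.cong) auto
      then have "tdeg (?f g) = d * (k - 1)" using tdeg_exps_X[OF e] le by simp
      then show "?f g \<in> box k" using e lt unfolding box_def by auto
    qed
    show "finite (box k)" by (rule finite_box)
  qed
  finally show ?thesis .
qed

text \<open>The bound \<open>\<rho>\<close> limits how many elements of one degree can be linearly independent over the
  polynomial ring in the variables \<open>X\<close>.\<close>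

lemma rank_bound: obtains \<rho> where "\<And>M k. M < k \<Longrightarrow> dim (B (d * (k - 1) + M)) \<le> \<rho> * k ^ d"
proof -
  obtain C where C: "\<And>m. dim (B m) \<le> C * (m + 1) ^ d" using dim_B_bound by blast
  have "dim (B (d * (k - 1) + M)) \<le> C * (d + 1) ^ d * k ^ d" if "M < k" for M k
  proof -
    have "d * (k - 1) + M + 1 \<le> (d + 1) * k"
      using that mult_le_mono2[of "k - 1" k d] by (simp add: algebra_simps)
    then have "(d * (k - 1) + M + 1) ^ d \<le> ((d + 1) * k) ^ d" by (rule power_mono) simp
    then have "C * (d * (k - 1) + M + 1) ^ d \<le> C * ((d + 1) * k) ^ d" by (rule mult_le_mono2)
    then show ?thesis using C[of "d * (k - 1) + M"] unfolding power_mult_distrib mult.assoc by linarith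
  qed
  then show ?thesis using that by blast
qed

lemma sc_one_mult: "sc c a = sc c 1 * a"
  using sc_mult[of c 1 a] by simp

text \<open>\<open>R0\<close> consists of the fractions \<open>a / mon \<beta>\<close> in which
  every monomial of the polynomial \<open>a\<close> weighs at least as much as
  \<open>mon \<beta>\<close>; these have nonnegative monomial value. \<open>P\<close> is the set of
  monomial quotients of positive value.\<close>

lemma monomial_valuation_ring_exists:
  obtains V :: "'b fract set" where "valuation_ring V"
    "\<And>\<alpha> \<beta>. \<alpha> \<in> exps X \<Longrightarrow> \<beta> \<in> exps X \<Longrightarrow> wt \<beta> \<le> wt \<alpha> \<Longrightarrow> mfrac \<alpha> \<beta> \<in> V"
    "\<And>\<alpha> \<beta>. \<alpha> \<in> exps X \<Longrightarrow> \<beta> \<in> exps X \<Longrightarrow> wt \<alpha> < wt \<beta> \<Longrightarrow> mfrac \<alpha> \<beta> \<notin> V"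
    "\<And>c. to_fract (sc c 1) \<in> V"
proof -
  define A where "A t = span (mon ` {\<alpha> \<in> exps X. t \<le> wt \<alpha>})" for t
  have A_mon: "mon \<alpha> \<in> A t" if "\<alpha> \<in> exps X" "t \<le> wt \<alpha>" for \<alpha> t
    unfolding A_def using that by (intro span_base) auto
  have A_mult: "a * b \<in> A (s + t)" if "a \<in> A s" "b \<in> A t" for a b s t
    unfolding A_def
  proof (rule span_mult)
    show "a \<in> span (mon ` {\<alpha> \<in> exps X. s \<le> wt \<alpha>})" "b \<in> span (mon ` {\<alpha> \<in> exps X. t \<le> wt \<alpha>})"
      using that unfolding A_def by auto
    fix x z assume "x \<in> mon ` {\<alpha> \<in> exps X. s \<le> wt \<alpha>}" "z \<in> mon ` {\<alpha> \<in> exps X. t \<le> wt \<alpha>}"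
    then obtain \<alpha> \<beta> where h: "\<alpha> \<in> exps X" "\<beta> \<in> exps X" "s \<le> wt \<alpha>" "t \<le> wt \<beta>" "x = mon \<alpha>" "z = mon \<beta>" by auto
    have "mon (\<lambda>i. \<alpha> i + \<beta> i) \<in> A (s + t)"
      using h by (intro A_mon exps_add) (auto simp: wt_add)
    then show "x * z \<in> span (mon ` {\<alpha> \<in> exps X. s + t \<le> wt \<alpha>})" unfolding A_def mon_add h(5,6) .
  qed
  define R0 where "R0 = {to_fract a / to_fract (mon \<beta>) | a \<beta>. \<beta> \<in> exps X \<and> a \<in> A (wt \<beta>)}"
  define P where "P = {mfrac \<alpha> \<beta> | \<alpha> \<beta>. \<alpha> \<in> exps X \<and> \<beta> \<in> exps X \<and> wt \<beta> < wt \<alpha>}"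
  have R0_mon: "mfrac \<alpha> \<beta> \<in> R0"
    if "\<alpha> \<in> exps X" "\<beta> \<in> exps X" "wt \<beta> \<le> wt \<alpha>" for \<alpha> \<beta>
    unfolding R0_def using that A_mon by blast
  have R0_const: "to_fract (sc c 1) \<in> R0" for c
  proof -
    have "sc c 1 \<in> A (wt (\<lambda>i. 0))" using A_mon[OF exps_zero[of X], of 0]
      unfolding A_def mon_zero wt_zero by (intro span_scale) simp
    then have "to_fract (sc c 1) / to_fract (mon (\<lambda>i. 0)) \<in> R0" unfolding R0_def using exps_zero by blast
    then show ?thesis by (simp add: mon_zero)
  qed
  have sub: "is_subring R0" unfolding is_subring_def
  proof (intro conjI ballI)
    show "1 \<in> R0" using R0_mon[OF exps_zero exps_zero] by (simp add: mon_zero)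
    fix u w assume "u \<in> R0" "w \<in> R0"
    then obtain a b \<beta> \<gamma> where h: "\<beta> \<in> exps X" "\<gamma> \<in> exps X" "a \<in> A (wt \<beta>)" "b \<in> A (wt \<gamma>)"
      "u = to_fract a / to_fract (mon \<beta>)" "w = to_fract b / to_fract (mon \<gamma>)" unfolding R0_def by blast
    let ?\<delta> = "\<lambda>i. \<beta> i + \<gamma> i"
    have nz: "to_fract (mon \<beta>) \<noteq> 0" "to_fract (mon \<gamma>) \<noteq> 0" using h mon_nonzero by auto
    have "u - w = to_fract (a * mon \<gamma> - mon \<beta> * b) / to_fract (mon ?\<delta>)"
      "u * w = to_fract (a * b) / to_fract (mon ?\<delta>)"
      unfolding h(5,6) mon_add using nz by (auto simp: field_simps)
    moreover have "a * mon \<gamma> - mon \<beta> * b \<in> A (wt ?\<delta>)" "a * b \<in> A (wt ?\<delta>)"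
      unfolding wt_add using A_mult[OF h(3) A_mon[OF h(2) order_refl]] A_mult[OF A_mon[OF h(1) order_refl] h(4)]
        A_mult[OF h(3,4)] by (auto simp: A_def intro: span_diff)
    moreover have "?\<delta> \<in> exps X" using h exps_add by blast
    ultimately show "u - w \<in> R0" "u * w \<in> R0" unfolding R0_def by blast+
  qed
  have P_R0: "P \<subseteq> R0" unfolding P_def using R0_mon by force
  have P0: "0 \<notin> P" unfolding P_def using mon_nonzero by auto
  \<comment> \<open>Independence of the weights makes \<open>\<omega> i0\<close> nonzero; its sign
    decides whether \<open>y i0\<close> or its inverse has positive value.\<close>
  have Pne: "P \<noteq> {}"
  proof -
    have "\<omega> i0 \<noteq> 0"
    proof
      assume "\<omega> i0 = 0"
      then have "(\<Sum>i<p. real_of_int (if i = i0 then 1 else 0) * \<omega> i) = 0" by (intro sum.neutral) auto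
      from \<omega>_indep[OF this i0_p] show False by simp
    qed
    note e = single_exp(3)[OF i0_p, of 1] single_exp(4)[OF i0_p i0_X, of 1]
    show ?thesis
    proof (cases "\<omega> i0 > 0")
      case True
      then show ?thesis unfolding P_def using e exps_zero wt_zero by fastforce
    next
      case False
      then have "wt (\<lambda>j. if j = i0 then 1 else 0) < wt (\<lambda>j. 0)" using \<open>\<omega> i0 \<noteq> 0\<close> e(1) wt_zero by auto
      then show ?thesis unfolding P_def using e(2) exps_zero by blast
    qed
  qed
  have tot: "u / w \<in> R0 \<or> w / u \<in> R0" if uw: "u \<in> P" "w \<in> P" for u w
  proof -
    obtain \<alpha> \<beta> \<gamma> \<delta> where h: "\<alpha> \<in> exps X" "\<beta> \<in> exps X" "\<gamma> \<in> exps X" "\<delta> \<in> exps X"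
      "u = mfrac \<alpha> \<beta>" "w = mfrac \<gamma> \<delta>"
      using uw unfolding P_def by blast
    have "u / w = to_fract (mon (\<lambda>i. \<alpha> i + \<delta> i)) / to_fract (mon (\<lambda>i. \<beta> i + \<gamma> i))"
      "w / u = to_fract (mon (\<lambda>i. \<beta> i + \<gamma> i)) / to_fract (mon (\<lambda>i. \<alpha> i + \<delta> i))"
      unfolding mon_add h(5,6) by (auto simp: field_simps)
    then show ?thesis
      using R0_mon[OF exps_add[OF h(1,4)] exps_add[OF h(2,3)]] R0_mon[OF exps_add[OF h(2,3)] exps_add[OF h(1,4)]]
      by (metis linear)
  qed
  \<comment> \<open>Clearing denominators would express a monomial through monomials that are
    strictly heavier, against algebraic independence.\<close>
  have inv: "inverse u \<notin> R0" if uP: "u \<in> P" for u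
  proof
    assume "inverse u \<in> R0"
    then obtain a \<gamma> where g: "\<gamma> \<in> exps X" "a \<in> A (wt \<gamma>)" "inverse u = to_fract a / to_fract (mon \<gamma>)"
      unfolding R0_def by blast
    obtain \<alpha> \<beta> where h: "\<alpha> \<in> exps X" "\<beta> \<in> exps X" "wt \<beta> < wt \<alpha>" "u = mfrac \<alpha> \<beta>"
      using uP unfolding P_def by blast
    have nz: "to_fract (mon \<alpha>) \<noteq> 0" "to_fract (mon \<gamma>) \<noteq> 0" using g h mon_nonzero by auto
    have "mfrac \<beta> \<alpha> = to_fract a / to_fract (mon \<gamma>)"
      using g(3) h(4) by simp
    then have "to_fract (mon \<beta>) * to_fract (mon \<gamma>) = to_fract a * to_fract (mon \<alpha>)" using nz by (simp add: field_simps)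
    then have "mon (\<lambda>i. \<beta> i + \<gamma> i) = a * mon \<alpha>" unfolding mon_add by (metis to_fract_mult to_fract_eq_iff)
    also have "\<dots> \<in> A (wt \<gamma> + wt \<alpha>)" using A_mult[OF g(2) A_mon[OF h(1) order_refl]] .
    finally have "mon (\<lambda>i. \<beta> i + \<gamma> i) \<in> span (mon ` {\<delta> \<in> exps X. wt \<gamma> + wt \<alpha> \<le> wt \<delta>})" unfolding A_def .
    moreover have "(\<lambda>i. \<beta> i + \<gamma> i) \<notin> {\<delta> \<in> exps X. wt \<gamma> + wt \<alpha> \<le> wt \<delta>}"
      using h(3) by (simp add: wt_add)
    ultimately show False
      using mon_notin_span[of "{\<delta> \<in> exps X. wt \<gamma> + wt \<alpha> \<le> wt \<delta>}" "\<lambda>i. \<beta> i + \<gamma> i"] exps_add[OF h(2) g(1)]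
      by simp
  qed
  have "\<exists>V. is_subring V \<and> R0 \<subseteq> V \<and> (\<forall>u\<in>P. inverse u \<notin> V) \<and> (\<forall>u. u \<in> V \<or> inverse u \<in> V)"
    by (rule valuation_ring_exists[OF sub P_R0 P0 Pne tot inv]) blast+
  then obtain V where V: "is_subring V" "R0 \<subseteq> V" "\<And>u. u \<in> P \<Longrightarrow> inverse u \<notin> V" "\<And>u. u \<in> V \<or> inverse u \<in> V"
    by blast
  have no: "mfrac \<alpha> \<beta> \<notin> V" if "\<alpha> \<in> exps X" "\<beta> \<in> exps X" "wt \<alpha> < wt \<beta>" for \<alpha> \<beta>
  proof -
    have "mfrac \<beta> \<alpha> \<in> P" unfolding P_def using that by blast
    from V(3)[OF this] show ?thesis by simp
  qed
  have "valuation_ring V" using V by unfold_locales auto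
  then show ?thesis by (rule that[OF _ subsetD[OF V(2) R0_mon] no subsetD[OF V(2) R0_const]])
qed

end

lemma (in valuation_ring) assoc_mem: assumes "a \<in> V" "assoc a b" shows "b \<in> V"
proof -
  have "a * (b / a) \<in> V" using assms closed(4) unfolding assoc_def by blast
  then show ?thesis using assms unfolding assoc_def by simp
qed

lemma (in valuation_ring) assoc_max_ideal: assumes "a \<in> max_ideal" "assoc a b" shows "b \<in> max_ideal"
proof -
  have "assoc (inverse b) (inverse a)" using assms(2) assoc_inverse assoc_sym by blast
  then show ?thesis using assms assoc_mem assoc_sym unfolding max_ideal_def assoc_def by blast
qed

section \<open>The value of a homogeneous element as a rational combination of weights\<close>

locale graded_domain_val = graded_domain_tr sc B y p \<omega> X + valuation_ring V
  for sc :: "'k::field \<Rightarrow> 'b::idom \<Rightarrow> 'b" and B :: "nat \<Rightarrow> 'b set" and y :: "nat \<Rightarrow> 'b"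
    and p :: nat and \<omega> :: "nat \<Rightarrow> real" and X :: "nat set" and V :: "'b fract set" +
  assumes V_mon: "\<alpha> \<in> exps X \<Longrightarrow> \<beta> \<in> exps X \<Longrightarrow> wt \<beta> \<le> wt \<alpha> \<Longrightarrow> mfrac \<alpha> \<beta> \<in> V"
    and V_mon_notin: "\<alpha> \<in> exps X \<Longrightarrow> \<beta> \<in> exps X \<Longrightarrow> wt \<alpha> < wt \<beta> \<Longrightarrow> mfrac \<alpha> \<beta> \<notin> V"
    and V_const: "to_fract (sc c 1) \<in> V"
begin

lemma assoc_sc: assumes "c \<noteq> 0" "a \<noteq> 0" shows "assoc (to_fract (sc c a)) (to_fract a)"
proof -
  have "sc c 1 * sc (inverse c) 1 = 1" using assms(1) by (simp add: sc_mult[symmetric])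
  then have 1: "to_fract (sc c 1) * to_fract (sc (inverse c) 1) = 1" by (metis to_fract_1 to_fract_mult)
  then have "inverse (to_fract (sc c 1)) = to_fract (sc (inverse c) 1)" by (rule inverse_unique)
  then have "to_fract a / to_fract (sc c a) = to_fract (sc (inverse c) 1)"
    "to_fract (sc c a) / to_fract a = to_fract (sc c 1)"
    using assms sc_one_mult[of c a] by (auto simp: divide_inverse)
  then show ?thesis unfolding assoc_def using assms V_const by simp
qed

text \<open>Distinct exponents have distinct weights, so the lightest monomial with nonzero
  coefficient dominates the sum.\<close>

lemma assoc_leading_mon:
  assumes T: "finite T" "T \<subseteq> exps X" and nz: "\<exists>\<alpha>\<in>T. c \<alpha> \<noteq> 0"
  shows "\<exists>\<alpha>\<in>T. assoc (to_fract (\<Sum>\<alpha>\<in>T. sc (c \<alpha>) (mon \<alpha>))) (to_fract (mon \<alpha>))"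
proof -
  define T' where "T' = {\<alpha>\<in>T. c \<alpha> \<noteq> 0}"
  have fT': "finite T'" "T' \<noteq> {}" "T' \<subseteq> exps X" using T nz unfolding T'_def by auto
  obtain \<alpha>0 where \<alpha>0: "\<alpha>0 \<in> T'" "\<And>\<alpha>. \<alpha> \<in> T' \<Longrightarrow> wt \<alpha>0 \<le> wt \<alpha>"
    using Min_in[of "wt ` T'"] Min_le[of "wt ` T'"] fT' by fastforce
  define z where "z \<alpha> = to_fract (sc (c \<alpha>) (mon \<alpha>))" for \<alpha>
  have zas: "assoc (z \<alpha>) (to_fract (mon \<alpha>))" if "\<alpha> \<in> T'" for \<alpha>
    unfolding z_def using assoc_sc mon_nonzero that fT'(3) unfolding T'_def by blast
  have "assoc (sum z T') (z \<alpha>0)"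
  proof (rule assoc_dominant_term[OF fT'(1) \<alpha>0(1)])
    show "z \<alpha>0 \<noteq> 0" using zas[OF \<alpha>0(1)] unfolding assoc_def by simp
    fix \<alpha> assume a: "\<alpha> \<in> T'" "\<alpha> \<noteq> \<alpha>0"
    have e: "\<alpha> \<in> exps X" "\<alpha>0 \<in> exps X" using a \<alpha>0 fT' by auto
    then have "wt \<alpha> \<noteq> wt \<alpha>0" using wt_inj exps_mono[OF X_le] a(2) by blast
    then have lt: "wt \<alpha>0 < wt \<alpha>" using \<alpha>0(2)[OF a(1)] by simp
    have "mfrac \<alpha> \<alpha>0 \<in> max_ideal"
      unfolding max_ideal_def using V_mon[OF e] V_mon_notin[OF e(2,1) lt] lt by simp
    moreover have "assoc (z \<alpha> / z \<alpha>0) (mfrac \<alpha> \<alpha>0)"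
      using assoc_divide zas a(1) \<alpha>0(1) by blast
    ultimately show "z \<alpha> / z \<alpha>0 \<in> max_ideal" using assoc_max_ideal assoc_sym by blast
  qed
  moreover have "sum z T' = sum z T" unfolding T'_def by (rule sum.mono_neutral_left) (use T in \<open>auto simp: z_def\<close>)
  moreover have "sum z T = to_fract (\<Sum>\<alpha>\<in>T. sc (c \<alpha>) (mon \<alpha>))" unfolding z_def by simp
  ultimately have "assoc (to_fract (\<Sum>\<alpha>\<in>T. sc (c \<alpha>) (mon \<alpha>))) (to_fract (mon \<alpha>0))"
    using assoc_trans zas[OF \<alpha>0(1)] by simp
  then show ?thesis using \<alpha>0(1) unfolding T'_def by blast
qed

text \<open>\<open>r\<close> is the value of \<open>b\<close>, read off from a monomial quotient
  having the same value as \<open>b ^ i\<close>. The exponent \<open>i\<close> is kept as a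
  parameter because its size bounds the denominators of values.\<close>

definition vrel :: "nat \<Rightarrow> 'b \<Rightarrow> real \<Rightarrow> bool" where
  "vrel i b r \<longleftrightarrow> i \<ge> 1 \<and> (\<exists>\<alpha>\<in>exps X. \<exists>\<beta>\<in>exps X.
     assoc (to_fract b ^ i) (mfrac \<alpha> \<beta>) \<and> r = (wt \<alpha> - wt \<beta>) / real i)"

lemma vrel_nonzero: "vrel i b r \<Longrightarrow> b \<noteq> 0"
  unfolding vrel_def assoc_def by (auto simp: power_0_left)

lemma frac_mon_comb:
  assumes "\<alpha> \<in> exps X" "\<beta> \<in> exps X" "\<gamma> \<in> exps X" "\<delta> \<in> exps X"
  obtains \<mu> \<nu> where "\<mu> \<in> exps X" "\<nu> \<in> exps X"
    "(mfrac \<alpha> \<beta>) ^ j * (mfrac \<gamma> \<delta>) ^ i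
       = mfrac \<mu> \<nu>"
    "wt \<mu> - wt \<nu> = real j * (wt \<alpha> - wt \<beta>) + real i * (wt \<gamma> - wt \<delta>)"
proof (rule that)
  show "(\<lambda>l. j * \<alpha> l + i * \<gamma> l) \<in> exps X" "(\<lambda>l. j * \<beta> l + i * \<delta> l) \<in> exps X"
    using assms by (auto intro!: exps_add exps_mult)
  show "(mfrac \<alpha> \<beta>) ^ j * (mfrac \<gamma> \<delta>) ^ i
       = to_fract (mon (\<lambda>l. j * \<alpha> l + i * \<gamma> l)) / to_fract (mon (\<lambda>l. j * \<beta> l + i * \<delta> l))"
    by (simp add: mon_add mon_mult to_fract_power power_divide)
  show "wt (\<lambda>l. j * \<alpha> l + i * \<gamma> l) - wt (\<lambda>l. j * \<beta> l + i * \<delta> l)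
      = real j * (wt \<alpha> - wt \<beta>) + real i * (wt \<gamma> - wt \<delta>)"
    by (simp add: wt_add wt_mult algebra_simps)
qed

lemma vrel_mult:
  assumes "vrel i a r" "vrel j b s"
  shows "vrel (i * j) (a * b) (r + s)"
proof -
  obtain \<alpha> \<beta> \<gamma> \<delta> where h: "\<alpha> \<in> exps X" "\<beta> \<in> exps X" "\<gamma> \<in> exps X" "\<delta> \<in> exps X" "i \<ge> 1" "j \<ge> 1"
    "assoc (to_fract a ^ i) (mfrac \<alpha> \<beta>)" "r = (wt \<alpha> - wt \<beta>) / real i"
    "assoc (to_fract b ^ j) (mfrac \<gamma> \<delta>)" "s = (wt \<gamma> - wt \<delta>) / real j"
    using assms unfolding vrel_def by blast
  obtain \<mu> \<nu> where m: "\<mu> \<in> exps X" "\<nu> \<in> exps X"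
    "(mfrac \<alpha> \<beta>) ^ j * (mfrac \<gamma> \<delta>) ^ i
       = mfrac \<mu> \<nu>"
    "wt \<mu> - wt \<nu> = real j * (wt \<alpha> - wt \<beta>) + real i * (wt \<gamma> - wt \<delta>)"
    by (rule frac_mon_comb[OF h(1-4), where i = i and j = j])
  have "assoc ((to_fract a ^ i) ^ j * (to_fract b ^ j) ^ i) (mfrac \<mu> \<nu>)"
    unfolding m(3)[symmetric] by (intro assoc_mult assoc_power h)
  moreover have "(to_fract a ^ i) ^ j * (to_fract b ^ j) ^ i = to_fract (a * b) ^ (i * j)"
    by (simp add: power_mult_distrib power_mult[symmetric] mult.commute)
  moreover have "r + s = (wt \<mu> - wt \<nu>) / real (i * j)"
    unfolding m(4) h(8,10) using h(5,6) by (simp add: field_simps)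
  moreover have "i * j \<ge> 1" using h(5,6) by simp
  ultimately show ?thesis unfolding vrel_def using m(1,2) by auto
qed

lemma vrel_quotient:
  assumes "vrel i a r" "vrel j b s"
  obtains N \<mu> \<nu> where "N \<ge> 1" "\<mu> \<in> exps X" "\<nu> \<in> exps X"
    "assoc ((to_fract a / to_fract b) ^ N) (mfrac \<mu> \<nu>)" "wt \<mu> - wt \<nu> = real N * (r - s)"
proof -
  obtain \<alpha> \<beta> \<gamma> \<delta> where h: "\<alpha> \<in> exps X" "\<beta> \<in> exps X" "\<gamma> \<in> exps X" "\<delta> \<in> exps X" "i \<ge> 1" "j \<ge> 1"
    "assoc (to_fract a ^ i) (mfrac \<alpha> \<beta>)" "r = (wt \<alpha> - wt \<beta>) / real i"
    "assoc (to_fract b ^ j) (mfrac \<gamma> \<delta>)" "s = (wt \<gamma> - wt \<delta>) / real j"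
    using assms unfolding vrel_def by blast
  obtain \<mu> \<nu> where m: "\<mu> \<in> exps X" "\<nu> \<in> exps X"
    "(mfrac \<alpha> \<beta>) ^ j * (mfrac \<delta> \<gamma>) ^ i
       = mfrac \<mu> \<nu>"
    "wt \<mu> - wt \<nu> = real j * (wt \<alpha> - wt \<beta>) + real i * (wt \<delta> - wt \<gamma>)"
    by (rule frac_mon_comb[OF h(1,2,4,3), where i = i and j = j])
  have "assoc (inverse (to_fract b ^ j)) (mfrac \<delta> \<gamma>)"
    using assoc_inverse[OF h(9)] by simp
  then have "assoc ((to_fract a ^ i) ^ j * (inverse (to_fract b ^ j)) ^ i) (mfrac \<mu> \<nu>)"
    unfolding m(3)[symmetric] by (intro assoc_mult assoc_power h(7))
  moreover have "(to_fract a ^ i) ^ j * (inverse (to_fract b ^ j)) ^ i = (to_fract a / to_fract b) ^ (i * j)"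
    by (simp add: power_divide power_mult[symmetric] mult.commute divide_inverse power_inverse power_mult_distrib)
  moreover have "wt \<mu> - wt \<nu> = real (i * j) * (r - s)"
    unfolding m(4) h(8,10) using h(5,6) by (simp add: field_simps)
  moreover have "i * j \<ge> 1" using h(5,6) by simp
  ultimately show ?thesis using that m(1,2) by metis
qed

lemma vrel_le:
  assumes "vrel i a r" "vrel j b s" "to_fract a / to_fract b \<in> V"
  shows "s \<le> r"
proof (rule ccontr)
  assume "\<not> s \<le> r"
  obtain N \<mu> \<nu> where h: "N \<ge> 1" "\<mu> \<in> exps X" "\<nu> \<in> exps X"
    "assoc ((to_fract a / to_fract b) ^ N) (mfrac \<mu> \<nu>)" "wt \<mu> - wt \<nu> = real N * (r - s)"
    using vrel_quotient[OF assms(1,2)] by metis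
  have "real N * (r - s) < 0" using \<open>\<not> s \<le> r\<close> h(1) by (intro mult_pos_neg) auto
  then have "wt \<mu> < wt \<nu>" using h(5) by simp
  then show False using assoc_mem[OF closed(7)[OF assms(3)] h(4)] V_mon_notin h(2,3) by blast
qed

lemma vrel_unique: assumes "vrel i a r" "vrel j a s" shows "r = s"
proof -
  have "to_fract a / to_fract a \<in> V" using closed vrel_nonzero[OF assms(1)] by simp
  then show ?thesis using vrel_le assms by (meson antisym)
qed

text \<open>Valuation rings are closed under roots. If the quotient were outside \<open>V\<close>,
  its inverse would lie in \<open>V\<close> and \<open>r = s\<close>; then some \<open>N\<close>-th
  power of the quotient is in \<open>V\<close>, and multiplying it by \<open>N - 1\<close> factors
  of the inverse returns the quotient itself.\<close>

lemma vrel_ge: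
  assumes "vrel i a r" "vrel j b s" "s \<le> r"
  shows "to_fract a / to_fract b \<in> V"
proof (rule ccontr)
  assume n: "to_fract a / to_fract b \<notin> V"
  have nz: "to_fract a \<noteq> 0" "to_fract b \<noteq> 0" using vrel_nonzero assms(1,2) by auto
  then have ba: "to_fract b / to_fract a \<in> V" using n divide_total by blast
  then have rs: "r = s" using vrel_le[OF assms(2,1)] assms(3) by simp
  obtain N \<mu> \<nu> where h: "N \<ge> 1" "\<mu> \<in> exps X" "\<nu> \<in> exps X"
    "assoc ((to_fract a / to_fract b) ^ N) (mfrac \<mu> \<nu>)" "wt \<mu> - wt \<nu> = real N * (r - s)"
    using vrel_quotient[OF assms(1,2)] by metis
  have "mfrac \<mu> \<nu> \<in> V" using V_mon[OF h(2,3)] h(5) rs by simp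
  then have "(to_fract a / to_fract b) ^ N \<in> V" using assoc_mem assoc_sym[OF h(4)] by blast
  then have "(to_fract a / to_fract b) ^ N * (to_fract b / to_fract a) ^ (N - 1) \<in> V"
    using closed(4,7) ba by blast
  also have "(to_fract a / to_fract b) ^ N * (to_fract b / to_fract a) ^ (N - 1) = to_fract a / to_fract b"
    using h(1) nz by (cases N) (auto simp: power_divide)
  finally show False using n by simp
qed

text \<open>Evaluated only where a value exists, in particular at nonzero homogeneous elements by
  \<open>vrel_exists\<close>; \<open>vrel_unique\<close> makes the description definite.\<close>

definition v :: "'b \<Rightarrow> real" where "v b = (THE r. \<exists>i. vrel i b r)"

lemma v_eq: "vrel i b r \<Longrightarrow> v b = r"
  unfolding v_def using vrel_unique by blast

lemma vrel_mon: assumes "\<alpha> \<in> exps X" shows "vrel 1 (mon \<alpha>) (wt \<alpha>)"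
  unfolding vrel_def using assms exps_zero[of X] mon_nonzero[OF assms]
  by (intro conjI bexI[of _ \<alpha>] bexI[of _ "\<lambda>i. 0"]) (auto simp: mon_zero wt_zero assoc_refl)

lemma vrel_sc: assumes "vrel i a r" "c \<noteq> 0" shows "vrel i (sc c a) r"
proof -
  have "assoc (to_fract (sc c a) ^ i) (to_fract a ^ i)"
    using assoc_power assoc_sc assms vrel_nonzero by blast
  then show ?thesis using assms(1) assoc_trans unfolding vrel_def by blast
qed

text \<open>\<open>b\<close> satisfies an equation of degree at most \<open>\<rho>\<close> over the
  polynomials in the variables \<open>X\<close>: multiplying \<open>\<rho> + 1\<close> powers of
  \<open>b\<close> by the box monomials gives more elements than the dimension allows. Two terms of
  the resulting relation have equal value, so \<open>b ^ (i - j)\<close> has the value of a monomial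
  quotient.\<close>

lemma vrel_exists:
  assumes \<rho>: "\<And>M k. M < k \<Longrightarrow> dim (B (d * (k - 1) + M)) \<le> \<rho> * k ^ d"
    and b: "b \<in> B n" "b \<noteq> 0"
  shows "\<exists>i r. i \<le> \<rho> \<and> vrel i b r"
proof -
  \<comment> \<open>\<open>M\<close> is the common degree of the elements \<open>z i\<close>, and
    \<open>k\<close> is the least box size to which the assumed bound applies.\<close>
  define M where "M = n * \<rho>"
  define k where "k = M + 1"
  define z where "z i = b ^ i * y i0 ^ (n * (\<rho> - i))" for i
  have zB: "z i \<in> B M" if "i \<le> \<rho>" for i
  proof -
    have "z i \<in> B (i * n + n * (\<rho> - i) * 1)"
      unfolding z_def by (intro B_mult B_power b y_B1 i0_p)
    moreover have "i * n + n * (\<rho> - i) * 1 = M" unfolding M_def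
      using that by (simp add: mult.commute[of i] distrib_left[symmetric])
    ultimately show ?thesis by simp
  qed
  let ?P = "{..\<rho>} \<times> box k"
  have "\<exists>c. (\<Sum>q\<in>?P. sc (c q) (mon (snd q) * z (fst q))) = 0 \<and> (\<exists>q\<in>?P. c q \<noteq> 0)"
  proof (rule ccontr)
    assume no: "\<not> ?thesis"
    have "card ?P \<le> dim (B (d * (k - 1) + M))"
    proof (rule family_card_le_dim[OF _ _ order_refl])
      show "finite ?P" using finite_box by simp
      fix q assume "q \<in> ?P"
      then show "mon (snd q) * z (fst q) \<in> B (d * (k - 1) + M)"
        using B_mult[OF mon_B zB, of "fst q" "snd q"] unfolding box_def by auto
    qed (use no in blast)
    also have "\<dots> \<le> \<rho> * k ^ d" by (rule \<rho>) (simp add: k_def)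
    also have "\<dots> < (\<rho> + 1) * k ^ d" by (simp add: k_def)
    also have "\<dots> \<le> card ?P" using mult_le_mono2[OF card_box[of k], of "\<rho> + 1"] unfolding card_cartesian_product by (simp add: k_def)
    finally show False by simp
  qed
  then obtain c where c: "(\<Sum>q\<in>?P. sc (c q) (mon (snd q) * z (fst q))) = 0" and cnz: "\<exists>q\<in>?P. c q \<noteq> 0" by blast
  define a where "a i = (\<Sum>j\<in>box k. sc (c (i, j)) (mon j))" for i
  have bX: "box k \<subseteq> exps X" unfolding box_def by auto
  have alead: "\<exists>\<alpha>\<in>exps X. assoc (to_fract (a i)) (to_fract (mon \<alpha>))" if "\<exists>j\<in>box k. c (i, j) \<noteq> 0" for i
    unfolding a_def using assoc_leading_mon[OF finite_box bX, of "\<lambda>j. c (i, j)"] that bX by blast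
  have az: "a i = 0" if "\<not> (\<exists>j\<in>box k. c (i, j) \<noteq> 0)" for i
    unfolding a_def using that by (intro sum.neutral) auto
  have "(\<Sum>i\<le>\<rho>. a i * z i) = 0"
  proof -
    have "(\<Sum>i\<le>\<rho>. a i * z i) = (\<Sum>i\<le>\<rho>. \<Sum>j\<in>box k. sc (c (i, j)) (mon j * z i))"
      unfolding a_def sum_distrib_right by (simp add: sc_mult)
    also have "\<dots> = (\<Sum>q\<in>?P. sc (c q) (mon (snd q) * z (fst q)))"
      by (simp add: sum.cartesian_product case_prod_beta)
    finally show ?thesis using c by simp
  qed
  then have "to_fract (\<Sum>i\<le>\<rho>. a i * z i) = 0" by simp
  then have s0: "(\<Sum>i\<le>\<rho>. to_fract (a i * z i)) = 0" by (simp only: to_fract_sum)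
  have z0: "z i \<noteq> 0" for i unfolding z_def using b y_i0_nonzero by simp
  obtain i1 j1 where "i1 \<le> \<rho>" "j1 \<in> box k" "c (i1, j1) \<noteq> 0" using cnz by auto
  then have "a i1 \<noteq> 0" using alead[of i1] unfolding assoc_def by auto
  then have "\<exists>i\<in>{..\<rho>}. to_fract (a i * z i) \<noteq> 0" using z0 \<open>i1 \<le> \<rho>\<close>
    by (intro bexI[of _ i1]) (auto simp del: to_fract_mult)
  then obtain i j where ij: "i \<in> {..\<rho>}" "j \<in> {..\<rho>}" "i \<noteq> j" "assoc (to_fract (a i * z i)) (to_fract (a j * z j))"
    using zero_sum_assoc[OF finite_atMost s0] by blast
  have fin: "\<exists>i r. i \<le> \<rho> \<and> vrel i b r" if ij: "i \<le> \<rho>" "j < i" "assoc (to_fract (a i * z i)) (to_fract (a j * z j))" for i j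
  proof -
    have "a i \<noteq> 0" "a j \<noteq> 0" using ij(3) unfolding assoc_def by auto
    then obtain \<alpha> \<beta> where ab: "\<alpha> \<in> exps X" "\<beta> \<in> exps X"
      "assoc (to_fract (a i)) (to_fract (mon \<alpha>))" "assoc (to_fract (a j)) (to_fract (mon \<beta>))"
      using alead az by metis
    define \<gamma> where "\<gamma> t = (\<lambda>l. if l = i0 then t else (0::nat))" for t
    have \<gamma>: "mon (\<gamma> t) = y i0 ^ t" "\<gamma> t \<in> exps X" for t
      unfolding \<gamma>_def using single_exp(1)[OF i0_p, of t] single_exp(4)[OF i0_p i0_X, of t] by auto
    \<comment> \<open>The factor common to \<open>z i\<close> and \<open>z j\<close>; dividing by it
      isolates \<open>b ^ (i - j)\<close>.\<close>
    define Y where "Y = to_fract (b ^ j * y i0 ^ (n * (\<rho> - i)))"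
    have Y0: "Y \<noteq> 0" unfolding Y_def using b y_i0_nonzero by simp
    have zi: "to_fract (z i) = to_fract b ^ (i - j) * Y"
    proof -
      have "b ^ i = b ^ (i - j) * b ^ j" using ij(2) by (simp add: power_add[symmetric])
      then show ?thesis unfolding z_def Y_def by (simp add: to_fract_power mult.assoc)
    qed
    let ?\<mu> = "\<lambda>l. \<beta> l + \<gamma> (n * (\<rho> - j)) l" and ?\<nu> = "\<lambda>l. \<alpha> l + \<gamma> (n * (\<rho> - i)) l"
    have "assoc (to_fract (a i * z i)) (to_fract (mon \<beta>) * to_fract (z j))"
      using assoc_trans[OF ij(3)] assoc_mult[OF ab(4) assoc_refl[of "to_fract (z j)"]] z0 by simp
    then have "assoc (to_fract (a i * z i) / (to_fract (a i) * Y)) (to_fract (mon \<beta>) * to_fract (z j) / (to_fract (mon \<alpha>) * Y))"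
      using assoc_divide assoc_mult[OF ab(3) assoc_refl[OF Y0]] by blast
    moreover have "to_fract (a i * z i) / (to_fract (a i) * Y) = to_fract b ^ (i - j)"
      using Y0 \<open>a i \<noteq> 0\<close> by (simp add: zi)
    moreover have "to_fract (mon \<beta>) * to_fract (z j) / (to_fract (mon \<alpha>) * Y) = mfrac ?\<mu> ?\<nu>"
      unfolding z_def Y_def mon_add \<gamma>(1) using b y_i0_nonzero mon_nonzero[OF ab(1)] by (simp add: field_simps)
    ultimately have "assoc (to_fract b ^ (i - j)) (mfrac ?\<mu> ?\<nu>)" by simp
    moreover have "?\<mu> \<in> exps X" "?\<nu> \<in> exps X" using exps_add ab(1,2) \<gamma>(2) by auto
    ultimately have "vrel (i - j) b ((wt ?\<mu> - wt ?\<nu>) / real (i - j))"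
      unfolding vrel_def using ij(2) by (intro conjI bexI[of _ ?\<mu>] bexI[of _ ?\<nu>]) auto
    then show ?thesis using ij(1) by (intro exI[of _ "i - j"] exI) auto
  qed
  show ?thesis using fin[of i j] fin[of j i] ij assoc_sym by (metis atMost_iff nat_neq_iff)
qed

end

section \<open>Values of homogeneous elements\<close>

context graded_domain_val
begin

lemma vrel_v: assumes "b \<in> B n" "b \<noteq> 0" obtains i where "vrel i b (v b)"
proof -
  obtain \<rho> where \<rho>: "\<And>M k. M < k \<Longrightarrow> dim (B (d * (k - 1) + M)) \<le> \<rho> * k ^ d" using rank_bound by blast
  then obtain i r where "vrel i b r" using vrel_exists[OF \<rho> assms] by blast
  then show ?thesis using that v_eq by metis
qed

lemma v_le_iff:
  assumes "a \<in> B n" "a \<noteq> 0" "b \<in> B m" "b \<noteq> 0"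
  shows "v b \<le> v a \<longleftrightarrow> to_fract a / to_fract b \<in> V"
  using vrel_v[OF assms(1,2)] vrel_v[OF assms(3,4)] vrel_le vrel_ge by metis

lemma v_mult: assumes "a \<in> B n" "a \<noteq> 0" "b \<in> B m" "b \<noteq> 0" shows "v (a * b) = v a + v b"
  using vrel_v[OF assms(1,2)] vrel_v[OF assms(3,4)] vrel_mult v_eq by metis

lemma v_sc: assumes "a \<in> B n" "a \<noteq> 0" "c \<noteq> 0" shows "v (sc c a) = v a"
  using vrel_v[OF assms(1,2)] vrel_sc[OF _ assms(3)] v_eq by metis

lemma v_mon: "\<alpha> \<in> exps X \<Longrightarrow> v (mon \<alpha>) = wt \<alpha>"
  using v_eq vrel_mon by blast

lemma v_one: "v 1 = 0"
  using v_mon[OF exps_zero] by (simp add: mon_zero wt_zero)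

lemma v_power: assumes "a \<in> B n" "a \<noteq> 0" shows "v (a ^ k) = real k * v a"
proof (induction k)
  case 0 then show ?case by (simp add: v_one)
next
  case (Suc k)
  then show ?case using v_mult[OF assms B_power[OF assms(1), of k]] assms(2) by (simp add: algebra_simps)
qed

lemma v_add:
  assumes "a \<in> B n" "a \<noteq> 0" "b \<in> B n" "b \<noteq> 0" "a + b \<noteq> 0"
  shows "min (v a) (v b) \<le> v (a + b)"
proof -
  have *: "v b \<le> v (a + b)" if ab: "a \<in> B n" "a \<noteq> 0" "b \<in> B n" "b \<noteq> 0" "a + b \<noteq> 0" "v b \<le> v a" for a b
  proof -
    have "to_fract a / to_fract b + 1 \<in> V" using v_le_iff[OF ab(1-4)] ab(6) closed by auto
    moreover have "to_fract a / to_fract b + 1 = to_fract (a + b) / to_fract b" using ab(4) by (simp add: field_simps)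
    ultimately show ?thesis using v_le_iff[OF subspace_add[OF B_subspace ab(1,3)] ab(5,3,4)] by simp
  qed
  show ?thesis using *[of a b] *[of b a] assms by (cases "v b \<le> v a") (auto simp: add.commute)
qed

text \<open>The exponents provided by \<open>vrel_exists\<close> are at most \<open>\<rho>\<close>,
  so all of them divide \<open>E = fact \<rho>\<close>.\<close>

lemma v_denominator:
  obtains E :: nat where "E \<ge> 1"
    "\<And>b n. b \<in> B n \<Longrightarrow> b \<noteq> 0 \<Longrightarrow> \<exists>h :: nat \<Rightarrow> int. real E * v b = (\<Sum>i<p. real_of_int (h i) * \<omega> i)"
proof -
  obtain \<rho> where \<rho>: "\<And>M k. M < k \<Longrightarrow> dim (B (d * (k - 1) + M)) \<le> \<rho> * k ^ d" using rank_bound by blast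
  have "\<exists>h :: nat \<Rightarrow> int. real (fact \<rho>) * v b = (\<Sum>i<p. real_of_int (h i) * \<omega> i)" if b: "b \<in> B n" "b \<noteq> 0" for b n
  proof -
    obtain i r where i: "i \<le> \<rho>" "vrel i b r" using vrel_exists[OF \<rho> b] by blast
    then obtain \<alpha> \<beta> where ab: "i \<ge> 1" "r = (wt \<alpha> - wt \<beta>) / real i" unfolding vrel_def by blast
    obtain t where t: "(fact \<rho> :: nat) = i * t" using dvd_fact[OF ab(1) i(1)] by blast
    have "real (fact \<rho>) * v b = real t * (wt \<alpha> - wt \<beta>)"
      unfolding t v_eq[OF i(2)] ab(2) using ab(1) by simp
    also have "\<dots> = (\<Sum>l<p. real_of_int (int t * (int (\<alpha> l) - int (\<beta> l))) * \<omega> l)"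
      unfolding wt_def sum_subtractf[symmetric] sum_distrib_left by (rule sum.cong) (auto simp: algebra_simps)
    finally show ?thesis by (rule exI[of _ "\<lambda>l. int t * (int (\<alpha> l) - int (\<beta> l))"])
  qed
  then show ?thesis using that[of "fact \<rho>"] by (simp add: fact_ge_1)
qed

lemma sum_distinct_values:
  assumes "finite I" "I \<noteq> {}" "\<And>i. i \<in> I \<Longrightarrow> z i \<in> B n" "\<And>i. i \<in> I \<Longrightarrow> z i \<noteq> 0" "inj_on (\<lambda>i. v (z i)) I"
  shows "sum z I \<noteq> 0"
proof
  assume "sum z I = 0"
  then have "to_fract (sum z I) = 0" by simp
  then have s: "(\<Sum>i\<in>I. to_fract (z i)) = 0" by (simp only: to_fract_sum)
  have "\<exists>i\<in>I. to_fract (z i) \<noteq> 0" using assms(2,4) by auto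
  then obtain i j where ij: "i \<in> I" "j \<in> I" "i \<noteq> j" "assoc (to_fract (z i)) (to_fract (z j))"
    using zero_sum_assoc[OF assms(1) s] by blast
  then have "v (z i) = v (z j)"
    using v_le_iff[of "z i" n "z j" n] v_le_iff[of "z j" n "z i" n] assms(3,4) unfolding assoc_def by (meson antisym)
  then show False using assms(5) ij(1-3) by (auto dest: inj_onD)
qed

text \<open>A family all of whose nontrivial \<open>K\<close>-combinations have the same value \<open>\<gamma>\<close>: its image in the
  graded piece of the valuation filtration at \<open>\<gamma>\<close> is linearly independent.\<close>

definition residually_indep :: "nat \<Rightarrow> 'b set \<Rightarrow> real \<Rightarrow> bool" where
  "residually_indep n U \<gamma> \<longleftrightarrow> finite U \<and> U \<subseteq> B n \<and>
     (\<forall>c. (\<exists>u\<in>U. c u \<noteq> 0) \<longrightarrow> (\<Sum>u\<in>U. sc (c u) u) \<noteq> 0 \<and> v (\<Sum>u\<in>U. sc (c u) u) = \<gamma>)"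

text \<open>Group a vanishing combination of the products \<open>w i * u\<close> by
  \<open>i\<close>. Each nontrivial group has value \<open>v (w i) + \<gamma>\<close>; these values
  are pairwise distinct, so the groups cannot cancel.\<close>

lemma residually_indep_card_le:
  assumes U: "residually_indep n U \<gamma>" and I: "finite I"
    and w: "\<And>i. i \<in> I \<Longrightarrow> w i \<in> B m" "\<And>i. i \<in> I \<Longrightarrow> w i \<noteq> 0" and inj: "inj_on (\<lambda>i. v (w i)) I"
    and W: "W \<subseteq> B (m + n)" "\<And>i u. i \<in> I \<Longrightarrow> u \<in> U \<Longrightarrow> w i * u \<in> W"
  shows "card I * card U \<le> dim W"
proof -
  have fU: "finite U" and UB: "U \<subseteq> B n"
    and Uv: "\<And>c. (\<exists>u\<in>U. c u \<noteq> 0) \<Longrightarrow> (\<Sum>u\<in>U. sc (c u) u) \<noteq> 0 \<and> v (\<Sum>u\<in>U. sc (c u) u) = \<gamma>"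
    using U unfolding residually_indep_def by auto
  have "card (I \<times> U) \<le> dim W"
  proof (rule family_card_le_dim[where z = "\<lambda>q. w (fst q) * snd q", OF _ _ W(1)])
    show "finite (I \<times> U)" using I fU by simp
    show "w (fst q) * snd q \<in> W" if "q \<in> I \<times> U" for q using W(2) that by auto
    fix c assume c: "(\<Sum>q\<in>I \<times> U. sc (c q) (w (fst q) * snd q)) = 0"
    define s where "s i = (\<Sum>u\<in>U. sc (c (i, u)) u)" for i
    define I' where "I' = {i \<in> I. \<exists>u\<in>U. c (i, u) \<noteq> 0}"
    have sI': "s i \<noteq> 0 \<and> v (s i) = \<gamma>" if "i \<in> I'" for i
      using Uv[of "\<lambda>u. c (i, u)"] that unfolding s_def I'_def by auto
    have sB: "s i \<in> B n" for i unfolding s_def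
      using UB by (intro subspace_sum[OF B_subspace] subspace_scale[OF B_subspace]) auto
    have "(\<Sum>i\<in>I. w i * s i) = (\<Sum>i\<in>I. \<Sum>u\<in>U. sc (c (i, u)) (w i * u))"
      unfolding s_def sum_distrib_left by (simp add: sc_mult_right)
    also have "\<dots> = (\<Sum>q\<in>I \<times> U. sc (c q) (w (fst q) * snd q))"
      by (simp add: sum.cartesian_product case_prod_beta)
    finally have "(\<Sum>i\<in>I. w i * s i) = 0" using c by simp
    moreover have "(\<Sum>i\<in>I'. w i * s i) = (\<Sum>i\<in>I. w i * s i)"
      unfolding I'_def by (rule sum.mono_neutral_left) (use I in \<open>auto simp: s_def intro!: sum.neutral\<close>)
    ultimately have zero: "(\<Sum>i\<in>I'. w i * s i) = 0" by simp
    have "I' = {}"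
    proof (rule ccontr)
      assume ne: "I' \<noteq> {}"
      have I'I: "I' \<subseteq> I" unfolding I'_def by auto
      have "(\<Sum>i\<in>I'. w i * s i) \<noteq> 0"
      proof (rule sum_distinct_values[OF _ ne])
        show "finite I'" using I I'I finite_subset by blast
        show "w i * s i \<in> B (m + n)" if "i \<in> I'" for i using B_mult w(1) sB that I'I by blast
        show "w i * s i \<noteq> 0" if "i \<in> I'" for i using w(2) sI' that I'I by auto
        have "v (w i * s i) = v (w i) + \<gamma>" if "i \<in> I'" for i
          using v_mult[OF w sB[of i]] sI'[OF that] that I'I by auto
        then show "inj_on (\<lambda>i. v (w i * s i)) I'"
          using inj_on_subset[OF inj I'I] by (auto simp: inj_on_def)
      qed
      then show False using zero by simp
    qed
    then show "\<forall>q\<in>I \<times> U. c q = 0" unfolding I'_def by auto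
  qed
  then show ?thesis by (simp add: card_cartesian_product)
qed

text \<open>Box monomials have distinct values, hence about \<open>k ^ d\<close> translates of
  \<open>U\<close> are independent in degree \<open>d * (k - 1) + n\<close>, where the dimension is
  at most \<open>\<rho> * k ^ d\<close>.\<close>

lemma residually_indep_bound: obtains \<rho> where "\<And>n U \<gamma>. residually_indep n U \<gamma> \<Longrightarrow> card U \<le> \<rho>"
proof -
  obtain \<rho> where \<rho>: "\<And>M k. M < k \<Longrightarrow> dim (B (d * (k - 1) + M)) \<le> \<rho> * k ^ d" using rank_bound by blast
  have "card U \<le> \<rho>" if U: "residually_indep n U \<gamma>" for n U \<gamma>
  proof -
    define k where "k = n + 1"
    have bX: "box k \<subseteq> exps X" unfolding box_def by auto
    have "card (box k) * card U \<le> dim (B (d * (k - 1) + n))"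
    proof (rule residually_indep_card_le[OF U finite_box, where w = mon and m = "d * (k - 1)"])
      show "mon j \<in> B (d * (k - 1))" if "j \<in> box k" for j using mon_B[of j] that unfolding box_def by auto
      show "mon j \<noteq> 0" if "j \<in> box k" for j using mon_nonzero that bX by blast
      then show "mon j * u \<in> B (d * (k - 1) + n)" if "j \<in> box k" "u \<in> U" for j u
        using B_mult[OF mon_B[of j]] that U unfolding box_def residually_indep_def by auto
      show "inj_on (\<lambda>j. v (mon j)) (box k)"
      proof (rule inj_onI)
        fix j j' assume h: "j \<in> box k" "j' \<in> box k" "v (mon j) = v (mon j')"
        then have "wt j = wt j'" using v_mon bX by (metis subsetD)
        then show "j = j'" using wt_inj exps_mono[OF X_le] bX h(1,2) by blast
      qed
    qed simp
    also have "\<dots> \<le> \<rho> * k ^ d" by (rule \<rho>) (simp add: k_def)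
    finally have "card (box k) * card U \<le> \<rho> * k ^ d" .
    moreover have "k ^ d * card U \<le> card (box k) * card U" using card_box[of k] by (simp add: k_def)
    ultimately have "card U * k ^ d \<le> \<rho> * k ^ d" unfolding mult.commute[of "card U"] by (rule order_trans[rotated])
    then show ?thesis by (simp add: k_def)
  qed
  then show ?thesis using that by blast
qed

text \<open>With this family the preceding count says that elements of distinct values are linearly
  independent, so a subspace has at most as many values as its dimension.\<close>

lemma residually_indep_one: "residually_indep 0 {1} 0"
proof -
  have "v (sc c 1) = 0" if "c \<noteq> 0" for c using v_sc[OF B_one _ that] v_one by simp
  then show ?thesis unfolding residually_indep_def using B_one by auto
qed

lemma finite_values:
  assumes V': "V' \<subseteq> B n"
  shows "finite (v ` (V' - {0}))"
proof -
  have "card G \<le> dim V'" if G: "G \<subseteq> v ` (V' - {0})" "finite G" for G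
  proof -
    have "\<forall>s\<in>G. \<exists>b. b \<in> V' - {0} \<and> v b = s" using G(1) by auto
    from bchoice[OF this] obtain b where b: "\<And>s. s \<in> G \<Longrightarrow> b s \<in> V' - {0} \<and> v (b s) = s" by blast
    have "card G * card {1::'b} \<le> dim V'"
    proof (rule residually_indep_card_le[OF residually_indep_one G(2), where w = b and m = n])
      show "inj_on (\<lambda>s. v (b s)) G" using b by (auto simp: inj_on_def)
    qed (use b V' in auto)
    then show ?thesis by simp
  qed
  then show ?thesis using finite_if_finite_subsets_card_bdd by blast
qed

text \<open>Peel off the least value \<open>s0\<close>: the elements of larger value form a subspace
  \<open>V''\<close> by the ultrametric inequality. Vectors completing a basis of \<open>V''\<close>
  are residually independent at \<open>s0\<close>, so each value costs at most \<open>r\<close>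
  dimensions.\<close>

lemma dim_le_card_values:
  assumes r: "\<And>n U \<gamma>. residually_indep n U \<gamma> \<Longrightarrow> card U \<le> r"
    and V': "subspace V'" "V' \<subseteq> B n"
  shows "dim V' \<le> r * card (v ` (V' - {0}))"
  using V'
proof (induction "card (v ` (V' - {0}))" arbitrary: V' rule: less_induct)
  case less
  let ?S = "v ` (V' - {0})"
  have fS: "finite ?S" using finite_values less.prems by blast
  show ?case
  proof (cases "?S = {}")
    case True
    then have "V' \<subseteq> span {}" by auto
    from dim_le_card[OF this] show ?thesis by simp
  next
    case False
    define s0 where "s0 = Min ?S"
    have s0: "s0 \<in> ?S" "\<And>s. s \<in> ?S \<Longrightarrow> s0 \<le> s" unfolding s0_def using fS False by auto
    define V'' where "V'' = {a \<in> V'. a = 0 \<or> s0 < v a}"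
    have V''V': "V'' \<subseteq> V'" unfolding V''_def by auto
    have sub: "subspace V''"
    proof (rule subspaceI)
      show "0 \<in> V''" unfolding V''_def using subspace_0[OF less.prems(1)] by simp
      fix a b assume ab: "a \<in> V''" "b \<in> V''"
      show "a + b \<in> V''"
      proof (cases "a = 0 \<or> b = 0 \<or> a + b = 0")
        case True then show ?thesis using ab subspace_0[OF less.prems(1)] unfolding V''_def by auto
      next
        case False
        then have "min (v a) (v b) \<le> v (a + b)" using v_add[of a n b] ab V''V' less.prems(2) by blast
        then show ?thesis using ab False subspace_add[OF less.prems(1)] unfolding V''_def by auto
      qed
    next
      fix c a assume a: "a \<in> V''"
      then show "sc c a \<in> V''"
        using v_sc[of a n c] less.prems(2) subspace_scale[OF less.prems(1), of a c] unfolding V''_def by (cases "c = 0 \<or> a = 0") auto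
    qed
    have V''B: "V'' \<subseteq> B n" using V''V' less.prems by blast
    have ss: "v ` (V'' - {0}) \<subseteq> ?S - {s0}" unfolding V''_def by auto
    then have lt: "card (v ` (V'' - {0})) < card ?S"
      using s0(1) fS by (meson card_Diff1_less card_mono finite_Diff le_less_trans)
    have IH: "dim V'' \<le> r * card (v ` (V'' - {0}))" by (rule less.hyps[OF lt sub V''B])
    obtain b'' where b'': "b'' \<subseteq> V''" "independent b''" "V'' \<subseteq> span b''" "card b'' = dim V''"
      using basis_exists by blast
    obtain b where b: "b'' \<subseteq> b" "b \<subseteq> V'" "independent b" "V' \<subseteq> span b"
      using maximal_independent_subset_extend[of b'' V'] b'' V''V' by blast
    have fb: "finite b" using card_independent_le_dim(1)[OF less.prems(2) b(2,3)] .
    then have fb'': "finite b''" using b(1) finite_subset by blast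
    define A where "A = b - b''"
    have "residually_indep n A s0" unfolding residually_indep_def
    proof (intro conjI allI impI)
      show "finite A" unfolding A_def using fb by simp
      show "A \<subseteq> B n" unfolding A_def using b(2) less.prems(2) by blast
      fix c :: "'b \<Rightarrow> 'k" assume c: "\<exists>u\<in>A. c u \<noteq> 0"
      let ?x = "\<Sum>u\<in>A. sc (c u) u"
      have xV': "?x \<in> V'" unfolding A_def
        using b(2) by (intro subspace_sum[OF less.prems(1)] subspace_scale[OF less.prems(1)]) auto
      have xV'': "?x \<notin> V''"
      proof
        assume "?x \<in> V''"
        then have "?x \<in> span b''" using b''(3) by blast
        then obtain e where e: "?x = (\<Sum>u\<in>b''. sc (e u) u)" unfolding span_finite[OF fb''] by auto
        define g where "g u = (if u \<in> b'' then - e u else c u)" for u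
        have "b = A \<union> b''" "A \<inter> b'' = {}" unfolding A_def using b(1) by auto
        then have "(\<Sum>u\<in>b. sc (g u) u) = (\<Sum>u\<in>A. sc (g u) u) + (\<Sum>u\<in>b''. sc (g u) u)"
          using sum.union_disjoint[of A b'' "\<lambda>u. sc (g u) u"] fb fb'' unfolding A_def by simp
        also have "(\<Sum>u\<in>A. sc (g u) u) = ?x" by (rule sum.cong) (auto simp: g_def A_def)
        also have "(\<Sum>u\<in>b''. sc (g u) u) = - (\<Sum>u\<in>b''. sc (e u) u)" by (simp add: g_def sum_negf)
        finally have g0: "(\<Sum>u\<in>b. sc (g u) u) = 0" using e by simp
        obtain u where u: "u \<in> A" "c u \<noteq> 0" using c by blast
        then have "g u = 0" using independentD[OF b(3) fb order_refl g0] unfolding A_def by blast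
        then show False using u unfolding g_def A_def by auto
      qed
      then show nz: "?x \<noteq> 0" using subspace_0[OF sub] by auto
      have "v ?x \<in> ?S" using xV' nz by blast
      then show "v ?x = s0" using s0(2) xV' xV'' unfolding V''_def by force
    qed
    then have "card A \<le> r" by (rule r)
    have "dim V' = card b" using basis_card_eq_dim[OF b(2,4,3)] by simp
    also have "\<dots> = card A + card b''" unfolding A_def using b(1) fb fb'' card_Diff_subset[of b'' b] card_mono[OF fb b(1)] by simp
    also have "\<dots> \<le> r + r * card (v ` (V'' - {0}))" using \<open>card A \<le> r\<close> IH b''(4) by simp
    also have "\<dots> = r * Suc (card (v ` (V'' - {0})))" by simp
    also have "\<dots> \<le> r * card ?S" using lt by (intro mult_le_mono2) simp
    finally show ?thesis .
  qed
qed

lemma max_residually_indep_exists: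
  obtains m U \<gamma> where "residually_indep m U \<gamma>" "\<And>n U' \<gamma>'. residually_indep n U' \<gamma>' \<Longrightarrow> card U' \<le> card U"
proof -
  obtain \<rho> where \<rho>: "\<And>n U \<gamma>. residually_indep n U \<gamma> \<Longrightarrow> card U \<le> \<rho>" using residually_indep_bound by blast
  let ?S = "{card U | n U \<gamma>. residually_indep n U \<gamma>}"
  have "finite ?S" by (rule finite_subset[of _ "{..\<rho>}"]) (use \<rho> in auto)
  moreover have "?S \<noteq> {}" using residually_indep_one by blast
  ultimately have M: "Max ?S \<in> ?S" "\<And>r. r \<in> ?S \<Longrightarrow> r \<le> Max ?S"
    by (rule Max_in) (rule Max_ge[OF \<open>finite ?S\<close>])
  then obtain m U \<gamma> where U: "residually_indep m U \<gamma>" "Max ?S = card U" by blast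
  have "card U' \<le> card U" if "residually_indep n U' \<gamma>'" for n U' \<gamma>'
    using M(2)[of "card U'"] that unfolding U(2) by blast
  then show ?thesis by (rule that[OF U(1)])
qed

text \<open>The family constructed in \<open>W\<close> has
  \<open>card S * card (box k) * card U\<close> members, while
  \<open>dim V' \<le> card U * card S\<close> because \<open>U\<close> is of maximal size; the
  factor \<open>card U\<close> cancels exactly. \<open>m0\<close> is the degree of \<open>U\<close>,
  and \<open>E\<close> clears the denominators of all values.\<close>

theorem power_dim_le:
  obtains E m0 :: nat where "E \<ge> 1"
    "\<And>n k q l V' W. k = 1 + E * l \<Longrightarrow> d * (k - 1) + m0 \<le> q \<Longrightarrow> subspace V' \<Longrightarrow> V' \<subseteq> B n \<Longrightarrow> W \<subseteq> B (k * n + q) \<Longrightarrow>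
      (\<And>b g. b \<in> V' \<Longrightarrow> g \<in> B q \<Longrightarrow> b ^ k * g \<in> W) \<Longrightarrow> k ^ d * dim V' \<le> dim W"
proof -
  obtain E where E: "E \<ge> 1"
    "\<And>b n. b \<in> B n \<Longrightarrow> b \<noteq> 0 \<Longrightarrow> \<exists>h :: nat \<Rightarrow> int. real E * v b = (\<Sum>i<p. real_of_int (h i) * \<omega> i)"
    using v_denominator by blast
  obtain m0 U \<gamma> where U: "residually_indep m0 U \<gamma>" "\<And>n U' \<gamma>'. residually_indep n U' \<gamma>' \<Longrightarrow> card U' \<le> card U"
    using max_residually_indep_exists by blast
  have "k ^ d * dim V' \<le> dim W"
    if k: "k = 1 + E * l" and q: "d * (k - 1) + m0 \<le> q" and V': "subspace V'" "V' \<subseteq> B n"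
      and W: "W \<subseteq> B (k * n + q)" "\<And>b g. b \<in> V' \<Longrightarrow> g \<in> B q \<Longrightarrow> b ^ k * g \<in> W"
    for n k q l V' W
  proof -
    define S where "S = v ` (V' - {0})"
    have fS: "finite S" unfolding S_def using finite_values V' by blast
    have "\<forall>s\<in>S. \<exists>b. b \<in> V' - {0} \<and> v b = s" unfolding S_def by auto
    from bchoice[OF this] obtain b where b: "\<And>s. s \<in> S \<Longrightarrow> b s \<in> V' \<and> b s \<noteq> 0 \<and> v (b s) = s" by blast
    \<comment> \<open>The degrees left between the box times \<open>U\<close> and \<open>q\<close>
      are filled by a power of \<open>y i0\<close>, which shifts all values equally.\<close>
    define gap where "gap = q - (d * (k - 1) + m0)"
    define g where "g = y i0 ^ gap"
    have g: "g \<in> B gap" "g \<noteq> 0" unfolding g_def using B_power[OF y_B1[OF i0_p], of gap] y_i0_nonzero by auto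
    define w where "w x = b (fst x) ^ k * (mon (snd x) * g)" for x
    have mg: "mon j * g \<in> B (d * (k - 1) + gap)" "mon j * g \<noteq> 0" "v (mon j * g) = wt j + v g" if "j \<in> box k" for j
      using B_mult[OF mon_B[of j] g(1)] that mon_nonzero[of j] g v_mult[OF mon_B[of j] _ g] v_mon[of j] unfolding box_def by auto
    have bk: "b s ^ k \<in> B (k * n)" "b s ^ k \<noteq> 0" "v (b s ^ k) = real k * s" if "s \<in> S" for s
      using b[OF that] B_power[of "b s" n k] v_power[of "b s" n k] V'(2) by auto
    have vw: "v (w x) = real k * fst x + (wt (snd x) + v g)" if "x \<in> S \<times> box k" for x
      unfolding w_def using v_mult[OF bk(1,2) mg(1,2)] bk(3) mg(3) that by auto
    have "card (S \<times> box k) * card U \<le> dim W"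
    proof (rule residually_indep_card_le[OF U(1), where w = w and m = "k * n + (d * (k - 1) + gap)"])
      show "finite (S \<times> box k)" using fS finite_box by simp
      show "w x \<in> B (k * n + (d * (k - 1) + gap))" "w x \<noteq> 0" if "x \<in> S \<times> box k" for x
        unfolding w_def using B_mult[OF bk(1) mg(1)] bk(2) mg(2) that by auto
      have q': "q = d * (k - 1) + gap + m0" unfolding gap_def using q by simp
      then show "W \<subseteq> B (k * n + (d * (k - 1) + gap) + m0)" using W(1) by (simp add: add.assoc)
      fix x u assume xu: "x \<in> S \<times> box k" "u \<in> U"
      then have "u \<in> B m0" using U(1) unfolding residually_indep_def by auto
      then have "mon (snd x) * g * u \<in> B q" unfolding q' using B_mult[OF mg(1)] xu(1) by auto
      then have "b (fst x) ^ k * (mon (snd x) * g * u) \<in> W" using W(2) b xu(1) by auto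
      then show "w x * u \<in> W" unfolding w_def by (simp add: mult.assoc)
    next
      show "inj_on (\<lambda>x. v (w x)) (S \<times> box k)"
      proof (rule inj_onI)
        fix x x' assume h: "x \<in> S \<times> box k" "x' \<in> S \<times> box k" "v (w x) = v (w x')"
        obtain s j s' j' where x: "x = (s, j)" "x' = (s', j')" by fastforce
        have sj: "s \<in> S" "s' \<in> S" "j \<in> box k" "j' \<in> box k" using h x by auto
        have eq: "real k * s + wt j = real k * s' + wt j'" using h(3) vw[OF h(1)] vw[OF h(2)] x by simp
        obtain e where e: "real E * s = (\<Sum>i<p. real_of_int (e i) * \<omega> i)" using E(2)[of "b s" n] b[OF sj(1)] V'(2) by auto
        obtain e' where e': "real E * s' = (\<Sum>i<p. real_of_int (e' i) * \<omega> i)" using E(2)[of "b s'" n] b[OF sj(2)] V'(2) by auto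
        \<comment> \<open>Multiplied by \<open>E\<close>, the coincidence of values becomes an
          integral relation among the weights, so it holds coordinate by coordinate.\<close>
        have "(\<Sum>i<p. real_of_int (int k * (e i - e' i) + int E * (int (j i) - int (j' i))) * \<omega> i)
            = real k * (real E * s) - real k * (real E * s') + real E * (wt j - wt j')"
          unfolding e e' wt_def sum_distrib_left sum_subtractf[symmetric] sum.distrib[symmetric]
          by (rule sum.cong) (auto simp: algebra_simps)
        also have "\<dots> = real E * ((real k * s + wt j) - (real k * s' + wt j'))" by (simp add: algebra_simps)
        also have "\<dots> = 0" using eq by simp
        finally have z0: "(\<Sum>i<p. real_of_int (int k * (e i - e' i) + int E * (int (j i) - int (j' i))) * \<omega> i) = 0" .
        have z: "int k * (e i - e' i) + int E * (int (j i) - int (j' i)) = 0" if "i < p" for i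
          by (rule \<omega>_indep[OF z0 that])
        have ji: "j i = j' i" if i: "i \<in> X - {i0}" for i
        proof -
          have ip: "i < p" using i X_le by auto
          have "int E * (int (j i) - int (j' i)) = int k * - (e i - e' i)" using z[OF ip] by (simp add: algebra_simps)
          then have "int k dvd int E * (int (j i) - int (j' i))" by (rule dvdI)
          \<comment> \<open>This is where \<open>k = 1 + E * l\<close> enters: \<open>k\<close>
            divides \<open>E * (j i - j' i)\<close>, hence the difference itself, and box
            coordinates congruent modulo \<open>k\<close> are equal.\<close>
          moreover have "coprime (int k) (int E)"
          proof (rule coprimeI)
            fix c assume "c dvd int k" "c dvd int E"
            then have "c dvd int k - int E * int l" by (intro dvd_diff) auto
            then show "is_unit c" using k by simp
          qed
          ultimately have "int k dvd int (j i) - int (j' i)" using coprime_dvd_mult_right_iff by blast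
          moreover have "j i < k" "j' i < k" using sj(3,4) i unfolding box_def by blast+
          then have "\<bar>int (j i) - int (j' i)\<bar> < int k" by linarith
          ultimately have "int (j i) - int (j' i) = 0" using zdvd_imp_le[of "int k" "\<bar>int (j i) - int (j' i)\<bar>"] by fastforce
          then show ?thesis by simp
        qed
        have jX: "j \<in> exps X" "j' \<in> exps X" "tdeg j = tdeg j'" using sj(3,4) unfolding box_def by auto
        have "(\<Sum>i\<in>X - {i0}. j i) = (\<Sum>i\<in>X - {i0}. j' i)" by (rule sum.cong[OF refl ji])
        then have "j i0 = j' i0" using tdeg_exps_X[OF jX(1)] tdeg_exps_X[OF jX(2)] jX(3) by simp
        then have "j i = j' i" for i using ji[of i] jX unfolding exps_def by (cases "i = i0"; cases "i \<in> X") auto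
        then have "j = j'" by (rule ext)
        moreover have "k > 0" using k by simp
        then have "s = s'" using eq \<open>j = j'\<close> by simp
        ultimately show "x = x'" using x \<open>s = s'\<close> by simp
      qed
    qed
    then have le: "card S * card (box k) * card U \<le> dim W" by (simp add: card_cartesian_product)
    have "k ^ d * dim V' \<le> k ^ d * (card U * card S)"
      using dim_le_card_values[OF U(2) V'] unfolding S_def by simp
    also have "\<dots> \<le> card (box k) * (card U * card S)"
      using card_box[of k] k by (intro mult_le_mono1) simp
    also have "\<dots> \<le> dim W" using le by (simp add: mult.commute mult.left_commute)
    finally show ?thesis .
  qed
  then show ?thesis using that[OF E(1), of m0] by blast
qed

end

text \<open>Exports the growth estimates free of \<open>X\<close> and \<open>V\<close>; the
  treatment of the filtrations sees nothing of the valuation.\<close>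

theorem (in graded_domain) dimension_growth:
  obtains d C E m0 :: nat where "E \<ge> 1" "\<And>m. dim (B m) \<le> C * (m + 1) ^ d"
    "\<And>n k q l V' W. k = 1 + E * l \<Longrightarrow> d * (k - 1) + m0 \<le> q \<Longrightarrow> subspace V' \<Longrightarrow> V' \<subseteq> B n \<Longrightarrow> W \<subseteq> B (k * n + q) \<Longrightarrow>
      (\<And>b g. b \<in> V' \<Longrightarrow> g \<in> B q \<Longrightarrow> b ^ k * g \<in> W) \<Longrightarrow> k ^ d * dim V' \<le> dim W"
proof -
  obtain X where X: "X \<subseteq> {..<p}" "alg_indep X" "X \<noteq> {}" "\<And>Y. Y \<subseteq> {..<p} \<Longrightarrow> alg_indep Y \<Longrightarrow> card Y \<le> card X"
    using max_alg_indep_exists by blast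
  interpret graded_domain_tr sc B y p \<omega> X
    by (rule graded_domain_tr.intro[OF graded_domain_axioms], unfold_locales) (use X in auto)
  obtain V :: "'b fract set" where V: "valuation_ring V"
    "\<And>\<alpha> \<beta>. \<alpha> \<in> exps X \<Longrightarrow> \<beta> \<in> exps X \<Longrightarrow> wt \<beta> \<le> wt \<alpha> \<Longrightarrow> mfrac \<alpha> \<beta> \<in> V"
    "\<And>\<alpha> \<beta>. \<alpha> \<in> exps X \<Longrightarrow> \<beta> \<in> exps X \<Longrightarrow> wt \<alpha> < wt \<beta> \<Longrightarrow> mfrac \<alpha> \<beta> \<notin> V"
    "\<And>c. to_fract (sc c 1) \<in> V"
    using monomial_valuation_ring_exists by blast
  interpret valuation_ring V by (rule V(1))
  interpret graded_domain_val sc B y p \<omega> X V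
    by unfold_locales (use V in auto)
  obtain C where C: "\<And>m. dim (B m) \<le> C * (m + 1) ^ d" using dim_B_bound by blast
  show ?thesis
  proof (rule power_dim_le)
    fix E m0 :: nat
    assume E: "E \<ge> 1" and
      main: "\<And>n k q l V' W. k = 1 + E * l \<Longrightarrow> d * (k - 1) + m0 \<le> q \<Longrightarrow> subspace V' \<Longrightarrow> V' \<subseteq> B n \<Longrightarrow>
        W \<subseteq> B (k * n + q) \<Longrightarrow> (\<And>b g. b \<in> V' \<Longrightarrow> g \<in> B q \<Longrightarrow> b ^ k * g \<in> W) \<Longrightarrow> k ^ d * dim V' \<le> dim W"
    show ?thesis by (rule that[OF E C main])
  qed
qed

section \<open>Existence of the generator data\<close>

text \<open>Allows an index bound valid on all of \<open>B n\<close> and of \<open>B m\<close> to be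
  transferred to all of \<open>B (n + m)\<close>, by checking products only.\<close>

lemma (in graded_domain) B_add_span: "B (n + m) \<subseteq> span {a * b | a b. a \<in> B n \<and> b \<in> B m}"
proof -
  have split: "\<exists>\<beta> \<gamma>. \<alpha> = (\<lambda>i. \<beta> i + \<gamma> i) \<and> tdeg \<beta> = n" if "tdeg \<alpha> = n + m" for \<alpha> n m
    using that
  proof (induction n arbitrary: m)
    case 0
    then show ?case by (intro exI[of _ "\<lambda>i. 0"] exI[of _ \<alpha>]) (auto simp: tdeg_def)
  next
    case (Suc n)
    then obtain \<beta> \<gamma> where h: "\<alpha> = (\<lambda>i. \<beta> i + \<gamma> i)" "tdeg \<beta> = n" using Suc.IH[of "Suc m"] by auto
    then have "tdeg \<gamma> > 0" using Suc.prems tdeg_add[of \<beta> \<gamma>] by simp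
    then obtain i where i: "i < p" "\<gamma> i > 0" unfolding tdeg_def by (metis bot_nat_0.not_eq_extremum lessThan_iff sum.neutral)
    define \<delta> where "\<delta> = (\<lambda>j. if j = i then 1 else (0::nat))"
    have "\<alpha> = (\<lambda>j. (\<beta> j + \<delta> j) + (\<gamma> j - \<delta> j))" using h(1) i(2) by (auto simp: \<delta>_def)
    moreover have "tdeg (\<lambda>j. \<beta> j + \<delta> j) = Suc n"
      using h(2) single_exp(2)[OF i(1), of 1] unfolding tdeg_add \<delta>_def by simp
    ultimately show ?case by (intro exI[of _ "\<lambda>j. \<beta> j + \<delta> j"] exI[of _ "\<lambda>j. \<gamma> j - \<delta> j"]) auto
  qed
  have "mon \<alpha> \<in> span {a * b | a b. a \<in> B n \<and> b \<in> B m}" if \<alpha>: "tdeg \<alpha> = n + m" for \<alpha>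
  proof -
    obtain \<beta> \<gamma> where h: "\<alpha> = (\<lambda>i. \<beta> i + \<gamma> i)" "tdeg \<beta> = n" using split[OF \<alpha>] by blast
    then have "tdeg \<gamma> = m" using \<alpha> tdeg_add[of \<beta> \<gamma>] by simp
    then have "mon \<beta> \<in> B n" "mon \<gamma> \<in> B m" using mon_B h(2) by metis+
    then have "mon \<beta> * mon \<gamma> \<in> span {a * b | a b. a \<in> B n \<and> b \<in> B m}" by (intro span_base) blast
    then show ?thesis unfolding h(1) mon_add .
  qed
  then have "span (mon ` {\<alpha> \<in> exps {..<p}. tdeg \<alpha> = n + m}) \<subseteq> span {a * b | a b. a \<in> B n \<and> b \<in> B m}"
    by (intro span_minimal) auto
  then show ?thesis using B_span_mon by blast
qed

lemma (in graded_domain) B_nonzero: obtains b where "b \<in> B n" "b \<noteq> 0"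
proof -
  obtain i where i: "i < p" "y i \<noteq> 0" using y_nonzero by blast
  show ?thesis using that[of "y i ^ n"] B_power[OF y_B1[OF i(1)], of n] i(2) by simp
qed

text \<open>Inductively, the next weight is chosen outside the countable set of rational
  combinations of the previous ones.\<close>

lemma rationally_independent_reals_exist:
  "\<exists>\<omega> :: nat \<Rightarrow> real. \<forall>h :: nat \<Rightarrow> int. (\<Sum>i<p. real_of_int (h i) * \<omega> i) = 0 \<longrightarrow> (\<forall>i<p. h i = 0)"
proof (induction p)
  case 0 then show ?case by simp
next
  case (Suc p)
  then obtain \<omega> :: "nat \<Rightarrow> real" where \<omega>: "\<And>h :: nat \<Rightarrow> int. (\<Sum>i<p. real_of_int (h i) * \<omega> i) = 0 \<Longrightarrow> \<forall>i<p. h i = 0"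
    by blast
  \<comment> \<open>Integer vectors are encoded as lists, a countable type; the values contributed
    by too short lists or by \<open>q = 0\<close> keep \<open>D\<close> countable.\<close>
  define D where "D = (\<lambda>(xs :: int list, q :: int). (\<Sum>i<p. real_of_int (xs ! i) * \<omega> i) / real_of_int q) ` UNIV"
  have "countable D" unfolding D_def by simp
  then have "D \<noteq> UNIV" using uncountable_UNIV_real by auto
  then obtain x where x: "x \<notin> D" by blast
  have "\<forall>i<Suc p. h i = 0" if h: "(\<Sum>i<Suc p. real_of_int (h i) * (if i = p then x else \<omega> i)) = 0" for h :: "nat \<Rightarrow> int"
  proof -
    have s: "(\<Sum>i<p. real_of_int (h i) * \<omega> i) + real_of_int (h p) * x = 0" using h by simp
    have "h p = 0"
    proof (rule ccontr)
      assume hp: "h p \<noteq> 0"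
      have "x = (\<Sum>i<p. real_of_int (- h i) * \<omega> i) / real_of_int (h p)"
        using s hp by (simp add: sum_negf field_simps)
      also have "(\<Sum>i<p. real_of_int (- h i) * \<omega> i) = (\<Sum>i<p. real_of_int (map (\<lambda>i. - h i) [0..<p] ! i) * \<omega> i)"
        by (rule sum.cong) auto
      finally have "x \<in> D" unfolding D_def by (intro image_eqI[of _ _ "(map (\<lambda>i. - h i) [0..<p], h p)"]) auto
      then show False using x by simp
    qed
    then show ?thesis using s \<omega>[of h] by (auto simp: less_Suc_eq)
  qed
  then show ?case by (intro exI[of _ "\<lambda>i. if i = p then x else \<omega> i"]) blast
qed

lemma graded_algebra_over_of_graded_algebra:
  assumes "graded_algebra sc B"
  shows "graded_algebra_over sc B"
proof -
  have ka: "k_algebra sc" and sub: "\<And>n. module.subspace sc (B n)"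
    and mu: "\<And>n m a b. a \<in> B n \<Longrightarrow> b \<in> B m \<Longrightarrow> a * b \<in> B (n + m)" and one: "1 \<in> B 0"
    and ex1: "\<And>x. \<exists>!c. finite {n. c n \<noteq> 0} \<and> (\<forall>n. c n \<in> B n) \<and> x = (\<Sum>n\<in>{n. c n \<noteq> 0}. c n)"
    using assms unfolding graded_algebra_def by auto
  interpret vector_space sc using ka unfolding k_algebra_def by blast
  interpret algebra_over sc using ka unfolding k_algebra_def by unfold_locales blast
  show ?thesis
  proof unfold_locales
    fix T :: "nat set" and g n
    assume T: "finite T" "\<And>n. n \<in> T \<Longrightarrow> g n \<in> B n" "(\<Sum>n\<in>T. g n) = 0" "n \<in> T"
    define c where "c n = (if n \<in> T then g n else 0)" for n
    have "{n. c n \<noteq> 0} \<subseteq> T" unfolding c_def by auto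
    then have "finite {n. c n \<noteq> 0}" "(\<Sum>n\<in>{n. c n \<noteq> 0}. c n) = (\<Sum>n\<in>T. c n)"
      using T(1) finite_subset by (blast, intro sum.mono_neutral_left) auto
    moreover have "(\<Sum>n\<in>T. c n) = 0" using T(3) unfolding c_def by simp
    moreover have "\<forall>n. c n \<in> B n" unfolding c_def using T(2) subspace_0[OF sub] by auto
    moreover define Q where "Q c \<longleftrightarrow> finite {n. c n \<noteq> 0} \<and> (\<forall>n. c n \<in> B n) \<and> 0 = (\<Sum>n\<in>{n. c n \<noteq> 0}. c n)" for c
    ultimately have "Q c" by simp
    moreover have "Q (\<lambda>_. 0)" unfolding Q_def using subspace_0[OF sub] by simp
    moreover have "\<exists>!c. Q c" unfolding Q_def by (rule ex1)
    ultimately have "c = (\<lambda>_. 0)" by blast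
    then show "g n = 0" using fun_cong[of c "\<lambda>_. 0" n] T(4) unfolding c_def by simp
  qed (use sub mu one in auto)
qed

section \<open>Finite generation in degree one\<close>

context graded_algebra_over
begin

lemma span_Union_components:
  assumes "t \<in> span (\<Union>n\<in>N. B n)"
  shows "\<exists>T c. finite T \<and> T \<subseteq> N \<and> (\<forall>n. c n \<in> B n) \<and> (\<forall>n. n \<notin> T \<longrightarrow> c n = 0) \<and> t = (\<Sum>n\<in>T. c n)"
  using assms
proof (induction rule: span_induct_alt)
  case base
  then show ?case using subspace_0[OF B_subspace] by (intro exI[of _ "{}"] exI[of _ "\<lambda>_. 0"]) auto
next
  case (step a x z)
  obtain m where m: "m \<in> N" "x \<in> B m" using step(1) by blast
  obtain T c where h: "finite T" "T \<subseteq> N" "\<And>n. c n \<in> B n" "\<And>n. n \<notin> T \<Longrightarrow> c n = 0" "z = (\<Sum>n\<in>T. c n)"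
    using step(2) by blast
  define c' where "c' n = c n + (if n = m then sc a x else 0)" for n
  have "(\<Sum>n\<in>insert m T. c' n) = (\<Sum>n\<in>insert m T. c n) + (\<Sum>n\<in>insert m T. if n = m then sc a x else 0)"
    unfolding c'_def by (rule sum.distrib)
  also have "(\<Sum>n\<in>insert m T. c n) = z" unfolding h(5) using h(1,4) by (intro sum.mono_neutral_right) auto
  also have "(\<Sum>n\<in>insert m T. if n = m then sc a x else 0) = sc a x" using h(1) by simp
  finally have "sc a x + z = (\<Sum>n\<in>insert m T. c' n)" by (simp add: add.commute)
  moreover have "c' n \<in> B n" for n unfolding c'_def
    using h(3) m(2) subspace_add[OF B_subspace] subspace_scale[OF B_subspace] by simp
  ultimately show ?case using h m
    by (intro exI[of _ "insert m T"] exI[of _ c']) (auto simp: c'_def)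
qed

text \<open>Elements whose degree zero part is a scalar and whose degree one part lies in
  \<open>span G\<close>. When \<open>G\<close> is contained in \<open>B 1\<close> these form a
  subalgebra, as shown by \<open>alg_gen_low_part\<close>.\<close>

definition low_part :: "'b set \<Rightarrow> 'b set" where
  "low_part G = {sc a 1 + g + t | a g t. g \<in> span G \<and> t \<in> span (\<Union>n\<in>{2..}. B n)}"

text \<open>In a product the degree one part is \<open>sc a g' + sc a' g\<close>, while
  \<open>g * g'\<close> already has degree two; thus multiplication never leads out of
  \<open>span G\<close> in degree one.\<close>

lemma alg_gen_low_part:
  assumes G: "G \<subseteq> B 1" and Z: "Z \<subseteq> low_part G"
  shows "alg_gen sc Z \<subseteq> low_part G"
proof
  let ?T = "span (\<Union>n\<in>{2..}. B n)"
  have I: "sc a 1 + g + t \<in> low_part G" if "g \<in> span G" "t \<in> ?T" for a g t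
    unfolding low_part_def using that by blast
  have gB: "g \<in> B 1" if "g \<in> span G" for g
    using span_minimal[OF G B_subspace] that by blast
  have BT: "b * t \<in> ?T" if bt: "b \<in> B n" "t \<in> ?T" for b n t
  proof (rule span_mult[of b "{b}", OF _ bt(2)])
    show "b \<in> span {b}" by (simp add: span_base)
    fix x z assume "x \<in> {b}" "z \<in> (\<Union>n\<in>{2..}. B n)"
    then obtain m where "m \<ge> 2" "x * z \<in> B (n + m)" using B_mult bt(1) by auto
    then show "x * z \<in> ?T" by (intro span_base) auto
  qed
  have TT: "s * t \<in> ?T" if "s \<in> ?T" "t \<in> ?T" for s t
  proof (rule span_mult[OF that])
    fix x z assume xz: "x \<in> (\<Union>n\<in>{2..}. B n)" "z \<in> (\<Union>n\<in>{2..}. B n)"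
    then obtain n where "x \<in> B n" by blast
    then show "x * z \<in> ?T" using span_base[OF xz(2)] by (rule BT)
  qed
  fix x assume "x \<in> alg_gen sc Z"
  then show "x \<in> low_part G"
  proof induction
    case (gen x) then show ?case using Z by blast
  next
    case one show ?case using I[of 0 0 1] by (simp add: span_zero)
  next
    case (add x z)
    then obtain a g t a' g' t' where h: "x = sc a 1 + g + t" "z = sc a' 1 + g' + t'" "g \<in> span G" "g' \<in> span G" "t \<in> ?T" "t' \<in> ?T"
      unfolding low_part_def by blast
    have "x + z = sc (a + a') 1 + (g + g') + (t + t')" unfolding h by (simp add: scale_left_distrib algebra_simps)
    then show ?case using I[OF span_add[OF h(3,4)] span_add[OF h(5,6)]] by simp
  next
    case (mult x z)
    then obtain a g t a' g' t' where h: "x = sc a 1 + g + t" "z = sc a' 1 + g' + t'" "g \<in> span G" "g' \<in> span G" "t \<in> ?T" "t' \<in> ?T"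
      unfolding low_part_def by blast
    have s1: "sc c 1 * b = sc c b" for c b using sc_mult[of c 1 b] by simp
    have s2: "b * sc c 1 = sc c b" for c b using s1 by (simp add: mult.commute)
    have "x * z = sc (a * a') 1 + (sc a g' + sc a' g) + (sc a t' + sc a' t + g * g' + g * t' + g' * t + t * t')"
      unfolding h distrib_left distrib_right s1 s2 by (simp add: algebra_simps)
    moreover have "g * g' \<in> ?T"
    proof -
      have "g * g' \<in> B 2" using B_mult[OF gB[OF h(3)] gB[OF h(4)]] by (simp add: numeral_2_eq_2)
      then show ?thesis by (intro span_base) auto
    qed
    then have "sc a t' + sc a' t + g * g' + g * t' + g' * t + t * t' \<in> ?T"
      using BT[OF gB[OF h(3)] h(6)] BT[OF gB[OF h(4)] h(5)] TT[OF h(5,6)] h(5,6)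
      by (intro span_add span_scale)
    moreover have "sc a g' + sc a' g \<in> span G" using h(3,4) by (intro span_add span_scale)
    ultimately show ?case using I by simp
  next
    case (scale x c)
    then obtain a g t where h: "x = sc a 1 + g + t" "g \<in> span G" "t \<in> ?T" unfolding low_part_def by blast
    have "sc c x = sc (c * a) 1 + sc c g + sc c t" unfolding h by (simp add: scale_right_distrib)
    then show ?case using I[OF span_scale[OF h(2)] span_scale[OF h(3)]] by simp
  qed
qed

text \<open>Taking \<open>G = B 1\<close> shows that every element has a scalar part in degree zero.
  The degree one parts of a finite generating set \<open>H\<close> then form a finite
  \<open>G\<close> with \<open>low_part G = UNIV\<close>, and comparing degree one components gives
  \<open>B 1 \<subseteq> span G\<close>.\<close>

lemma B1_finite_span:
  assumes "finite_type sc" "alg_gen sc (B 1) = UNIV"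
  obtains G where "finite G" "G \<subseteq> B 1" "B 1 \<subseteq> span G"
proof -
  let ?T = "span (\<Union>n\<in>{2..}. B n)"
  have "B 1 \<subseteq> low_part (B 1)"
  proof
    fix b assume "b \<in> B 1"
    then have "sc 0 1 + b + 0 \<in> low_part (B 1)" unfolding low_part_def using span_base span_zero by blast
    then show "b \<in> low_part (B 1)" by simp
  qed
  then have U: "low_part (B 1) = UNIV" using alg_gen_low_part[of "B 1" "B 1"] assms(2) by auto
  obtain H where H: "finite H" "alg_gen sc H = UNIV" using assms(1) unfolding finite_type_def by blast
  have "\<forall>x\<in>H. \<exists>g. g \<in> B 1 \<and> (\<exists>a. \<exists>t\<in>?T. x = sc a 1 + g + t)"
  proof
    fix x assume "x \<in> H"
    have "x \<in> low_part (B 1)" using U by simp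
    then show "\<exists>g. g \<in> B 1 \<and> (\<exists>a. \<exists>t\<in>?T. x = sc a 1 + g + t)"
      unfolding low_part_def using span_minimal[OF order_refl B_subspace[of 1]] by blast
  qed
  from bchoice[OF this] obtain f where f: "\<And>x. x \<in> H \<Longrightarrow> f x \<in> B 1 \<and> (\<exists>a. \<exists>t\<in>?T. x = sc a 1 + f x + t)" by blast
  let ?G = "f ` H"
  have GB: "?G \<subseteq> B 1" using f by blast
  have "H \<subseteq> low_part ?G"
  proof
    fix x assume x: "x \<in> H"
    then obtain a t where "t \<in> ?T" "x = sc a 1 + f x + t" using f by blast
    moreover have "f x \<in> span ?G" using x by (intro span_base) auto
    ultimately show "x \<in> low_part ?G" unfolding low_part_def by blast
  qed
  then have U': "low_part ?G = UNIV" using alg_gen_low_part[OF GB] H(2) by auto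
  have "B 1 \<subseteq> span ?G"
  proof
    fix b assume b: "b \<in> B 1"
    obtain a g t where h: "b = sc a 1 + g + t" "g \<in> span ?G" "t \<in> ?T" using U' unfolding low_part_def by blast
    have gB: "g \<in> B 1" using span_minimal[OF GB B_subspace] h(2) by blast
    obtain T c where t: "finite T" "T \<subseteq> {2..}" "\<forall>n. c n \<in> B n" "t = (\<Sum>n\<in>T. c n)"
      using span_Union_components[OF h(3)] by blast
    \<comment> \<open>The homogeneous components of \<open>sc a 1 + (g - b) + t = 0\<close>;
      directness forces the one of degree one, \<open>g - b\<close>, to vanish.\<close>
    define e where "e n = (if n = 0 then sc a 1 else if n = 1 then g - b else c n)" for n
    have "(\<Sum>n\<in>insert 0 (insert 1 T). e n) = sc a 1 + (g - b) + (\<Sum>n\<in>T. e n)"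
    proof -
      have "0 \<notin> insert 1 T" "1 \<notin> T" using t(2) by auto
      then show ?thesis using t(1) by (simp add: e_def add.assoc)
    qed
    also have "(\<Sum>n\<in>T. e n) = t" unfolding t(4) by (rule sum.cong) (use t(2) in \<open>auto simp: e_def\<close>)
    finally have "(\<Sum>n\<in>insert 0 (insert 1 T). e n) = 0" using h(1) by simp
    then have "e 1 = 0"
    proof (rule B_direct[rotated 2])
      show "e n \<in> B n" for n unfolding e_def
        using t(3) subspace_scale[OF B_subspace B_one] subspace_diff[OF B_subspace gB b] by auto
    qed (use t(1) in auto)
    then show "b \<in> span ?G" using h(2) by (simp add: e_def)
  qed
  then show ?thesis using that[of ?G] GB H(1) by blast
qed

lemma B_span_monomials:
  fixes y :: "nat \<Rightarrow> 'b" and p :: nat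
  assumes gen: "alg_gen sc (B 1) = UNIV" and y: "\<And>i. i < p \<Longrightarrow> y i \<in> B 1" and B1: "B 1 \<subseteq> span (y ` {..<p})"
  shows "B n \<subseteq> span ((\<lambda>\<alpha>. \<Prod>i<p. y i ^ \<alpha> i) ` {\<alpha> \<in> exps {..<p}. (\<Sum>i<p. \<alpha> i) = n})"
proof
  let ?mon = "\<lambda>\<alpha>. \<Prod>i<p. y i ^ \<alpha> i" and ?deg = "\<lambda>\<alpha>. \<Sum>i<p. \<alpha> i"
  let ?Q = "span (?mon ` exps {..<p})"
  have monB: "?mon \<alpha> \<in> B (?deg \<alpha>)" for \<alpha> :: "nat \<Rightarrow> nat" by (rule monomial_B[OF y])
  have yQ: "y i \<in> ?Q" if "i < p" for i
  proof -
    have "?mon (\<lambda>j. if j = i then 1 else 0) = (\<Prod>j<p. if j = i then y i else 1)" by (intro prod.cong) auto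
    also have "\<dots> = y i" using that by simp
    finally have "y i = ?mon (\<lambda>j. if j = i then 1 else 0)" by simp
    moreover have "(\<lambda>j. if j = i then 1 else 0) \<in> exps {..<p}" using that by (auto simp: exps_def)
    ultimately show ?thesis by (intro span_base) (rule image_eqI)
  qed
  have "x \<in> ?Q" if "x \<in> alg_gen sc (B 1)" for x
    using that
  proof induction
    case (gen x)
    have "span (y ` {..<p}) \<subseteq> ?Q" by (rule span_minimal) (use yQ in auto)
    then show ?case using gen B1 by blast
  next
    case one
    have "?mon (\<lambda>_. 0) \<in> ?Q" using exps_zero by (intro span_base imageI)
    then show ?case by simp
  next
    case (mult x z)
    show ?case
    proof (rule span_mult[OF mult.IH])
      fix a b assume "a \<in> ?mon ` exps {..<p}" "b \<in> ?mon ` exps {..<p}"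
      then obtain \<alpha> \<beta> where h: "\<alpha> \<in> exps {..<p}" "\<beta> \<in> exps {..<p}" "a = ?mon \<alpha>" "b = ?mon \<beta>" by blast
      have "a * b = ?mon (\<lambda>i. \<alpha> i + \<beta> i)" unfolding h by (simp add: power_add prod.distrib)
      then show "a * b \<in> ?Q" using exps_add[OF h(1,2)] by (intro span_base) (rule image_eqI)
    qed
  qed (auto intro: span_add span_scale)
  then have all: "x \<in> ?Q" for x using gen by blast
  fix b assume b: "b \<in> B n"
  obtain t r where t: "finite t" "t \<subseteq> ?mon ` exps {..<p}" "b = (\<Sum>a\<in>t. sc (r a) a)"
    using all[of b] unfolding span_explicit by blast
  obtain U where U: "U \<subseteq> exps {..<p}" "inj_on ?mon U" "t = ?mon ` U" using t(2) unfolding subset_image_inj by blast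
  have fU: "finite U" using t(1) U finite_imageD by blast
  define z where "z \<alpha> = sc (r (?mon \<alpha>)) (?mon \<alpha>)" for \<alpha>
  have bz: "b = sum z U" unfolding t(3) U(3) z_def by (simp add: sum.reindex[OF U(2)])
  define g where "g m = (\<Sum>\<alpha>\<in>{\<alpha> \<in> U. ?deg \<alpha> = m}. z \<alpha>)" for m
  have gB: "g m \<in> B m" for m unfolding g_def z_def
    using monB by (intro subspace_sum[OF B_subspace] subspace_scale[OF B_subspace]) auto
  have gs: "g n \<in> span (?mon ` {\<alpha> \<in> exps {..<p}. ?deg \<alpha> = n})"
    unfolding g_def z_def using U(1) by (intro span_sum span_scale span_base imageI) auto
  \<comment> \<open>\<open>n\<close> is inserted because possibly no monomial occurring in
    \<open>b\<close> has degree \<open>n\<close>.\<close>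
  define T where "T = insert n (?deg ` U)"
  have "b = (\<Sum>m\<in>?deg ` U. g m)" unfolding bz g_def by (rule sum.image_gen[OF fU])
  also have "\<dots> = (\<Sum>m\<in>T. g m)" unfolding T_def
    by (rule sum.mono_neutral_left) (use fU in \<open>auto simp: g_def intro!: sum.neutral\<close>)
  finally have bT: "b = (\<Sum>m\<in>T. g m)" .
  have fT: "finite T" "n \<in> T" unfolding T_def using fU by auto
  have "(\<Sum>m\<in>T. g m - (if m = n then b else 0)) = 0"
    using fT bT by (simp add: sum_subtractf)
  then have "g n - (if n = n then b else 0) = 0"
  proof (rule B_direct[rotated 2])
    show "g m - (if m = n then b else 0) \<in> B m" for m
      using gB b subspace_diff[OF B_subspace] by auto
  qed (use fT in auto)
  then show "b \<in> span (?mon ` {\<alpha> \<in> exps {..<p}. ?deg \<alpha> = n})" using gs by simp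
qed

end

text \<open>If all generators vanish, every element is a scalar multiple of \<open>1\<close>; the
  ring is a field, its only prime ideal is \<open>{0}\<close>, and no chain of positive length
  exists.\<close>

lemma krull_dim_pos_imp_B1_nonzero:
  fixes sc :: "'k::field \<Rightarrow> 'b::idom \<Rightarrow> 'b"
  assumes "algebra_over sc" "alg_gen sc S = UNIV" "krull_dim TYPE('b) > 0"
  shows "\<exists>x\<in>S. x \<noteq> 0"
proof (rule ccontr)
  interpret algebra_over sc by (rule assms(1))
  assume no: "\<not> ?thesis"
  have s1: "sc c 1 * b = sc c b" for c b using sc_mult[of c 1 b] by simp
  have "\<exists>c. x = sc c 1" if "x \<in> alg_gen sc S" for x
    using that
  proof induction
    case (gen x) then show ?case using no by (intro exI[of _ 0]) auto
  next
    case one show ?case by (intro exI[of _ 1]) simp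
  next
    case (add x z)
    then obtain a b where "x = sc a 1" "z = sc b 1" by blast
    then show ?case by (intro exI[of _ "a + b"]) (simp add: scale_left_distrib)
  next
    case (mult x z)
    then obtain a b where "x = sc a 1" "z = sc b 1" by blast
    then show ?case by (intro exI[of _ "a * b"]) (simp add: s1)
  next
    case (scale x c)
    then obtain a where "x = sc a 1" by blast
    then show ?case by (intro exI[of _ "c * a"]) simp
  qed
  then have all: "\<exists>c. x = sc c 1" for x using assms(2) by blast
  have pz: "P = {0}" if P: "prime_ideal P" for P :: "'b set"
  proof -
    have id: "0 \<in> P" "\<And>r x. x \<in> P \<Longrightarrow> r * x \<in> P" "P \<noteq> UNIV"
      using P unfolding prime_ideal_def ring_ideal_def by auto
    have "x = 0" if "x \<in> P" for x
    proof (rule ccontr)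
      assume "x \<noteq> 0"
      obtain c where c: "x = sc c 1" using all by blast
      then have "c \<noteq> 0" using \<open>x \<noteq> 0\<close> by auto
      then have "sc (inverse c) 1 * x = 1" unfolding c by (simp add: s1)
      then have "1 \<in> P" using id(2)[OF that, of "sc (inverse c) 1"] by simp
      then have "r \<in> P" for r using id(2)[of 1 r] by simp
      then show False using id(3) by blast
    qed
    then show ?thesis using id(1) by blast
  qed
  have "krull_dim TYPE('b) \<le> 0" unfolding krull_dim_def
  proof (rule Sup_least)
    fix e assume "e \<in> {enat n | n. \<exists>P :: nat \<Rightarrow> 'b set. (\<forall>i\<le>n. prime_ideal (P i)) \<and> (\<forall>i<n. P i \<subset> P (Suc i))}"
    then obtain n and P :: "nat \<Rightarrow> 'b set" where n: "e = enat n" "\<forall>i\<le>n. prime_ideal (P i)" "\<forall>i<n. P i \<subset> P (Suc i)" by blast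
    have "n = 0"
    proof (rule ccontr)
      assume "n \<noteq> 0"
      then have "P 0 \<subset> P (Suc 0)" "P 0 = {0}" "P (Suc 0) = {0}" using n pz by auto
      then show False by blast
    qed
    then show "e \<le> 0" using n(1) by (simp add: zero_enat_def)
  qed
  then show False using assms(3) by simp
qed

theorem graded_domain_exists:
  fixes sc :: "'k::field \<Rightarrow> 'b::idom \<Rightarrow> 'b"
  assumes "graded_algebra sc B" "finite_type sc" "alg_gen sc (B 1) = UNIV" "krull_dim TYPE('b) > 0"
  obtains y p \<omega> where "graded_domain sc B y p \<omega>"
proof -
  interpret graded_algebra_over sc B by (rule graded_algebra_over_of_graded_algebra[OF assms(1)])
  obtain G where G: "finite G" "G \<subseteq> B 1" "B 1 \<subseteq> span G" using B1_finite_span[OF assms(2,3)] by blast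
  define p where "p = card G"
  obtain y where y: "bij_betw y {0..<p} G" using ex_bij_betw_nat_finite[OF G(1)] unfolding p_def by blast
  then have yG: "y ` {..<p} = G" by (simp add: bij_betw_def lessThan_atLeast0)
  obtain \<omega> :: "nat \<Rightarrow> real" where \<omega>: "\<And>h :: nat \<Rightarrow> int. (\<Sum>i<p. real_of_int (h i) * \<omega> i) = 0 \<Longrightarrow> \<forall>i<p. h i = 0"
    using rationally_independent_reals_exist[of p] by blast
  have yB: "y i \<in> B 1" if "i < p" for i using yG G(2) that by blast
  have "\<exists>i<p. y i \<noteq> 0"
  proof (rule ccontr)
    assume "\<not> ?thesis"
    then have "G \<subseteq> {0}" using yG by auto
    then have "B 1 \<subseteq> {0}" using G(3) span_mono[of G "{0}"] by auto
    then show False using krull_dim_pos_imp_B1_nonzero[OF algebra_over_axioms assms(3,4)] by blast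
  qed
  then have "graded_domain sc B y p \<omega>"
    using yB B_span_monomials[OF assms(3), of p y] G(3) yG \<omega> by unfold_locales blast+
  then show ?thesis by (rule that)
qed

section \<open>Almost superadditive functions\<close>

text \<open>The term for \<open>i\<close> controls, up to a factor 2, the loss per factor of
  splitting an exponent between \<open>2 ^ i\<close> and \<open>2 ^ (i + 1)\<close> into halves, for
  an element of degree \<open>n\<close>.\<close>

definition dyadic_err :: "(nat \<Rightarrow> real) \<Rightarrow> nat \<Rightarrow> real" where
  "dyadic_err f n = (\<Sum>i. f (2 ^ i * n) / 2 ^ i)"

lemma dyadic_err_bounds:
  fixes f :: "nat \<Rightarrow> real"
  assumes f0: "\<And>n. f n \<ge> 0" and mono: "mono f" and sum: "summable (\<lambda>i. f (2 ^ i) / 2 ^ i)" and n: "n \<le> 2 ^ \<beta>"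
  shows "summable (\<lambda>i. f (2 ^ i * n) / 2 ^ i)"
    and "dyadic_err f n \<le> 2 ^ \<beta> * (\<Sum>i. f (2 ^ (i + \<beta>)) / 2 ^ (i + \<beta>))"
proof -
  have s: "summable (\<lambda>i. f (2 ^ (i + \<beta>)) / 2 ^ (i + \<beta>))"
    using sum by (subst summable_iff_shift)
  then have s': "summable (\<lambda>i. 2 ^ \<beta> * (f (2 ^ (i + \<beta>)) / 2 ^ (i + \<beta>)))" by (rule summable_mult)
  have le: "f (2 ^ i * n) / 2 ^ i \<le> 2 ^ \<beta> * (f (2 ^ (i + \<beta>)) / 2 ^ (i + \<beta>))" for i
  proof -
    have "f (2 ^ i * n) \<le> f (2 ^ (i + \<beta>))" using n by (intro monoD[OF mono]) (simp add: power_add)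
    then show ?thesis by (simp add: power_add field_simps)
  qed
  show 1: "summable (\<lambda>i. f (2 ^ i * n) / 2 ^ i)"
    by (rule summable_comparison_test'[OF s', of 0]) (use le f0 in auto)
  show "dyadic_err f n \<le> 2 ^ \<beta> * (\<Sum>i. f (2 ^ (i + \<beta>)) / 2 ^ (i + \<beta>))"
    unfolding dyadic_err_def suminf_mult[OF s, symmetric] by (rule suminf_le[OF le 1 s'])
qed

text \<open>With \<open>2 ^ \<beta>\<close> the least power of two that is at least
  \<open>n\<close>, one has \<open>2 ^ \<beta> \<le> 2 * n\<close>, and the error is at most
  \<open>2 * n\<close> times a tail of the convergent series.\<close>

lemma dyadic_err_small:
  fixes f :: "nat \<Rightarrow> real"
  assumes f: "\<And>n. f n \<ge> 0" "mono f" "summable (\<lambda>i. f (2 ^ i) / 2 ^ i)" and e: "e > 0"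
  obtains N where "\<And>n. n \<ge> N \<Longrightarrow> dyadic_err f n \<le> e * real n"
proof -
  have "(\<lambda>\<beta>. \<Sum>i. f (2 ^ (i + \<beta>)) / 2 ^ (i + \<beta>)) \<longlonglongrightarrow> 0"
    by (rule suminf_exist_split2[OF f(3)])
  then obtain \<beta>0 where \<beta>0: "\<And>\<beta>. \<beta> \<ge> \<beta>0 \<Longrightarrow> (\<Sum>i. f (2 ^ (i + \<beta>)) / 2 ^ (i + \<beta>)) \<le> e / 2"
    using e by (fastforce dest: order_tendstoD(2)[of _ _ _ "e / 2"] simp: eventually_sequentially)
  have "dyadic_err f n \<le> e * real n" if n: "n \<ge> 2 ^ \<beta>0" for n
  proof -
    have n1: "n \<ge> 1" using n by (metis one_le_power one_le_numeral order_trans)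
    define \<beta> where "\<beta> = (LEAST b. n \<le> 2 ^ b)"
    have nb: "n \<le> 2 ^ \<beta>" unfolding \<beta>_def by (rule LeastI[of _ n]) (simp add: less_imp_le)
    have b2: "(2::nat) ^ \<beta> \<le> 2 * n"
    proof (cases \<beta>)
      case 0 then show ?thesis using n1 by simp
    next
      case (Suc b)
      then have "\<not> n \<le> 2 ^ b" using not_less_Least[of b "\<lambda>b. n \<le> 2 ^ b"] unfolding \<beta>_def by simp
      then show ?thesis unfolding Suc by simp
    qed
    have "(2::nat) ^ \<beta>0 \<le> 2 ^ \<beta>" by (rule order_trans[OF n nb])
    then have "\<beta>0 \<le> \<beta>" by simp
    have "dyadic_err f n \<le> 2 ^ \<beta> * (\<Sum>i. f (2 ^ (i + \<beta>)) / 2 ^ (i + \<beta>))" by (rule dyadic_err_bounds(2)[OF f nb])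
    also have "\<dots> \<le> 2 ^ \<beta> * (e / 2)" using \<beta>0[OF \<open>\<beta>0 \<le> \<beta>\<close>] by (intro mult_left_mono) auto
    also have "\<dots> \<le> (2 * real n) * (e / 2)"
    proof (rule mult_right_mono)
      have "real (2 ^ \<beta>) \<le> real (2 * n)" using b2 by (rule of_nat_mono)
      then show "2 ^ \<beta> \<le> 2 * real n" by simp
    qed (use e in simp)
    finally show ?thesis by (simp add: mult.commute)
  qed
  then show ?thesis by (rule that)
qed

lemma dyadic_err_ge:
  fixes f :: "nat \<Rightarrow> real"
  assumes f: "\<And>n. f n \<ge> 0" "mono f" "summable (\<lambda>i. f (2 ^ i) / 2 ^ i)"
  shows "(\<Sum>i<a. f (2 ^ i * n) / 2 ^ i) \<le> dyadic_err f n" "f n \<le> dyadic_err f n"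
proof -
  have "n \<le> 2 ^ n" by (simp add: less_imp_le)
  then have s: "summable (\<lambda>i. f (2 ^ i * n) / 2 ^ i)" by (rule dyadic_err_bounds(1)[OF f])
  show 1: "(\<Sum>i<a. f (2 ^ i * n) / 2 ^ i) \<le> dyadic_err f n" for a
    unfolding dyadic_err_def by (rule sum_le_suminf[OF s]) (use f(1) in auto)
  show "f n \<le> dyadic_err f n" using 1[of 1] by simp
qed

text \<open>Halve \<open>k\<close> repeatedly. If \<open>2 ^ a < k \<le> 2 ^ (a + 1)\<close>, both
  halves are at most \<open>2 ^ a\<close>, and by monotonicity each of the two error terms is at
  most \<open>f (2 ^ a * n) \<le> k * f (2 ^ a * n) / 2 ^ a\<close>.\<close>

lemma almost_superadditive_ge:
  fixes f :: "nat \<Rightarrow> real" and h :: "nat \<Rightarrow> real"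
  assumes f: "\<And>n. f n \<ge> 0" "mono f" "summable (\<lambda>i. f (2 ^ i) / 2 ^ i)"
    and h: "\<And>k l. k \<ge> 1 \<Longrightarrow> l \<ge> 1 \<Longrightarrow> h k + h l - f (k * n) - f (l * n) \<le> h (k + l)"
    and k: "k \<ge> 1"
  shows "real k * h 1 - 2 * real k * dyadic_err f n \<le> h k"
proof -
  have *: "real k * h 1 - 2 * real k * (\<Sum>i<a. f (2 ^ i * n) / 2 ^ i) \<le> h k" if "1 \<le> k" "k \<le> 2 ^ a" for a k
    using that
  proof (induction a arbitrary: k)
    case 0 then have "k = 1" by simp
    then show ?case by simp
  next
    case (Suc a)
    let ?G = "\<Sum>i<a. f (2 ^ i * n) / 2 ^ i" and ?t = "f (2 ^ a * n) / 2 ^ a"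
    have t0: "?t \<ge> 0" using f(1) by simp
    show ?case
    proof (cases "k \<le> 2 ^ a")
      case True
      then have "real k * h 1 - 2 * real k * ?G \<le> h k" using Suc by blast
      moreover have "0 \<le> 2 * real k * ?t" by (rule mult_nonneg_nonneg[OF _ t0]) simp
      ultimately show ?thesis by (simp add: algebra_simps)
    next
      case False
      define k1 where "k1 = k div 2"
      define k2 where "k2 = k - k1"
      have "(1::nat) \<le> 2 ^ a" by simp
      then have kk: "k = k1 + k2" "1 \<le> k1" "1 \<le> k2" "k1 \<le> 2 ^ a" "k2 \<le> 2 ^ a"
        using False Suc.prems unfolding k1_def k2_def by auto
      have "f (k1 * n) \<le> f (2 ^ a * n)" "f (k2 * n) \<le> f (2 ^ a * n)"
        using kk by (auto intro!: monoD[OF f(2)] mult_le_mono1)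
      moreover have "f (2 ^ a * n) \<le> real k * ?t"
      proof -
        have "real (2 ^ a) \<le> real k" using False by simp
        then have "real (2 ^ a) * ?t \<le> real k * ?t" using t0 by (rule mult_right_mono)
        then show ?thesis by simp
      qed
      moreover have "real k1 * h 1 - 2 * real k1 * ?G \<le> h k1" "real k2 * h 1 - 2 * real k2 * ?G \<le> h k2"
        using Suc.IH kk by auto
      moreover have "h k1 + h k2 - f (k1 * n) - f (k2 * n) \<le> h k" using h[OF kk(2,3)] kk(1) by simp
      moreover have "real k * h 1 - 2 * real k * (?G + ?t)
          = (real k1 * h 1 - 2 * real k1 * ?G) + (real k2 * h 1 - 2 * real k2 * ?G) - 2 * (real k * ?t)"
        unfolding kk(1) by (simp add: algebra_simps)
      ultimately show ?thesis unfolding sum.lessThan_Suc by linarith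
    qed
  qed
  have "k \<le> 2 ^ k" by (simp add: less_imp_le)
  from *[OF k this] have "real k * h 1 - 2 * real k * (\<Sum>i<k. f (2 ^ i * n) / 2 ^ i) \<le> h k" .
  moreover have "2 * real k * (\<Sum>i<k. f (2 ^ i * n) / 2 ^ i) \<le> 2 * real k * dyadic_err f n"
    using dyadic_err_ge(1)[OF f] by (intro mult_left_mono) auto
  ultimately show ?thesis by linarith
qed

lemma subseq_limits_le:
  fixes u w :: "nat \<Rightarrow> real"
  assumes cmp: "\<And>e. e > 0 \<Longrightarrow> \<exists>n0. \<forall>n\<ge>n0. \<exists>M. \<forall>m\<ge>M. u n - e \<le> w m"
    and s: "strict_mono s" "strict_mono s'" and lim: "(u \<circ> s) \<longlonglongrightarrow> L" "(w \<circ> s') \<longlonglongrightarrow> L'"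
  shows "L \<le> L'"
proof (rule field_le_epsilon)
  fix e :: real assume "e > 0"
  then obtain n0 where n0: "\<And>n. n \<ge> n0 \<Longrightarrow> \<exists>M. \<forall>m\<ge>M. u n - e / 2 \<le> w m" using cmp[of "e / 2"] by auto
  have "eventually (\<lambda>j. L - e / 2 < (u \<circ> s) j) sequentially" using order_tendstoD(1)[OF lim(1)] \<open>e > 0\<close> by simp
  then obtain j0 where j0: "\<And>j. j \<ge> j0 \<Longrightarrow> L - e / 2 < u (s j)" by (auto simp: eventually_sequentially)
  define n where "n = s (max j0 n0)"
  have "n \<ge> n0" unfolding n_def using seq_suble[OF s(1), of "max j0 n0"] by linarith
  then obtain M where M: "\<And>m. m \<ge> M \<Longrightarrow> u n - e / 2 \<le> w m" using n0 by blast
  have "L - e / 2 < u n" unfolding n_def by (rule j0) simp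
  then have "L - e \<le> w (s' j)" if "j \<ge> M" for j
    using M[of "s' j"] seq_suble[OF s(2), of j] that by linarith
  then have "\<exists>N. \<forall>j\<ge>N. L - e \<le> (w \<circ> s') j" by auto
  then have "L - e \<le> L'" by (rule LIMSEQ_le_const[OF lim(2)])
  then show "L \<le> L' + e" by simp
qed

text \<open>The comparison says that the upper limit does not exceed the lower limit; boundedness
  supplies a finite subsequential limit.\<close>

lemma convergent_of_self_compare:
  fixes u :: "nat \<Rightarrow> real"
  assumes cmp: "\<And>e. e > 0 \<Longrightarrow> \<exists>n0. \<forall>n\<ge>n0. \<exists>M. \<forall>m\<ge>M. u n - e \<le> u m"
    and bd: "\<And>n. n \<ge> N \<Longrightarrow> \<bar>u n\<bar> \<le> K"
  obtains L where "u \<longlonglongrightarrow> L"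
proof -
  have "bounded (range (\<lambda>n. u (n + N)))" using bd by (intro boundedI[of _ K]) auto
  then obtain L r where r: "strict_mono r" "((\<lambda>n. u (n + N)) \<circ> r) \<longlonglongrightarrow> L"
    using bounded_imp_convergent_subsequence by blast
  define s where "s n = r n + N" for n
  have s: "strict_mono s" "(u \<circ> s) \<longlonglongrightarrow> L"
    using r unfolding s_def by (auto simp: strict_mono_def o_def)
  have "u \<longlonglongrightarrow> L"
  proof (rule LIMSEQ_I)
    fix e :: real assume e: "e > 0"
    obtain n0 where n0: "\<And>n. n \<ge> n0 \<Longrightarrow> \<exists>M. \<forall>m\<ge>M. u n - e / 4 \<le> u m" using cmp[of "e / 4"] e by auto
    have ev: "eventually (\<lambda>j. \<bar>u (s j) - L\<bar> < e / 4) sequentially"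
      using tendstoD[OF s(2), of "e / 4"] e by (simp add: dist_real_def)
    then obtain j0 where j0: "\<And>j. j \<ge> j0 \<Longrightarrow> \<bar>u (s j) - L\<bar> < e / 4" by (auto simp: eventually_sequentially)
    define n where "n = s (max j0 n0)"
    have "n \<ge> n0" unfolding n_def using seq_suble[OF s(1), of "max j0 n0"] by linarith
    then obtain M where M: "\<And>m. m \<ge> M \<Longrightarrow> u n - e / 4 \<le> u m" using n0 by blast
    have un: "\<bar>u n - L\<bar> < e / 4" unfolding n_def by (rule j0) simp
    have up: "u m < L + e" if mn: "m \<ge> n0" for m
    proof -
      obtain M' where M': "\<And>k. k \<ge> M' \<Longrightarrow> u m - e / 4 \<le> u k" using n0[OF mn] by blast
      have "u m - e / 4 \<le> u (s (max j0 M'))"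
        using M'[of "s (max j0 M')"] seq_suble[OF s(1), of "max j0 M'"] by linarith
      moreover have "\<bar>u (s (max j0 M')) - L\<bar> < e / 4" by (rule j0) simp
      ultimately show ?thesis using e by linarith
    qed
    have "norm (u m - L) < e" if "m \<ge> max M n0" for m
      using M[of m] up[of m] un that e unfolding real_norm_def by linarith
    then show "\<exists>no. \<forall>n\<ge>no. norm (u n - L) < e" by blast
  qed
  then show ?thesis by (rule that)
qed

section \<open>Filtrations\<close>

locale filtered_domain = graded_domain sc B y p \<omega>
  for sc :: "'k::field \<Rightarrow> 'b::idom \<Rightarrow> 'b" and B :: "nat \<Rightarrow> 'b set" and y :: "nat \<Rightarrow> 'b"
    and p :: nat and \<omega> :: "nat \<Rightarrow> real" +
  fixes F :: "nat \<Rightarrow> real \<Rightarrow> 'b set" and f :: "nat \<Rightarrow> real"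
  assumes f_nonneg: "\<And>n. f n \<ge> 0"
    and f_mono: "mono f"
    and f_sum: "summable (\<lambda>\<alpha>::nat. f (2 ^ \<alpha>) / 2 ^ \<alpha>)"
    and filt: "\<And>n. n \<ge> 1 \<Longrightarrow> filtration_on sc (B n) (F n)"
    and sep: "\<And>n. n \<ge> 1 \<Longrightarrow> separated (F n)"
    and exh: "\<And>n. n \<ge> 1 \<Longrightarrow> exhaustive (B n) (F n)"
    and lcont: "\<And>n. n \<ge> 1 \<Longrightarrow> left_continuous (F n)"
    and pf: "pseudo_filtered f F"
    and bounded: "limsup (\<lambda>n. SUP a\<in>B n - {0}. filt_index (F n) a / ereal (real n)) < \<infinity>"
begin

lemma F_subspace: "n \<ge> 1 \<Longrightarrow> subspace (F n s)" and F_le: "n \<ge> 1 \<Longrightarrow> F n s \<subseteq> B n"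
  and F_antimono: "n \<ge> 1 \<Longrightarrow> s \<le> t \<Longrightarrow> F n t \<subseteq> F n s"
  using filt[of n] unfolding filtration_on_def by auto

text \<open>The index as a real number. For \<open>n \<ge> 1\<close> and nonzero \<open>a\<close> in
  \<open>B n\<close>, exhaustiveness makes the set nonempty and separatedness bounds it
  above.\<close>

definition lam :: "nat \<Rightarrow> 'b \<Rightarrow> real" where "lam n a = Sup {s. a \<in> F n s}"

text \<open>Left continuity makes the supremum attained, so membership in a filtration step becomes
  an inequality.\<close>

lemma mem_F_iff:
  assumes n: "n \<ge> 1" and a: "a \<in> B n" "a \<noteq> 0"
  shows "a \<in> F n s \<longleftrightarrow> s \<le> lam n a"
proof -
  let ?S = "{s. a \<in> F n s}"
  have ne: "?S \<noteq> {}" using exh[OF n] a(1) unfolding exhaustive_def by blast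
  obtain s0 where s0: "a \<notin> F n s0" using sep[OF n] a(2) unfolding separated_def by blast
  have bdd: "bdd_above ?S"
  proof (rule bdd_aboveI[of _ s0])
    fix s assume "s \<in> ?S"
    then show "s \<le> s0" using F_antimono[OF n, of s0 s] s0 by force
  qed
  show ?thesis
  proof
    assume "a \<in> F n s"
    then show "s \<le> lam n a" unfolding lam_def using bdd by (intro cSup_upper) auto
  next
    assume le: "s \<le> lam n a"
    have "a \<in> F n t" if "t < s" for t
    proof -
      have "t < Sup ?S" using that le unfolding lam_def by simp
      then obtain s' where "s' \<in> ?S" "t < s'" using less_cSup_iff[OF ne bdd] by blast
      then show ?thesis using F_antimono[OF n, of t s'] by auto
    qed
    moreover have "F n s = (\<Inter>t\<in>{..<s}. F n t)" using lcont[OF n] unfolding left_continuous_def by blast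
    ultimately show "a \<in> F n s" by auto
  qed
qed

text \<open>The threshold is taken at least \<open>1\<close>, since the filtration axioms are
  available only in positive degrees.\<close>

definition N0 :: nat where
  "N0 = (SOME N. N \<ge> 1 \<and> (\<forall>n m. N \<le> n \<longrightarrow> N \<le> m \<longrightarrow> (\<forall>s t. \<forall>a\<in>F n s. \<forall>b\<in>F m t. a * b \<in> F (n + m) (s + t - f n - f m))))"

lemma N0_ge: "N0 \<ge> 1"
  and F_mult: "N0 \<le> n \<Longrightarrow> N0 \<le> m \<Longrightarrow> a \<in> F n s \<Longrightarrow> b \<in> F m t \<Longrightarrow> a * b \<in> F (n + m) (s + t - f n - f m)"
proof -
  let ?P = "\<lambda>N. N \<ge> 1 \<and> (\<forall>n m. N \<le> n \<longrightarrow> N \<le> m \<longrightarrow> (\<forall>s t. \<forall>a\<in>F n s. \<forall>b\<in>F m t. a * b \<in> F (n + m) (s + t - f n - f m)))"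
  obtain N where N: "\<forall>n m. N \<le> n \<longrightarrow> N \<le> m \<longrightarrow> (\<forall>s t. \<forall>a\<in>F n s. \<forall>b\<in>F m t. a * b \<in> F (n + m) (s + t - f n - f m))"
    using pf unfolding pseudo_filtered_def by blast
  have "?P (Suc N)" using N Suc_leD by auto
  then have "?P N0" unfolding N0_def by (rule someI)
  then show "N0 \<ge> 1" "N0 \<le> n \<Longrightarrow> N0 \<le> m \<Longrightarrow> a \<in> F n s \<Longrightarrow> b \<in> F m t \<Longrightarrow> a * b \<in> F (n + m) (s + t - f n - f m)"
    by blast+
qed

text \<open>Almost superadditivity of \<open>j \<mapsto> lam (j * n) (b ^ j)\<close>; since the ring
  is a domain, powers of a nonzero \<open>b\<close> are nonzero and have an index.\<close>

lemma power_mem_F: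
  assumes n: "n \<ge> N0" and k: "k \<ge> 1" and b: "b \<in> F n s"
  shows "b ^ k \<in> F (k * n) (real k * s - 2 * real k * dyadic_err f n)"
proof (cases "b = 0")
  case True
  have "k * n \<ge> 1" using n N0_ge k by simp
  then show ?thesis using True k subspace_0[OF F_subspace] by (simp add: power_0_left)
next
  case False
  have n1: "n \<ge> 1" using n N0_ge by simp
  have bB: "b \<in> B n" using b F_le[OF n1] by blast
  have pB: "b ^ j \<in> B (j * n)" "b ^ j \<noteq> 0" for j using B_power[OF bB] False by auto
  have j1: "j * n \<ge> N0" "j * n \<ge> 1" if "j \<ge> 1" for j
  proof -
    have "n \<le> j * n" using mult_le_mono1[OF that, of n] unfolding mult_1 .
    then show "j * n \<ge> N0" "j * n \<ge> 1" using n n1 by linarith+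
  qed
  define h where "h j = lam (j * n) (b ^ j)" for j
  have hF: "b ^ j \<in> F (j * n) (h j)" if "j \<ge> 1" for j
    unfolding h_def using mem_F_iff[OF j1(2)[OF that] pB] by simp
  have "real k * h 1 - 2 * real k * dyadic_err f n \<le> h k"
  proof (rule almost_superadditive_ge[OF f_nonneg f_mono f_sum _ k])
    fix j l :: nat assume jl: "j \<ge> 1" "l \<ge> 1"
    have "b ^ j * b ^ l \<in> F (j * n + l * n) (h j + h l - f (j * n) - f (l * n))"
      by (rule F_mult[OF j1(1)[OF jl(1)] j1(1)[OF jl(2)] hF[OF jl(1)] hF[OF jl(2)]])
    then have "b ^ (j + l) \<in> F ((j + l) * n) (h j + h l - f (j * n) - f (l * n))"
      by (simp add: power_add distrib_right)
    then show "h j + h l - f (j * n) - f (l * n) \<le> h (j + l)"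
      unfolding h_def using mem_F_iff[OF j1(2) pB, of "j + l"] jl by simp
  qed
  moreover have "s \<le> h 1" unfolding h_def using mem_F_iff[OF n1 bB False] b by simp
  then have "real k * s \<le> real k * h 1" by (intro mult_left_mono) auto
  ultimately have "real k * s - 2 * real k * dyadic_err f n \<le> h k" by linarith
  then show ?thesis unfolding h_def using mem_F_iff[OF j1(2)[OF k] pB] by simp
qed

section \<open>Linear bounds for the jumps of the filtrations\<close>

lemma B_le_F_exists: assumes n: "n \<ge> 1" shows "\<exists>s. B n \<subseteq> F n s"
proof -
  let ?M = "{\<alpha> \<in> exps {..<p}. tdeg \<alpha> = n}"
  have "\<forall>\<alpha>\<in>?M. \<exists>s. mon \<alpha> \<in> F n s"
    using mon_B exh[OF n] unfolding exhaustive_def by blast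
  from bchoice[OF this] obtain s where s: "\<And>\<alpha>. \<alpha> \<in> ?M \<Longrightarrow> mon \<alpha> \<in> F n (s \<alpha>)" by blast
  define m where "m = - (\<Sum>\<alpha>\<in>?M. \<bar>s \<alpha>\<bar>)"
  have "mon \<alpha> \<in> F n m" if a: "\<alpha> \<in> ?M" for \<alpha>
  proof -
    have "\<bar>s \<alpha>\<bar> \<le> (\<Sum>\<alpha>\<in>?M. \<bar>s \<alpha>\<bar>)" by (rule member_le_sum[OF a _ finite_exps_tdeg]) simp
    then have "m \<le> s \<alpha>" unfolding m_def by linarith
    then show ?thesis using F_antimono[OF n] s[OF a] by blast
  qed
  then have "span (mon ` ?M) \<subseteq> F n m" by (intro span_minimal F_subspace n) auto
  then show ?thesis using B_span_mon by blast
qed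

definition lam_min :: "nat \<Rightarrow> real" where "lam_min n = Inf (lam n ` (B n - {0}))"

lemma B_le_F_iff: assumes n: "n \<ge> 1" shows "B n \<subseteq> F n s \<longleftrightarrow> s \<le> lam_min n"
proof -
  obtain b where b: "b \<in> B n" "b \<noteq> 0" using B_nonzero by blast
  obtain s0 where s0: "B n \<subseteq> F n s0" using B_le_F_exists[OF n] by blast
  have ne: "lam n ` (B n - {0}) \<noteq> {}" using b by blast
  have bdd: "bdd_below (lam n ` (B n - {0}))"
    using s0 mem_F_iff[OF n] by (intro bdd_belowI[of _ s0]) blast
  have "B n \<subseteq> F n s \<longleftrightarrow> (\<forall>a\<in>B n - {0}. s \<le> lam n a)"
  proof
    assume "B n \<subseteq> F n s" then show "\<forall>a\<in>B n - {0}. s \<le> lam n a" using mem_F_iff[OF n] by blast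
  next
    assume h: "\<forall>a\<in>B n - {0}. s \<le> lam n a"
    show "B n \<subseteq> F n s"
    proof
      fix a assume "a \<in> B n"
      then show "a \<in> F n s" using h mem_F_iff[OF n, of a s] subspace_0[OF F_subspace[OF n]] by (cases "a = 0") auto
    qed
  qed
  also have "\<dots> \<longleftrightarrow> s \<le> lam_min n"
    unfolding lam_min_def le_cInf_iff[OF ne bdd] by blast
  finally show ?thesis .
qed

lemma lam_min_add:
  assumes "n \<ge> N0" "m \<ge> N0"
  shows "lam_min n + lam_min m - f n - f m \<le> lam_min (n + m)"
proof -
  have 1: "n \<ge> 1" "m \<ge> 1" "n + m \<ge> 1" using assms N0_ge by auto
  have "a * b \<in> F (n + m) (lam_min n + lam_min m - f n - f m)" if "a \<in> B n" "b \<in> B m" for a b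
    using F_mult[OF assms] B_le_F_iff[OF 1(1), of "lam_min n"] B_le_F_iff[OF 1(2), of "lam_min m"] that by blast
  then have "span {a * b | a b. a \<in> B n \<and> b \<in> B m} \<subseteq> F (n + m) (lam_min n + lam_min m - f n - f m)"
    by (intro span_minimal F_subspace 1) auto
  then have "B (n + m) \<subseteq> F (n + m) (lam_min n + lam_min m - f n - f m)" using B_add_span by blast
  then show ?thesis using B_le_F_iff[OF 1(3)] by blast
qed

lemma f_small: assumes "e > 0" obtains M where "\<And>n. n \<ge> M \<Longrightarrow> f n \<le> e * real n"
proof -
  obtain M where "\<And>n. n \<ge> M \<Longrightarrow> dyadic_err f n \<le> e * real n"
    using dyadic_err_small[OF f_nonneg f_mono f_sum assms] by blast
  then show ?thesis using that dyadic_err_ge(2)[OF f_nonneg f_mono f_sum] by (meson order_trans)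
qed

text \<open>Along multiples of \<open>N0\<close> the bound is almost superadditivity. Any other
  large degree is \<open>k * N0 + r\<close> with one of finitely many remainders \<open>r\<close>,
  to which one more product applies.\<close>

lemma lam_min_lower_bound: obtains C where "C \<ge> 0" "\<And>n. n \<ge> 1 \<Longrightarrow> - C * real n \<le> lam_min n"
proof -
  obtain M where M: "\<And>n. n \<ge> M \<Longrightarrow> f n \<le> 1 * real n" using f_small[of 1] by auto
  define c where "c = \<bar>lam_min N0\<bar> + 2 * \<bar>dyadic_err f N0\<bar>"
  define R where "R = (\<Sum>n<2 * N0 + M. \<bar>lam_min n\<bar>)"
  have R: "\<bar>lam_min n\<bar> \<le> R" if "n < 2 * N0 + M" for n
    unfolding R_def by (rule member_le_sum) (use that in auto)
  have R0: "R \<ge> 0" unfolding R_def by (rule sum_nonneg) simp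
  have mult: "- (real k * c) \<le> lam_min (k * N0)" if "k \<ge> 1" for k
  proof -
    have "real k * lam_min (1 * N0) - 2 * real k * dyadic_err f N0 \<le> lam_min (k * N0)"
    proof (rule almost_superadditive_ge[OF f_nonneg f_mono f_sum _ that])
      fix j l :: nat assume "j \<ge> 1" "l \<ge> 1"
      then have "j * N0 \<ge> N0" "l * N0 \<ge> N0" by auto
      from lam_min_add[OF this] show "lam_min (j * N0) + lam_min (l * N0) - f (j * N0) - f (l * N0) \<le> lam_min ((j + l) * N0)"
        by (simp add: distrib_right)
    qed
    moreover have "- (real k * c) \<le> real k * (lam_min N0 - 2 * dyadic_err f N0)"
      unfolding minus_mult_right c_def by (intro mult_left_mono) auto
    ultimately show ?thesis by (simp add: algebra_simps)
  qed
  have "- (c + R + 2) * real n \<le> lam_min n" if n: "n \<ge> 1" for n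
  proof (cases "n < 2 * N0 + M")
    case True
    have "R \<le> R * real n" using R0 n by (simp add: mult_le_cancel_left1)
    moreover have "0 \<le> c * real n" unfolding c_def by simp
    ultimately show ?thesis using R[OF True] by (simp add: algebra_simps)
  next
    case False
    \<comment> \<open>One copy of \<open>N0\<close> is kept back, so that the remainder satisfies
      \<open>N0 \<le> r < 2 * N0\<close> and the product axiom applies to both parts.\<close>
    define k where "k = n div N0 - 1"
    define r where "r = n - k * N0"
    have q: "n div N0 \<ge> 2" using False N0_ge by (simp add: less_eq_div_iff_mult_less_eq)
    then have k1: "k \<ge> 1" unfolding k_def by simp
    have "n div N0 * N0 \<le> n" by simp
    moreover have "n < n div N0 * N0 + N0" using N0_ge dividend_less_div_times[of N0 n] by linarith
    moreover have kN: "k * N0 = n div N0 * N0 - N0" unfolding k_def by (simp add: diff_mult_distrib)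
    moreover have "2 * N0 \<le> n div N0 * N0" using q by (rule mult_le_mono1)
    ultimately have r: "N0 \<le> r" "r < 2 * N0" "n = k * N0 + r" unfolding r_def by linarith+
    have kN0: "k * N0 \<ge> N0" using k1 by auto
    have "lam_min (k * N0) + lam_min r - f (k * N0) - f r \<le> lam_min n" using lam_min_add[OF kN0 r(1)] r(3) by simp
    moreover have "f (k * N0) \<le> f n" "f r \<le> f n" using r(3) by (auto intro!: monoD[OF f_mono])
    moreover have "f n \<le> real n" using M[of n] False by simp
    moreover have "- R \<le> lam_min r" using R[of r] r(2) by auto
    moreover have "- (real k * c) \<le> lam_min (k * N0)" by (rule mult[OF k1])
    moreover have "real k * c \<le> real n * c"
    proof (rule mult_right_mono)
      have "k * 1 \<le> k * N0" using N0_ge by (rule mult_le_mono2)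
      then have "k \<le> n" using r(3) by linarith
      then show "real k \<le> real n" by simp
    qed (simp add: c_def)
    moreover have "R \<le> R * real n" using R0 n by (simp add: mult_le_cancel_left1)
    ultimately have "- (real n * c) - R * real n - 2 * real n \<le> lam_min n" by linarith
    then show ?thesis by (simp add: algebra_simps)
  qed
  moreover have "c + R + 2 \<ge> 0" using R0 unfolding c_def by simp
  ultimately show ?thesis by (rule that[rotated])
qed

lemma subspace_dim_eq:
  assumes "subspace W" "subspace W'" "W \<subseteq> W'" "W' \<subseteq> B n" "dim W = dim W'"
  shows "W = W'"
proof (rule ccontr)
  assume "W \<noteq> W'"
  then obtain x where x: "x \<in> W'" "x \<notin> W" using assms(3) by blast
  obtain b where b: "b \<subseteq> W" "independent b" "W \<subseteq> span b" "card b = dim W" using basis_exists by blast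
  have "x \<notin> span b" using x(2) span_minimal[OF b(1) assms(1)] by blast
  then have ind: "independent (insert x b)" using b(2) by (rule independent_insertI)
  have "finite b" using card_independent_le_dim(1)[of W n b] b(1,2) assms(3,4) by blast
  moreover have "card (insert x b) \<le> dim W'"
    using card_independent_le_dim(2)[OF assms(4) _ ind] b(1) x(1) assms(3) by blast
  moreover have "x \<notin> b" using x(2) b(1) by blast
  ultimately show False using b(4) assms(5) by simp
qed

text \<open>The dimensions decrease to a minimum, after which the spaces are constant; this constant
  space lies in the intersection, which is zero.\<close>

lemma F_trivial_exists: assumes n: "n \<ge> 1" shows "\<exists>s. F n s = {0}"
proof -
  obtain s where s: "\<And>t. dim (F n s) \<le> dim (F n t)"
    using ex_has_least_nat[of "\<lambda>_. True" _ "\<lambda>t. dim (F n t)"] by blast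
  have eq: "F n t = F n s" if "t \<ge> s" for t
  proof (rule subspace_dim_eq[OF F_subspace[OF n] F_subspace[OF n] F_antimono[OF n that] F_le[OF n]])
    show "dim (F n t) = dim (F n s)"
      using s[of t] dim_mono_B[OF F_antimono[OF n that] F_le[OF n]] by simp
  qed
  have "F n s \<subseteq> F n t" for t
    using eq[of t] F_antimono[OF n, of t s] by (cases "t \<ge> s") auto
  then have "F n s \<subseteq> (\<Inter>t. F n t)" by blast
  then have "F n s \<subseteq> {0}" using sep[OF n] unfolding separated_def by simp
  then show ?thesis using subspace_0[OF F_subspace[OF n]] by blast
qed

text \<open>The upper limit hypothesis handles all large degrees; the finitely many others are
  covered by \<open>F_trivial_exists\<close>, through the constant \<open>R\<close>.\<close>

lemma lam_upper_bound: obtains C where "C \<ge> 0" "\<And>n s. n \<ge> 1 \<Longrightarrow> s > C * real n \<Longrightarrow> F n s = {0}"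
proof -
  let ?u = "\<lambda>n. SUP a\<in>B n - {0}. filt_index (F n) a / ereal (real n)"
  obtain c where c: "limsup ?u < ereal c" using ereal_dense2[OF bounded] by blast
  have "eventually (\<lambda>n. ?u n < ereal c) sequentially" using Limsup_lessD[OF c] .
  then obtain M where M: "\<And>n. n \<ge> M \<Longrightarrow> ?u n < ereal c" by (auto simp: eventually_sequentially)
  have big: "F n s = {0}" if n: "n \<ge> 1" "n \<ge> M" and s: "s > c * real n" for n s
  proof -
    have "a = 0" if a: "a \<in> F n s" for a
    proof (rule ccontr)
      assume a0: "a \<noteq> 0"
      have "ereal s \<le> filt_index (F n) a" unfolding filt_index_def using a by (intro SUP_upper) simp
      then have "ereal s / ereal (real n) \<le> filt_index (F n) a / ereal (real n)"
        using n(1) by (intro ereal_divide_right_mono) auto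
      also have "\<dots> \<le> ?u n" using a a0 F_le[OF n(1)] by (intro SUP_upper) auto
      also have "\<dots> < ereal c" by (rule M[OF n(2)])
      finally have "s / real n < c" using n(1) by simp
      then show False using s n(1) by (simp add: field_simps)
    qed
    then show ?thesis using subspace_0[OF F_subspace[OF n(1)]] by blast
  qed
  have "\<forall>n\<in>{1..<M}. \<exists>s. F n s = {0}" using F_trivial_exists by simp
  from bchoice[OF this] obtain t where t: "\<forall>n\<in>{1..<M}. F n (t n) = {0}" ..
  define R where "R = (\<Sum>n\<in>{1..<M}. \<bar>t n\<bar>)"
  have R0: "R \<ge> 0" unfolding R_def by (rule sum_nonneg) simp
  have "F n s = {0}" if n: "n \<ge> 1" and s: "s > (\<bar>c\<bar> + R) * real n" for n s
  proof (cases "n \<ge> M")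
    case True
    have "c * real n \<le> (\<bar>c\<bar> + R) * real n" using R0 by (intro mult_right_mono) auto
    then have "c * real n < s" using s by linarith
    then show ?thesis by (rule big[OF n True])
  next
    case False
    then have nM: "n \<in> {1..<M}" using n by simp
    have "\<bar>t n\<bar> \<le> R" unfolding R_def by (rule member_le_sum) (use nM in auto)
    also have "R \<le> R * real n" using R0 n by (simp add: mult_le_cancel_left1)
    also have "\<dots> \<le> (\<bar>c\<bar> + R) * real n" by (intro mult_right_mono) auto
    finally have "t n \<le> s" using s by simp
    then have "F n s \<subseteq> {0}" using F_antimono[OF n, of "t n" s] bspec[OF t nM] by simp
    then show ?thesis using subspace_0[OF F_subspace[OF n]] by blast
  qed
  moreover have "\<bar>c\<bar> + R \<ge> 0" using R0 by simp
  ultimately show ?thesis by (rule that[rotated])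
qed

lemma F_range:
  obtains C where "C \<ge> 0" "\<And>n s. n \<ge> 1 \<Longrightarrow> s \<le> - C * real n \<Longrightarrow> F n s = B n"
    "\<And>n s. n \<ge> 1 \<Longrightarrow> s > C * real n \<Longrightarrow> F n s = {0}"
proof -
  obtain C1 where C1: "C1 \<ge> 0" "\<And>n. n \<ge> 1 \<Longrightarrow> - C1 * real n \<le> lam_min n" using lam_min_lower_bound by blast
  obtain C2 where C2: "C2 \<ge> 0" "\<And>n s. n \<ge> 1 \<Longrightarrow> s > C2 * real n \<Longrightarrow> F n s = {0}" using lam_upper_bound by blast
  show ?thesis
  proof (rule that[of "C1 + C2"])
    show "C1 + C2 \<ge> 0" using C1(1) C2(1) by simp
    show "F n s = B n" if "n \<ge> 1" "s \<le> - (C1 + C2) * real n" for n s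
    proof -
      have "0 \<le> C2 * real n" using C2(1) by simp
      then have "s \<le> lam_min n" using C1(2)[OF that(1)] that(2) by (simp add: algebra_simps)
      then show ?thesis using B_le_F_iff[OF that(1)] F_le[OF that(1)] by blast
    qed
    show "F n s = {0}" if "n \<ge> 1" "s > (C1 + C2) * real n" for n s
    proof -
      have "0 \<le> C1 * real n" using C1(1) by simp
      then show ?thesis using C2(2)[OF that(1)] that(2) by (simp add: algebra_simps)
    qed
  qed
qed

end

section \<open>Comparison of the filtrations in different degrees\<close>

context filtered_domain
begin

lemma dim_B_pos: "dim (B n) > 0"
proof -
  obtain b where b: "b \<in> B n" "b \<noteq> 0" using B_nonzero by blast
  then have "card {b} \<le> dim (B n)" by (intro card_independent_le_dim(2)[of _ n]) auto
  then show ?thesis by simp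
qed

text \<open>For fixed \<open>n\<close> and large \<open>m\<close>, write
  \<open>m = k * n + q\<close> with \<open>k\<close> congruent to \<open>1\<close> modulo
  \<open>E\<close> and \<open>q\<close> close to \<open>k * d\<close>. The \<open>k\<close>-th
  powers from \<open>F n (n * x)\<close> times \<open>B q\<close> lie in a step
  \<open>F m t\<close>, and \<open>t\<close> is at least \<open>m * x'\<close> because all losses
  are small multiples of \<open>k * n\<close>.\<close>

theorem dim_F_compare:
  obtains d :: nat and K :: real where "K > 0" "\<And>n. n \<ge> 1 \<Longrightarrow> real (dim (B n)) \<le> K * real n ^ d"
    "\<And>\<theta> x x'. 0 < \<theta> \<Longrightarrow> \<theta> < 1 \<Longrightarrow> x' < x \<Longrightarrow> \<exists>n0. \<forall>n\<ge>n0. \<exists>M. \<forall>m\<ge>M.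
       (\<theta> * real m / real n) ^ d * real (dim (F n (real n * x))) \<le> real (dim (F m (real m * x')))"
proof (rule dimension_growth)
  fix d C E m0 :: nat
  assume E: "E \<ge> 1" and C: "\<And>m. dim (B m) \<le> C * (m + 1) ^ d" and
    main: "\<And>n k q l V' W. k = 1 + E * l \<Longrightarrow> d * (k - 1) + m0 \<le> q \<Longrightarrow> subspace V' \<Longrightarrow> V' \<subseteq> B n \<Longrightarrow> W \<subseteq> B (k * n + q) \<Longrightarrow>
      (\<And>b g. b \<in> V' \<Longrightarrow> g \<in> B q \<Longrightarrow> b ^ k * g \<in> W) \<Longrightarrow> k ^ d * dim V' \<le> dim W"
  obtain R where R: "R \<ge> 0" "\<And>n s. n \<ge> 1 \<Longrightarrow> s \<le> - R * real n \<Longrightarrow> F n s = B n" using F_range by metis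
  define K where "K = real C * 2 ^ d + 1"
  have K: "real (dim (B n)) \<le> K * real n ^ d" if "n \<ge> 1" for n
  proof -
    have "real (dim (B n)) \<le> real (C * (n + 1) ^ d)" using C by (rule of_nat_mono)
    also have "\<dots> = real C * (real n + 1) ^ d" by (simp add: add.commute)
    also have "\<dots> \<le> real C * (2 * real n) ^ d" using that by (intro mult_left_mono power_mono) auto
    also have "\<dots> \<le> K * real n ^ d" unfolding K_def power_mult_distrib by (simp add: algebra_simps)
    finally show ?thesis .
  qed
  have "\<exists>n0. \<forall>n\<ge>n0. \<exists>M. \<forall>m\<ge>M.
       (\<theta> * real m / real n) ^ d * real (dim (F n (real n * x))) \<le> real (dim (F m (real m * x')))"
    if \<theta>: "0 < \<theta>" "\<theta> < 1" and xx': "x' < x" for \<theta> x x'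
  proof -
    \<comment> \<open>The middle bound gives \<open>\<theta> * (1 + 2 * \<eta>) \<le> 1\<close>, so
      that \<open>\<theta> * m / n \<le> k\<close>. In the last one, with \<open>a = k * n\<close>,
      the 8 covers \<open>2 * \<eta> * a\<close> for the powers and \<open>6 * \<eta> * a\<close>
      for the two values of \<open>f\<close>; the rest covers \<open>R * q\<close> and
      \<open>q * x'\<close>, as \<open>q \<le> 2 * \<eta> * a\<close>.\<close>
    define \<eta> where "\<eta> = min 1 (min ((1 / \<theta> - 1) / 2) ((x - x') / (8 + 2 * (R + \<bar>x'\<bar>))))"
    have pos: "8 + 2 * (R + \<bar>x'\<bar>) > 0" using R(1) by simp
    have \<eta>0: "\<eta> > 0" unfolding \<eta>_def using \<theta> xx' pos by simp
    have \<eta>1: "\<eta> \<le> 1" unfolding \<eta>_def by simp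
    have \<eta>2: "\<theta> * (1 + 2 * \<eta>) \<le> 1"
    proof -
      have "\<eta> \<le> (1 / \<theta> - 1) / 2" unfolding \<eta>_def by (rule min.coboundedI2[OF min.cobounded1])
      then have "1 + 2 * \<eta> \<le> 1 / \<theta>" by simp
      then show ?thesis using \<theta>(1) by (simp add: field_simps)
    qed
    have \<eta>3: "\<eta> * (8 + 2 * (R + \<bar>x'\<bar>)) \<le> x - x'"
    proof -
      have "\<eta> \<le> (x - x') / (8 + 2 * (R + \<bar>x'\<bar>))" unfolding \<eta>_def by (rule min.coboundedI2[OF min.cobounded2])
      then show ?thesis using pos by (simp add: pos_le_divide_eq)
    qed
    obtain N1 where N1: "\<And>n. n \<ge> N1 \<Longrightarrow> dyadic_err f n \<le> \<eta> * real n"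
      using dyadic_err_small[OF f_nonneg f_mono f_sum \<eta>0] by blast
    obtain Mf where Mf: "\<And>n. n \<ge> Mf \<Longrightarrow> f n \<le> \<eta> * real n" using f_small[OF \<eta>0] by blast
    define n0 where "n0 = max N0 (max N1 (nat \<lceil>real d / \<eta>\<rceil>))"
    have "\<exists>M. \<forall>m\<ge>M. (\<theta> * real m / real n) ^ d * real (dim (F n (real n * x))) \<le> real (dim (F m (real m * x')))"
      if n: "n \<ge> n0" for n
    proof -
      have nN: "n \<ge> N0" "n \<ge> N1" "n \<ge> 1" using n N0_ge unfolding n0_def by auto
      have "real d / \<eta> \<le> real n" using n unfolding n0_def by linarith
      then have dn: "real d \<le> \<eta> * real n" using \<eta>0 by (simp add: field_simps)
      define s where "s = n + d"
      have s1: "s \<ge> 1" unfolding s_def using nN by simp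
      \<comment> \<open>\<open>Q\<close> reserves the degree \<open>m0\<close> of the auxiliary
        family and ensures \<open>q \<ge> N0\<close>. \<open>T\<close> adds the error
        \<open>E * s\<close> of rounding \<open>k\<close> to its residue class.\<close>
      define Q where "Q = m0 + N0"
      define T where "T = Q + E * s"
      \<comment> \<open>Together with \<open>m < k * s + T\<close>, the middle term forces
        \<open>T \<le> \<eta> * k * n\<close>.\<close>
      define M where "M = max Mf (nat \<lceil>real T + real s * real T / (\<eta> * real n)\<rceil> + s + T)"
      have "(\<theta> * real m / real n) ^ d * real (dim (F n (real n * x))) \<le> real (dim (F m (real m * x')))"
        if m: "m \<ge> M" for m
      proof -
        have mT: "m \<ge> s + T" "m \<ge> Mf" using m unfolding M_def by auto
        have mr: "real T + real s * real T / (\<eta> * real n) \<le> real m" using m unfolding M_def by linarith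
        \<comment> \<open>Each unit of \<open>k\<close> uses degree \<open>s = n + d\<close>, and
          \<open>k\<close> can only grow in steps of \<open>E\<close>.\<close>
        define l where "l = (m - Q - s) div (E * s)"
        define k where "k = 1 + E * l"
        have Es: "E * s > 0" using E s1 by simp
        have l1: "l * (E * s) \<le> m - Q - s" unfolding l_def by simp
        have l2: "m - Q - s < l * (E * s) + E * s" unfolding l_def using dividend_less_div_times[OF Es, of "m - Q - s"] by simp
        have ks: "k * s = s + l * (E * s)" unfolding k_def by (simp add: algebra_simps)
        have QT: "Q \<le> T" unfolding T_def by simp
        have m1: "k * s + Q \<le> m" using l1 ks mT(1) QT by linarith
        have m2: "m < k * s + T" using l2 ks mT(1) QT unfolding T_def by linarith
        have k1: "k \<ge> 1" unfolding k_def by simp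
        have ksd: "k * s = k * n + k * d" unfolding s_def by (simp add: distrib_left)
        define q where "q = m - k * n"
        have mq: "m = k * n + q" unfolding q_def using m1 ksd by linarith
        have q1: "k * d + Q \<le> q" using m1 ksd mq by linarith
        have q2: "q < k * d + T" using m2 ksd mq by linarith
        have qN: "q \<ge> N0" "q \<ge> 1" using q1 N0_ge unfolding Q_def by auto
        have "n \<le> k * n" using mult_le_mono1[OF k1, of n] by simp
        then have knN: "k * n \<ge> N0" using nN(1) by linarith
        have m1': "m \<ge> 1" using mq qN by simp
        define t where "t = real k * (real n * x) - 2 * real k * dyadic_err f n + (- R * real q) - f (k * n) - f q"
        have "k ^ d * dim (F n (real n * x)) \<le> dim (F m t)"
        proof (rule main[OF k_def])
          have "d * (k - 1) \<le> k * d" by (simp add: mult.commute)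
          then show "d * (k - 1) + m0 \<le> q" using q1 unfolding Q_def by linarith
          show "subspace (F n (real n * x))" "F n (real n * x) \<subseteq> B n" using F_subspace F_le nN(3) by auto
          show "F m t \<subseteq> B (k * n + q)" using F_le[OF m1'] mq by simp
          fix b g assume bg: "b \<in> F n (real n * x)" "g \<in> B q"
          have "g \<in> F q (- R * real q)" using R(2)[OF qN(2)] bg(2) by simp
          from F_mult[OF knN qN(1) power_mem_F[OF nN(1) k1 bg(1)] this]
          show "b ^ k * g \<in> F m t" unfolding t_def mq .
        qed
        then have dim1: "real k ^ d * real (dim (F n (real n * x))) \<le> real (dim (F m t))"
          by (metis of_nat_le_iff of_nat_mult of_nat_power)
        define a where "a = real k * real n"
        have a0: "a > 0" unfolding a_def using k1 nN by simp
        have Ta: "real T \<le> \<eta> * a"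
        proof -
          have "real m < real (k * s + T)" using m2 by (rule of_nat_less_iff[THEN iffD2])
          then have "real m < real k * real s + real T" by simp
          then have "real s * (real T / (\<eta> * real n)) < real s * real k" using mr by (simp add: algebra_simps)
          then have "real T / (\<eta> * real n) < real k" by (rule mult_left_less_imp_less) simp
          then show ?thesis unfolding a_def using \<eta>0 nN(3) by (simp add: field_simps)
        qed
        have da: "real k * real d \<le> \<eta> * a"
          using mult_left_mono[OF dn, of "real k"] unfolding a_def by (simp add: algebra_simps)
        have "real q \<le> real (k * d + T)" using q2 by (intro of_nat_mono) simp
        then have "real q \<le> real k * real d + real T" by simp
        then have qa: "real q \<le> 2 * (\<eta> * a)" using Ta da by linarith
        have mr': "real m = a + real q" unfolding mq a_def by simp
        then have ma: "real m \<le> a * (1 + 2 * \<eta>)" using qa by (simp add: algebra_simps)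
        have ea: "2 * real k * dyadic_err f n \<le> 2 * (\<eta> * a)"
          using mult_left_mono[OF N1[OF nN(2)], of "2 * real k"] unfolding a_def by (simp add: algebra_simps)
        have \<eta>a: "\<eta> * real m \<le> 3 * (\<eta> * a)"
        proof -
          have "a * (1 + 2 * \<eta>) \<le> a * 3" using \<eta>1 a0 by (intro mult_left_mono) auto
          then have "real m \<le> a * 3" using ma by linarith
          from mult_left_mono[OF this, of \<eta>] show ?thesis using \<eta>0 by (simp add: algebra_simps)
        qed
        have "f (k * n) \<le> f m" "f q \<le> f m" using mq by (auto intro!: monoD[OF f_mono])
        then have fa: "f (k * n) + f q \<le> 6 * (\<eta> * a)" using Mf[OF mT(2)] \<eta>a by linarith
        have Rq: "R * real q \<le> R * (2 * (\<eta> * a))" by (rule mult_left_mono[OF qa R(1)])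
        have xq: "real q * x' \<le> \<bar>x'\<bar> * (2 * (\<eta> * a))"
        proof -
          have "real q * x' \<le> real q * \<bar>x'\<bar>" by (intro mult_left_mono) auto
          also have "\<dots> \<le> 2 * (\<eta> * a) * \<bar>x'\<bar>" by (intro mult_right_mono qa) auto
          finally show ?thesis by (simp add: mult.commute)
        qed
        have "a * (\<eta> * (8 + 2 * (R + \<bar>x'\<bar>))) \<le> a * (x - x')" by (rule mult_left_mono[OF \<eta>3]) (use a0 in simp)
        then have "8 * (\<eta> * a) + R * (2 * (\<eta> * a)) + \<bar>x'\<bar> * (2 * (\<eta> * a)) \<le> a * x - a * x'" by (simp add: algebra_simps)
        moreover have "t = a * x - 2 * real k * dyadic_err f n - R * real q - f (k * n) - f q" unfolding t_def a_def by simp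
        moreover have "real m * x' = a * x' + real q * x'" unfolding mr' by (simp add: distrib_right)
        ultimately have "real m * x' \<le> t" using ea fa Rq xq by linarith
        then have "dim (F m t) \<le> dim (F m (real m * x'))" by (intro dim_mono_B[OF F_antimono F_le] m1')
        moreover have "(\<theta> * real m / real n) ^ d * real (dim (F n (real n * x))) \<le> real k ^ d * real (dim (F n (real n * x)))"
        proof (intro mult_right_mono power_mono)
          have "\<theta> * real m \<le> \<theta> * (a * (1 + 2 * \<eta>))" using ma \<theta>(1) by (intro mult_left_mono) auto
          also have "\<dots> = a * (\<theta> * (1 + 2 * \<eta>))" by (simp add: algebra_simps)
          also have "\<dots> \<le> a * 1" using \<eta>2 a0 by (intro mult_left_mono) auto
          finally show "\<theta> * real m / real n \<le> real k" unfolding a_def using nN(3) by (simp add: field_simps)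
        qed (use \<theta> in auto)
        ultimately show ?thesis using dim1 by linarith
      qed
      then show ?thesis by blast
    qed
    then show ?thesis by blast
  qed
  moreover have "K > 0" unfolding K_def by (simp add: add_nonneg_pos)
  ultimately show ?thesis using that[of K d] K by blast
qed

definition tail_fraction :: "nat \<Rightarrow> real \<Rightarrow> real" where
  "tail_fraction n x = real (dim (F n (real n * x))) / real (dim (B n))"

text \<open>The comparison is natural after division by \<open>n ^ d\<close>. For \<open>x\<close>
  below \<open>- R\<close> the filtration step is all of \<open>B n\<close>, so the same comparison
  shows that \<open>dim (B n) / n ^ d\<close> converges to a positive limit, without a Hilbert
  polynomial; then dividing by \<open>dim (B n)\<close> instead is harmless.\<close>

theorem tail_fraction_limits_le:
  assumes xx': "x' < x" and s: "strict_mono s" "strict_mono s'"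
    and lim: "(\<lambda>j. tail_fraction (s j) x) \<longlonglongrightarrow> L" "(\<lambda>j. tail_fraction (s' j) x') \<longlonglongrightarrow> L'"
  shows "L \<le> L'"
proof (rule dim_F_compare)
  fix d :: nat and K :: real
  assume K: "K > 0" "\<And>n. n \<ge> 1 \<Longrightarrow> real (dim (B n)) \<le> K * real n ^ d" and
    cmp: "\<And>\<theta> x x'. 0 < \<theta> \<Longrightarrow> \<theta> < 1 \<Longrightarrow> x' < x \<Longrightarrow> \<exists>n0. \<forall>n\<ge>n0. \<exists>M. \<forall>m\<ge>M.
       (\<theta> * real m / real n) ^ d * real (dim (F n (real n * x))) \<le> real (dim (F m (real m * x')))"
  define u where "u x n = real (dim (F n (real n * x))) / real n ^ d" for x n
  define A where "A n = real (dim (B n)) / real n ^ d" for n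
  have cmp1: "\<exists>n0\<ge>1. \<forall>n\<ge>n0. \<exists>M\<ge>1. \<forall>m\<ge>M. \<theta> ^ d * u x n \<le> u x' m" if th: "0 < \<theta>" "\<theta> < 1" "x' < x" for \<theta> x x'
  proof -
    obtain n0 where n0: "\<And>n. n \<ge> n0 \<Longrightarrow> \<exists>M. \<forall>m\<ge>M.
       (\<theta> * real m / real n) ^ d * real (dim (F n (real n * x))) \<le> real (dim (F m (real m * x')))" using cmp[OF th] by blast
    have "\<exists>M\<ge>1. \<forall>m\<ge>M. \<theta> ^ d * u x n \<le> u x' m" if n: "n \<ge> max 1 n0" for n
    proof -
      obtain M where M: "\<And>m. m \<ge> M \<Longrightarrow>
       (\<theta> * real m / real n) ^ d * real (dim (F n (real n * x))) \<le> real (dim (F m (real m * x')))" using n0 n by auto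
      have "\<theta> ^ d * u x n \<le> u x' m" if m: "m \<ge> max 1 M" for m
        using M[of m] m n unfolding u_def by (simp add: power_divide power_mult_distrib field_simps)
      then show ?thesis by (intro exI[of _ "max 1 M"]) auto
    qed
    then show ?thesis by (intro exI[of _ "max 1 n0"]) auto
  qed
  have A_le: "A n \<le> K" "A n > 0" if "n \<ge> 1" for n
    using K(2)[OF that] dim_B_pos[of n] that unfolding A_def by (auto simp: field_simps)
  have u_le: "u x n \<le> K" "u x n \<ge> 0" if "n \<ge> 1" for x n
  proof -
    have "u x n \<le> A n" unfolding u_def A_def using dim_mono_B[OF F_le[OF that] order_refl] by (intro divide_right_mono) auto
    then show "u x n \<le> K" using A_le[OF that] by simp
    show "u x n \<ge> 0" unfolding u_def by simp
  qed
  have cmp2: "\<exists>n0. \<forall>n\<ge>n0. \<exists>M. \<forall>m\<ge>M. u x n - e \<le> u x' m" if e: "e > 0" and x: "x' < x" for e x x'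
  proof -
    \<comment> \<open>By Bernoulli's inequality the factor \<open>(1 - \<tau>) ^ d\<close> costs at
      most \<open>K * d * \<tau> \<le> e\<close>. Using \<open>d + 1\<close> avoids a zero
      denominator, and \<open>1 / 2\<close> keeps \<open>\<tau> < 1\<close>.\<close>
    define \<tau> where "\<tau> = min (1 / 2) (e / (K * (real d + 1)))"
    have Kd: "K * (real d + 1) > 0" using K(1) by simp
    have \<tau>: "0 < \<tau>" "\<tau> < 1" "K * (real d + 1) * \<tau> \<le> e"
    proof -
      show "0 < \<tau>" "\<tau> < 1" unfolding \<tau>_def using e Kd by auto
      have "\<tau> \<le> e / (K * (real d + 1))" unfolding \<tau>_def by (rule min.cobounded2)
      then show "K * (real d + 1) * \<tau> \<le> e" using Kd by (simp add: pos_le_divide_eq mult.commute)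
    qed
    obtain n0 where n0: "n0 \<ge> 1" "\<And>n. n \<ge> n0 \<Longrightarrow> \<exists>M\<ge>1. \<forall>m\<ge>M. (1 - \<tau>) ^ d * u x n \<le> u x' m"
      using cmp1[of "1 - \<tau>" x' x] \<tau> x by auto
    have "\<exists>M. \<forall>m\<ge>M. u x n - e \<le> u x' m" if n: "n \<ge> n0" for n
    proof -
      have un: "u x n \<le> K" "u x n \<ge> 0" using u_le n n0(1) by auto
      have "1 + real d * (- \<tau>) \<le> (1 + - \<tau>) ^ d" using \<tau> by (intro Bernoulli_inequality) auto
      then have "(1 - real d * \<tau>) * u x n \<le> (1 - \<tau>) ^ d * u x n" using un(2) by (intro mult_right_mono) auto
      moreover have "real d * \<tau> * u x n \<le> e"
      proof -
        have "real d * \<tau> * u x n \<le> (real d + 1) * \<tau> * K" using un \<tau>(1) by (intro mult_mono) auto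
        then show ?thesis using \<tau>(3) by (simp add: algebra_simps)
      qed
      ultimately have "u x n - e \<le> (1 - \<tau>) ^ d * u x n" by (simp add: algebra_simps)
      then show ?thesis using n0(2)[OF n] order_trans by blast
    qed
    then show ?thesis by blast
  qed
  obtain R where R: "R \<ge> 0" "\<And>n s. n \<ge> 1 \<Longrightarrow> s \<le> - R * real n \<Longrightarrow> F n s = B n" using F_range by metis
  have uA: "u x n = A n" if "x \<le> - R" "n \<ge> 1" for x n
  proof -
    have "real n * x \<le> - R * real n" using mult_left_mono[OF that(1), of "real n"] by (simp add: mult.commute)
    then show ?thesis unfolding u_def A_def using R(2)[OF that(2)] by simp
  qed
  have "\<exists>n0. \<forall>n\<ge>n0. \<exists>M. \<forall>m\<ge>M. A n - e \<le> A m" if e: "e > 0" for e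
  proof -
    obtain n0 where n0: "\<And>n. n \<ge> n0 \<Longrightarrow> \<exists>M. \<forall>m\<ge>M. u (- R) n - e \<le> u (- R - 1) m"
      using cmp2[OF e, of "- R - 1" "- R"] by auto
    have "\<exists>M. \<forall>m\<ge>M. A n - e \<le> A m" if n: "n \<ge> max 1 n0" for n
    proof -
      obtain M where M: "\<And>m. m \<ge> M \<Longrightarrow> u (- R) n - e \<le> u (- R - 1) m" using n0 n by auto
      have "A n - e \<le> A m" if "m \<ge> max 1 M" for m
        using M[of m] uA[of "- R" n] uA[of "- R - 1" m] n that by auto
      then show ?thesis by blast
    qed
    then show ?thesis by blast
  qed
  moreover have "\<bar>A n\<bar> \<le> K" if "n \<ge> 1" for n using A_le[OF that] by simp
  ultimately obtain LA where LA: "A \<longlonglongrightarrow> LA" by (rule convergent_of_self_compare)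
  \<comment> \<open>Any fixed loss suffices for positivity: with \<open>\<theta> = 1 / 2\<close>,
    one positive term bounds all later ones from below.\<close>
  have LApos: "LA > 0"
  proof -
    obtain n0 where n0: "n0 \<ge> 1" "\<And>n. n \<ge> n0 \<Longrightarrow> \<exists>M\<ge>1. \<forall>m\<ge>M. (1 / 2) ^ d * u (- R) n \<le> u (- R - 1) m"
      using cmp1[of "1 / 2" "- R - 1" "- R"] by auto
    obtain M where M: "M \<ge> 1" "\<And>m. m \<ge> M \<Longrightarrow> (1 / 2) ^ d * u (- R) n0 \<le> u (- R - 1) m" using n0(2)[of n0] by auto
    have "(1 / 2) ^ d * A n0 \<le> A m" if "m \<ge> M" for m
      using M(2)[OF that] uA[of "- R" n0] uA[of "- R - 1" m] n0(1) M(1) that by auto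
    then have "(1 / 2) ^ d * A n0 \<le> LA" by (intro LIMSEQ_le_const[OF LA]) blast
    moreover have "(1 / 2) ^ d * A n0 > 0" using A_le(2)[OF n0(1)] by simp
    ultimately show ?thesis by linarith
  qed
  have ut: "u x n = tail_fraction n x * A n" if "n \<ge> 1" for x n
    unfolding u_def tail_fraction_def A_def using dim_B_pos[of n] by simp
  have lu: "(u z \<circ> r) \<longlonglongrightarrow> l * LA" if r: "strict_mono r" "(\<lambda>j. tail_fraction (r j) z) \<longlonglongrightarrow> l" for z r l
  proof -
    have "(\<lambda>j. tail_fraction (r j) z * (A \<circ> r) j) \<longlonglongrightarrow> l * LA"
      by (intro tendsto_mult r(2) LIMSEQ_subseq_LIMSEQ[OF LA r(1)])
    moreover have "eventually (\<lambda>j. tail_fraction (r j) z * (A \<circ> r) j = (u z \<circ> r) j) sequentially"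
      unfolding eventually_sequentially
    proof (intro exI[of _ 1] allI impI)
      fix j :: nat assume "j \<ge> 1"
      then have "r j \<ge> 1" using seq_suble[OF r(1), of j] by simp
      then show "tail_fraction (r j) z * (A \<circ> r) j = (u z \<circ> r) j" by (simp add: ut)
    qed
    ultimately show ?thesis by (rule Lim_transform_eventually)
  qed
  have "L * LA \<le> L' * LA"
    by (rule subseq_limits_le[OF cmp2[OF _ xx'] s lu[OF s(1) lim(1)] lu[OF s(2) lim(2)]])
  then show ?thesis using LApos by simp
qed

end

section \<open>Convergence of the measures\<close>

lemma cdf_distr_uminus:
  assumes "sets \<nu> = sets borel"
  shows "cdf (distr \<nu> borel uminus) x = measure \<nu> {- x..}"
proof -
  have "cdf (distr \<nu> borel uminus) x = measure \<nu> (uminus -` {..x} \<inter> space \<nu>)"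
    unfolding cdf_def using assms by (intro measure_distr) (auto cong: measurable_cong_sets)
  also have "uminus -` {..x} \<inter> space \<nu> = {- x..}" using sets_eq_imp_space_eq[OF assms] by auto
  finally show ?thesis .
qed

text \<open>Reflection turns upper half-lines into lower ones, where distribution functions
  determine the measure.\<close>

lemma measure_eqI_atLeast:
  fixes \<mu> \<nu> :: "real measure"
  assumes \<mu>: "prob_space \<mu>" "sets \<mu> = sets borel" and \<nu>: "prob_space \<nu>" "sets \<nu> = sets borel"
    and eq: "\<And>r. measure \<mu> {r..} = measure \<nu> {r..}"
  shows "\<mu> = \<nu>"
proof -
  have d: "distr (distr m borel uminus) borel uminus = m" if "sets m = sets borel" for m :: "real measure"
  proof -
    have "distr (distr m borel uminus) borel uminus = distr m borel (uminus \<circ> uminus)"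
      using that by (intro distr_distr) (auto cong: measurable_cong_sets)
    also have "\<dots> = distr m borel (\<lambda>x. x)" by (simp add: o_def)
    also have "\<dots> = distr m m (\<lambda>x. x)" by (rule distr_cong) (use that in auto)
    also have "\<dots> = m" by (rule distr_id)
    finally show ?thesis .
  qed
  have rd: "real_distribution (distr m borel uminus)" if "prob_space m" "sets m = sets borel" for m :: "real measure"
  proof -
    interpret prob_space m by fact
    show ?thesis using that(2) by (intro real_distribution_distr) (auto cong: measurable_cong_sets)
  qed
  have "distr \<mu> borel uminus = distr \<nu> borel uminus"
    by (rule cdf_unique[OF rd[OF \<mu>] rd[OF \<nu>]]) (simp add: fun_eq_iff cdf_distr_uminus \<mu>(2) \<nu>(2) eq)
  then show ?thesis using d[OF \<mu>(2)] d[OF \<nu>(2)] by metis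
qed

text \<open>The atoms are countable, the interval is not.\<close>

lemma continuity_point_between:
  assumes "real_distribution M" "a < b"
  obtains z where "a < z" "z < b" "isCont (cdf M) z"
proof -
  interpret real_distribution M by fact
  have "\<not> {a<..<b} \<subseteq> {x. measure M {x} > 0}"
    using countable_atoms uncountable_open_interval[of a b] assms(2) countable_subset by blast
  then obtain z where "z \<in> {a<..<b}" "\<not> measure M {z} > 0" by blast
  then show ?thesis using that isCont_cdf[of z] measure_nonneg[of M "{z}"] by force
qed

lemma cdf_le_of_lt:
  assumes "real_distribution M" and le: "\<And>y. x < y \<Longrightarrow> c \<le> cdf M y"
  shows "c \<le> cdf M x"
proof -
  interpret real_distribution M by fact
  have "(cdf M \<longlongrightarrow> cdf M x) (at_right x)" using cdf_is_right_cont[of x] by (simp add: continuous_within)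
  moreover have "eventually (\<lambda>y. c \<le> cdf M y) (at_right x)"
    using eventually_at_right_less[of x] by eventually_elim (rule le)
  ultimately show ?thesis by (rule tendsto_lowerbound) simp
qed

section \<open>Tail fractions as reflected distribution functions\<close>

context filtered_domain
begin

lemma tail_fraction_antimono: "n \<ge> 1 \<Longrightarrow> x \<le> x' \<Longrightarrow> tail_fraction n x' \<le> tail_fraction n x"
  unfolding tail_fraction_def
  by (intro divide_right_mono of_nat_mono dim_mono_B[OF F_antimono F_le]) (auto intro: mult_left_mono)

lemma tail_fraction_range:
  obtains C where "C \<ge> 0" "\<And>n x. n \<ge> 1 \<Longrightarrow> x \<le> - C \<Longrightarrow> tail_fraction n x = 1"
    "\<And>n x. n \<ge> 1 \<Longrightarrow> x > C \<Longrightarrow> tail_fraction n x = 0"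
proof (rule F_range)
  fix C assume C: "C \<ge> 0" "\<And>n s. n \<ge> 1 \<Longrightarrow> s \<le> - C * real n \<Longrightarrow> F n s = B n"
    "\<And>n s. n \<ge> 1 \<Longrightarrow> s > C * real n \<Longrightarrow> F n s = {0}"
  show ?thesis
  proof (rule that[OF C(1)])
    show "tail_fraction n x = 1" if "n \<ge> 1" "x \<le> - C" for n x
    proof -
      have "real n * x \<le> - C * real n" using mult_left_mono[OF that(2), of "real n"] by (simp add: mult.commute)
      then show ?thesis unfolding tail_fraction_def using C(2)[OF that(1)] dim_B_pos[of n] by simp
    qed
    show "tail_fraction n x = 0" if "n \<ge> 1" "x > C" for n x
    proof -
      have "real n * x > C * real n" using that by simp
      moreover have "dim {0::'b} = 0" using dim_le_card[of "{0}" "{}"] by simp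
      ultimately show ?thesis unfolding tail_fraction_def using C(3)[OF that(1)] by simp
    qed
  qed
qed

text \<open>The dimension attains its minimum over all indices below \<open>s\<close>, and left
  continuity extends the constancy up to \<open>s\<close>. After reflection this is right continuity
  of the distribution function.\<close>

lemma F_left_constant: assumes n: "n \<ge> 1" obtains t0 where "t0 < s" "\<And>t. t0 \<le> t \<Longrightarrow> t \<le> s \<Longrightarrow> F n t = F n s"
proof -
  obtain t0 where t0: "t0 < s" "\<And>t. t < s \<Longrightarrow> dim (F n t0) \<le> dim (F n t)"
    using ex_has_least_nat[of "\<lambda>t. t < s" "s - 1" "\<lambda>t. dim (F n t)"] by auto
  have eq: "F n t = F n t0" if "t0 \<le> t" "t < s" for t
  proof (rule subspace_dim_eq[OF F_subspace[OF n] F_subspace[OF n] F_antimono[OF n that(1)] F_le[OF n]])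
    show "dim (F n t) = dim (F n t0)"
      using t0(2)[OF that(2)] dim_mono_B[OF F_antimono[OF n that(1)] F_le[OF n]] by simp
  qed
  have "F n t0 \<subseteq> F n t" if "t < s" for t
    using eq[of t] F_antimono[OF n, of t t0] that by (cases "t0 \<le> t") auto
  moreover have "F n s = (\<Inter>t\<in>{..<s}. F n t)" using lcont[OF n] unfolding left_continuous_def by blast
  ultimately have "F n t0 \<subseteq> F n s" by blast
  then have ts: "F n s = F n t0" using F_antimono[OF n, of t0 s] t0(1) by auto
  have "F n t = F n s" if "t0 \<le> t" "t \<le> s" for t using eq[of t] ts that by (cases "t = s") auto
  then show ?thesis using that t0(1) by blast
qed

text \<open>Reflection turns the left continuous tail function into a distribution function.\<close>

definition refl_measure :: "nat \<Rightarrow> real measure" where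
  "refl_measure n = interval_measure (\<lambda>x. tail_fraction n (- x))"

lemma refl_measure:
  assumes n: "n \<ge> 1"
  shows "real_distribution (refl_measure n)" "cdf (refl_measure n) = (\<lambda>x. tail_fraction n (- x))"
proof -
  let ?H = "\<lambda>x. tail_fraction n (- x)"
  have mono: "?H x \<le> ?H x'" if "x \<le> x'" for x x' using tail_fraction_antimono[OF n] that by simp
  have rc: "continuous (at_right a) ?H" for a
  proof -
    obtain t0 where t0: "t0 < real n * (- a)" "\<And>t. t0 \<le> t \<Longrightarrow> t \<le> real n * (- a) \<Longrightarrow> F n t = F n (real n * (- a))"
      using F_left_constant[OF n] by blast
    have "- t0 / real n > a" using t0(1) n by (simp add: field_simps)
    moreover have "?H x = ?H a" if "a < x" "x < - t0 / real n" for x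
    proof -
      have "t0 \<le> real n * (- x)" using that(2) n by (simp add: field_simps)
      moreover have "real n * (- x) \<le> real n * (- a)" using that(1) by (intro mult_left_mono) auto
      ultimately show ?thesis unfolding tail_fraction_def using t0(2) by metis
    qed
    ultimately have "eventually (\<lambda>x. ?H a = ?H x) (at_right a)" unfolding eventually_at_right_field by (metis (no_types))
    then have "(?H \<longlongrightarrow> ?H a) (at_right a)" using tendsto_const Lim_transform_eventually by fast
    then show ?thesis by (simp add: continuous_within)
  qed
  obtain C where C: "C \<ge> 0" "\<And>x. x \<le> - C \<Longrightarrow> tail_fraction n x = 1" "\<And>x. x > C \<Longrightarrow> tail_fraction n x = 0"
    using tail_fraction_range n by metis
  have "eventually (\<lambda>x. 0 = ?H x) at_bot" unfolding eventually_at_bot_dense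
    using C(3) by (intro exI[of _ "- C"]) auto
  then have bot: "(?H \<longlongrightarrow> 0) at_bot" using tendsto_const Lim_transform_eventually by fast
  have "eventually (\<lambda>x. 1 = ?H x) at_top" unfolding eventually_at_top_linorder
    using C(2) by (intro exI[of _ C]) auto
  then have top: "(?H \<longlongrightarrow> 1) at_top" using tendsto_const Lim_transform_eventually by fast
  show "real_distribution (refl_measure n)" unfolding refl_measure_def
    by (rule real_distribution_interval_measure[OF mono rc bot top])
  show "cdf (refl_measure n) = ?H" unfolding refl_measure_def by (rule cdf_interval_measure[OF mono rc bot])
qed

text \<open>Existence for the definite description: reflecting back and scaling by \<open>n\<close>
  gives the required tails. Uniqueness is \<open>measure_eqI_atLeast\<close>.\<close>

lemma filt_measure_eq:
  assumes n: "n \<ge> 1"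
  shows "filt_measure sc (B n) (F n) = distr (refl_measure n) borel (\<lambda>x. - (real n * x))"
proof -
  interpret R: real_distribution "refl_measure n" by (rule refl_measure(1)[OF n])
  let ?\<nu> = "distr (refl_measure n) borel (\<lambda>x. - (real n * x))"
  let ?P = "\<lambda>\<nu>. prob_space \<nu> \<and> sets \<nu> = sets borel \<and> (\<forall>r. measure \<nu> {r..} = real (dim (F n r)) / real (dim (B n)))"
  have "measure ?\<nu> {r..} = real (dim (F n r)) / real (dim (B n))" for r
  proof -
    have "measure ?\<nu> {r..} = measure (refl_measure n) ((\<lambda>x. - (real n * x)) -` {r..} \<inter> space (refl_measure n))"
      by (rule measure_distr) auto
    also have "(\<lambda>x. - (real n * x)) -` {r..} \<inter> space (refl_measure n) = {..- (r / real n)}"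
      using n by (auto simp: field_simps)
    also have "measure (refl_measure n) {..- (r / real n)} = tail_fraction n (r / real n)"
      using refl_measure(2)[OF n] unfolding cdf_def fun_eq_iff by simp
    finally show ?thesis using n by (simp add: tail_fraction_def)
  qed
  moreover have "prob_space ?\<nu>" by (rule R.prob_space_distr) simp
  ultimately have P: "?P ?\<nu>" by simp
  show ?thesis unfolding filt_measure_def
  proof (rule the_equality[of ?P, OF P])
    fix \<nu> assume "?P \<nu>"
    then show "\<nu> = ?\<nu>" using P by (intro measure_eqI_atLeast) auto
  qed
qed

lemma dilate_filt_measure:
  assumes n: "n \<ge> 1"
  shows "dilate (1 / real n) (filt_measure sc (B n) (F n)) = distr (refl_measure n) borel uminus"
proof -
  interpret R: real_distribution "refl_measure n" by (rule refl_measure(1)[OF n])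
  have "dilate (1 / real n) (filt_measure sc (B n) (F n))
      = distr (refl_measure n) borel ((\<lambda>x. 1 / real n * x) \<circ> (\<lambda>x. - (real n * x)))"
    unfolding dilate_def filt_measure_eq[OF n] by (rule distr_distr) auto
  also have "(\<lambda>x. 1 / real n * x) \<circ> (\<lambda>x. - (real n * x)) = uminus" using n by (auto simp: o_def)
  finally show ?thesis .
qed

lemma refl_measure_supported:
  obtains c where "c > 0" "\<And>n. n \<ge> 1 \<Longrightarrow> cdf (refl_measure n) (- c) = 0" "\<And>n. n \<ge> 1 \<Longrightarrow> cdf (refl_measure n) c = 1"
proof -
  obtain C where C: "C \<ge> 0" "\<And>n x. n \<ge> 1 \<Longrightarrow> x \<le> - C \<Longrightarrow> tail_fraction n x = 1"
    "\<And>n x. n \<ge> 1 \<Longrightarrow> x > C \<Longrightarrow> tail_fraction n x = 0"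
    using tail_fraction_range by metis
  \<comment> \<open>The tail fraction is known to vanish only strictly beyond \<open>C\<close>; the
    shift by \<open>1\<close> also makes \<open>c\<close> positive.\<close>
  show ?thesis using that[of "C + 1"] C by (simp add: refl_measure(2))
qed

lemma dilate_filt_measure_supported:
  "\<exists>a b. \<forall>n\<ge>1. measure (dilate (1 / real n) (filt_measure sc (B n) (F n))) (- {a..b}) = 0"
proof -
  obtain c where c: "c > 0" "\<And>n. n \<ge> 1 \<Longrightarrow> cdf (refl_measure n) (- c) = 0" "\<And>n. n \<ge> 1 \<Longrightarrow> cdf (refl_measure n) c = 1"
    using refl_measure_supported by metis
  have "measure (dilate (1 / real n) (filt_measure sc (B n) (F n))) (- {- c..c}) = 0" if n: "n \<ge> 1" for n
  proof -
    interpret R: real_distribution "refl_measure n" by (rule refl_measure(1)[OF n])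
    have "measure (distr (refl_measure n) borel uminus) (- {- c..c})
        = measure (refl_measure n) (uminus -` (- {- c..c}) \<inter> space (refl_measure n))"
      by (rule measure_distr) auto
    also have "\<dots> \<le> measure (refl_measure n) ({..- c} \<union> (space (refl_measure n) - {..c}))"
      by (rule R.finite_measure_mono) auto
    also have "\<dots> \<le> measure (refl_measure n) {..- c} + measure (refl_measure n) (space (refl_measure n) - {..c})"
      by (rule measure_Un_le) auto
    also have "measure (refl_measure n) (space (refl_measure n) - {..c}) = 1 - measure (refl_measure n) {..c}"
      by (rule R.prob_compl) auto
    finally have "measure (distr (refl_measure n) borel uminus) (- {- c..c}) \<le> 0"
      using c(2,3)[OF n] unfolding cdf_def by simp
    then show ?thesis unfolding dilate_filt_measure[OF n] using measure_nonneg by (intro antisym) auto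
  qed
  then show ?thesis by blast
qed

text \<open>\<open>tail_fraction_limits_le\<close> needs strictly ordered points, so it is applied
  at continuity points \<open>z < z'\<close> to the right of \<open>x\<close>, and right continuity
  lets both approach \<open>x\<close>. By symmetry any two subsequential limits coincide.\<close>

lemma cdf_subseq_limits_le:
  assumes s: "strict_mono s" "strict_mono s'" and M: "real_distribution M" "real_distribution M'"
    and w: "weak_conv_m ((\<lambda>j. refl_measure (Suc j)) \<circ> s) M" "weak_conv_m ((\<lambda>j. refl_measure (Suc j)) \<circ> s') M'"
  shows "cdf M x \<le> cdf M' x"
proof (rule cdf_le_of_lt[OF M(2)])
  fix x' assume "x < x'"
  \<comment> \<open>The midpoint separates the continuity points of the two limit measures.\<close>
  then have "x < (x + x') / 2" "(x + x') / 2 < x'" by auto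
  then obtain z z' where z: "x < z" "z < (x + x') / 2" "isCont (cdf M) z"
    and z': "(x + x') / 2 < z'" "z' < x'" "isCont (cdf M') z'"
    using continuity_point_between[OF M(1)] continuity_point_between[OF M(2)] by metis
  have lim: "(\<lambda>j. tail_fraction (Suc (r j)) (- a)) \<longlonglongrightarrow> cdf N a"
    if "weak_conv_m ((\<lambda>j. refl_measure (Suc j)) \<circ> r) N" "isCont (cdf N) a" for r N a
    using that unfolding weak_conv_m_def weak_conv_def by (simp add: refl_measure(2))
  have sm: "strict_mono (\<lambda>j. Suc (r j))" if "strict_mono r" for r using that by (simp add: strict_mono_def)
  have "cdf M z \<le> cdf M' z'"
    by (rule tail_fraction_limits_le[OF _ sm[OF s(1)] sm[OF s(2)] lim[OF w(1) z(3)] lim[OF w(2) z'(3)]])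
      (use z z' in simp)
  moreover have "cdf M x \<le> cdf M z" "cdf M' z' \<le> cdf M' x'"
    using finite_borel_measure.cdf_nondecreasing[OF real_distribution.finite_borel_measure_M[OF M(1)]]
      finite_borel_measure.cdf_nondecreasing[OF real_distribution.finite_borel_measure_M[OF M(2)]] z(1) z'(2) by auto
  ultimately show "cdf M x \<le> cdf M' x'" by linarith
qed

text \<open>The common bounded support gives tightness, hence convergent subsequences, whose limits
  all agree. Indices are shifted by \<open>Suc\<close> because the measures are controlled only for
  \<open>n \<ge> 1\<close>.\<close>

lemma refl_measure_weak_conv:
  obtains M where "real_distribution M" "weak_conv_m (\<lambda>j. refl_measure (Suc j)) M"
proof -
  let ?\<mu> = "\<lambda>j. refl_measure (Suc j)"
  obtain c where c: "c > 0" "\<And>n. n \<ge> 1 \<Longrightarrow> cdf (refl_measure n) (- c) = 0" "\<And>n. n \<ge> 1 \<Longrightarrow> cdf (refl_measure n) c = 1"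
    using refl_measure_supported by metis
  have rd: "real_distribution (?\<mu> j)" for j by (rule refl_measure(1)) simp
  have "measure (?\<mu> j) {- c<..c} = 1" for j
  proof -
    interpret real_distribution "?\<mu> j" by (rule rd)
    have "cdf (?\<mu> j) c - cdf (?\<mu> j) (- c) = measure (?\<mu> j) {- c<..c}" by (rule cdf_diff_eq) (use c(1) in simp)
    then show ?thesis using c(2,3)[of "Suc j"] by simp
  qed
  then have tight: "tight ?\<mu>" unfolding tight_def using rd c(1) by (intro conjI allI impI exI[of _ "- c"] exI[of _ c]) auto
  obtain r M where r: "strict_mono r" "real_distribution M" "weak_conv_m (?\<mu> \<circ> id \<circ> r) M"
    using tight_imp_convergent_subsubsequence[OF tight, of id] by (auto simp: strict_mono_def)
  have wr: "weak_conv_m (?\<mu> \<circ> r) M" using r(3) by simp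
  have "weak_conv_m ?\<mu> M"
  proof (rule tight_subseq_weak_converge[OF rd r(2) tight])
    fix s \<nu> assume s: "strict_mono s" "real_distribution \<nu>" "weak_conv_m (?\<mu> \<circ> s) \<nu>"
    have "cdf \<nu> x = cdf M x" for x
      using cdf_subseq_limits_le[OF s(1) r(1) s(2) r(2) s(3) wr] cdf_subseq_limits_le[OF r(1) s(1) r(2) s(2) wr s(3)]
      by (intro antisym)
    then have "\<nu> = M" by (intro cdf_unique[OF s(2) r(2)]) auto
    then show "weak_conv_m (?\<mu> \<circ> s) M" using s(3) by simp
  qed
  then show ?thesis using that r(2) by blast
qed

lemma dilate_filt_measure_vague_conv:
  "\<exists>\<mu>. prob_space \<mu> \<and> sets \<mu> = sets borel \<and> vague_conv (\<lambda>n. dilate (1 / real n) (filt_measure sc (B n) (F n))) \<mu>"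
proof -
  obtain M where M: "real_distribution M" "weak_conv_m (\<lambda>j. refl_measure (Suc j)) M" using refl_measure_weak_conv by metis
  interpret M: real_distribution M by (rule M(1))
  have "vague_conv (\<lambda>n. dilate (1 / real n) (filt_measure sc (B n) (F n))) (distr M borel uminus)"
    unfolding vague_conv_def
  proof (intro allI impI)
    fix g :: "real \<Rightarrow> real" assume g: "continuous_on UNIV g" "compact (closure {x. g x \<noteq> 0})"
    have gm: "g \<in> borel_measurable borel" using g(1) by (rule borel_measurable_continuous_onI)
    \<comment> \<open>Compact support makes \<open>g\<close> bounded, so weak convergence applies to
      the reflected function.\<close>
    have "compact (g ` closure {x. g x \<noteq> 0})" using g by (intro compact_continuous_image continuous_on_subset[OF g(1)]) auto
    then obtain K where K: "\<And>x. x \<in> closure {x. g x \<noteq> 0} \<Longrightarrow> norm (g x) \<le> K"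
      using compact_imp_bounded bounded_iff by (metis imageI)
    have bound: "norm (g (- x)) \<le> max K 0" for x
      using K[of "- x"] closure_subset[of "{x. g x \<noteq> 0}"] by (cases "g (- x) = 0") auto
    have cont: "isCont (\<lambda>x. g (- x)) x" for x
      using g(1) by (intro continuous_at_compose[of x uminus g, unfolded o_def] continuous_intros)
        (auto simp: continuous_on_eq_continuous_at)
    have "(\<lambda>j. integral\<^sup>L (refl_measure (Suc j)) (\<lambda>x. g (- x))) \<longlonglongrightarrow> integral\<^sup>L M (\<lambda>x. g (- x))"
      by (rule weak_conv_imp_integral_bdd_continuous_conv[OF refl_measure(1) M cont bound]) simp
    moreover have "integral\<^sup>L (dilate (1 / real (Suc j)) (filt_measure sc (B (Suc j)) (F (Suc j)))) g
        = integral\<^sup>L (refl_measure (Suc j)) (\<lambda>x. g (- x))" for j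
    proof -
      interpret R: real_distribution "refl_measure (Suc j)" by (rule refl_measure(1)) simp
      have "dilate (1 / real (Suc j)) (filt_measure sc (B (Suc j)) (F (Suc j))) = distr (refl_measure (Suc j)) borel uminus"
        by (rule dilate_filt_measure) simp
      then show ?thesis using gm by (simp only:) (rule integral_distr, auto)
    qed
    moreover have "integral\<^sup>L (distr M borel uminus) g = integral\<^sup>L M (\<lambda>x. g (- x))"
      using gm by (intro integral_distr) auto
    ultimately have "(\<lambda>j. integral\<^sup>L (dilate (1 / real (Suc j)) (filt_measure sc (B (Suc j)) (F (Suc j)))) g)
        \<longlonglongrightarrow> integral\<^sup>L (distr M borel uminus) g" by simp
    \<comment> \<open>Undoes the index shift: one initial term does not affect the limit.\<close>
    then show "(\<lambda>n. integral\<^sup>L (dilate (1 / real n) (filt_measure sc (B n) (F n))) g) \<longlonglongrightarrow> integral\<^sup>L (distr M borel uminus) g"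
      by (rule LIMSEQ_imp_Suc)
  qed
  moreover have "prob_space (distr M borel uminus)" by (rule M.prob_space_distr) simp
  ultimately show ?thesis by (intro exI[of _ "distr M borel uminus"]) simp
qed

end

theorem mainTheorem20:
  fixes sc :: "'k::field \<Rightarrow> 'b::idom \<Rightarrow> 'b"
    and B :: "nat \<Rightarrow> 'b set"
    and F :: "nat \<Rightarrow> real \<Rightarrow> 'b set"
    and f :: "nat \<Rightarrow> real"
  assumes f_nonneg: "\<And>n. f n \<ge> 0"
    and f_mono: "mono f"
    and f_sum: "summable (\<lambda>\<alpha>::nat. f (2 ^ \<alpha>) / 2 ^ \<alpha>)"
    and graded: "graded_algebra sc B"
    and fin_type: "finite_type sc"
    and gen_B1: "alg_gen sc (B 1) = UNIV"
    and krull: "krull_dim TYPE('b) > 0"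
    and filt: "\<And>n. n \<ge> 1 \<Longrightarrow> filtration_on sc (B n) (F n)"
    and sep: "\<And>n. n \<ge> 1 \<Longrightarrow> separated (F n)"
    and exh: "\<And>n. n \<ge> 1 \<Longrightarrow> exhaustive (B n) (F n)"
    and lcont: "\<And>n. n \<ge> 1 \<Longrightarrow> left_continuous (F n)"
    and pf: "pseudo_filtered f F"
    and bounded: "limsup (\<lambda>n. SUP a\<in>B n - {0}. filt_index (F n) a / ereal (real n)) < \<infinity>"
  shows "(\<exists>a b. \<forall>n\<ge>1. measure (dilate (1 / real n) (filt_measure sc (B n) (F n))) (- {a..b}) = 0)
       \<and> (\<exists>\<mu>. prob_space \<mu> \<and> sets \<mu> = sets borel \<and>
            vague_conv (\<lambda>n. dilate (1 / real n) (filt_measure sc (B n) (F n))) \<mu>)"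
proof -
  obtain y p \<omega> where "graded_domain sc B y p \<omega>"
    by (rule graded_domain_exists[OF graded fin_type gen_B1 krull])
  then interpret graded_domain sc B y p \<omega> .
  interpret filtered_domain sc B y p \<omega> F f
    by unfold_locales (fact f_nonneg f_mono f_sum filt sep exh lcont pf bounded)+
  show ?thesis using dilate_filt_measure_supported dilate_filt_measure_vague_conv by blast
qed

end
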